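(* For every $\varepsilon>0$ there exist $C=C(\varepsilon)>0$ and $\beta=\beta(\varepsilon)>0$ such that for every $p=p(n)\ge C\frac{\ln n}{n}$ and every $v_0\in[n]$, a random graph $G\sim G(n,p)$ is with high probability such that, for $L=(1+\varepsilon)n\ln n$, the trace $\Gamma=\Gamma^{v_0}_L(G)$ of a simple random walk of length $L$ on $G$ starting at $v_0$ has, with high probability, the following two properties: (E1) every set $A\subseteq[n]$ with $|A|\le\frac{n}{\ln n}$ satisfies $|N_\Gamma(A)|\ge|A|\cdot\beta\ln n$; (E2) there is an edge of $\Gamma$ between every pair of disjoint subsets $A,B\subseteq[n]$ with $|A|,|B|\ge\frac{n(\ln\ln n)^{1.5}}{\ln n}$.
   Context: $G(n,p)$ is the Erdős–Rényi random graph on $[n]$. A simple random walk on $G$ moves at each step to a uniformly random neighbour of the current vertex. The trace $\Gamma^{v_0}_L(G)$ is the multigraph on $[n]$ formed by the edges traversed in the first $L$ steps. $N_\Gamma(A)$ is the set of vertices outside $A$ having a $\Gamma$-neighbour in $A$. "With high probability" means with probability tending to $1$ as $n\to\infty$. *)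

theory Defs
  imports "HOL-Probability.Probability"
begin

text \<open>
  A simple graph is given by its edge set, an edge being a two-element set of vertices;
  a multigraph is given by its multiset of edges.
\<close>

definition all_edges :: "nat \<Rightarrow> nat set set" where
  "all_edges n = {e. e \<subseteq> {1..n} \<and> card e = 2}"

definition gnp :: "nat \<Rightarrow> real \<Rightarrow> nat set set pmf" where
  "gnp n p = map_pmf (\<lambda>f. {e \<in> all_edges n. f e})
     (Pi_pmf (all_edges n) False (\<lambda>_. bernoulli_pmf p))"

definition neighbours :: "nat set set \<Rightarrow> nat \<Rightarrow> nat set" where
  "neighbours G v = {w. {v, w} \<in> G}"

text \<open>
  The law of the list of vertices visited by the walk in its first \<open>k\<close> steps, the starting
  vertex included. A walk at an isolated vertex has no step to make and stops there.
\<close>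

primrec srw :: "nat set set \<Rightarrow> nat \<Rightarrow> nat \<Rightarrow> nat list pmf" where
  "srw G 0 v = return_pmf [v]"
| "srw G (Suc k) v =
     (if neighbours G v = {} then return_pmf [v]
      else bind_pmf (pmf_of_set (neighbours G v)) (\<lambda>w. map_pmf ((#) v) (srw G k w)))"

definition walk_edges :: "nat list \<Rightarrow> nat set multiset" where
  "walk_edges xs = mset (map2 (\<lambda>u v. {u, v}) xs (tl xs))"

text \<open>For a real number of steps \<open>L\<close>, the first \<open>L\<close> steps are those numbered \<open>1, \<dots>, \<lfloor>L\<rfloor>\<close>.\<close>

definition walk_trace :: "nat set set \<Rightarrow> nat \<Rightarrow> real \<Rightarrow> nat set multiset pmf" where
  "walk_trace G v0 L = map_pmf walk_edges (srw G (nat \<lfloor>L\<rfloor>) v0)"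

definition nbhd :: "nat \<Rightarrow> nat set multiset \<Rightarrow> nat set \<Rightarrow> nat set" where
  "nbhd n \<Gamma> A = {v \<in> {1..n} - A. \<exists>u\<in>A. {u, v} \<in># \<Gamma>}"

definition E1 :: "real \<Rightarrow> nat \<Rightarrow> nat set multiset \<Rightarrow> bool" where
  "E1 \<beta> n \<Gamma> \<longleftrightarrow>
     (\<forall>A \<subseteq> {1..n}. real (card A) \<le> real n / ln (real n) \<longrightarrow>
        real (card (nbhd n \<Gamma> A)) \<ge> real (card A) * (\<beta> * ln (real n)))"

definition E2 :: "nat \<Rightarrow> nat set multiset \<Rightarrow> bool" where
  "E2 n \<Gamma> \<longleftrightarrow>
     (\<forall>A B. A \<subseteq> {1..n} \<and> B \<subseteq> {1..n} \<and> A \<inter> B = {} \<and>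
        real (card A) \<ge> real n * ln (ln (real n)) powr 1.5 / ln (real n) \<and>
        real (card B) \<ge> real n * ln (ln (real n)) powr 1.5 / ln (real n) \<longrightarrow>
        (\<exists>a\<in>A. \<exists>b\<in>B. {a, b} \<in># \<Gamma>))"

definition whp :: "(nat \<Rightarrow> 'a pmf) \<Rightarrow> (nat \<Rightarrow> 'a \<Rightarrow> bool) \<Rightarrow> bool" where
  "whp M P \<longleftrightarrow> (\<lambda>n. measure_pmf.prob (M n) {x. P n x}) \<longlonglongrightarrow> 1"

text \<open>
  The nested form: with high probability \<open>x\<close> is such that, with high probability over the
  second source of randomness \<open>K n x\<close>, the property holds. The inner error bound \<open>\<delta>\<close> is a
  vanishing sequence not depending on \<open>x\<close>.
\<close>

definition whp_whp ::
  "(nat \<Rightarrow> 'a pmf) \<Rightarrow> (nat \<Rightarrow> 'a \<Rightarrow> 'b pmf) \<Rightarrow> (nat \<Rightarrow> 'b \<Rightarrow> bool) \<Rightarrow> bool" where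
  "whp_whp M K P \<longleftrightarrow>
     (\<exists>\<delta>. \<delta> \<longlonglongrightarrow> 0 \<and>
        whp M (\<lambda>n x. measure_pmf.prob (K n x) {y. P n y} \<ge> 1 - \<delta> n))"

end

theory Submission
  imports Defs "HOL-Real_Asymp.Real_Asymp"
begin

text \<open>
  By Markov's inequality it is enough to make the failure probability, averaged over the graph and
  the walk together, tend to \<open>0\<close>. Averaging allows one to reveal the graph along the walk.

  Fix a vertex \<open>w\<close> and consider the walk at \<open>v \<noteq> w\<close> given its past and the graph without \<open>w\<close>. If the
  edge \<open>vw\<close> was not traversed yet, adding it to the graph multiplies the probability of the past by
  \<open>(d/(d+1))\<^sup>m\<close>, where \<open>d\<close> is the degree of \<open>v\<close> and \<open>m\<close> the number of its exits. As long as
  \<open>m = O(ln n)\<close> and \<open>d\<close> is at least a large multiple of \<open>ln n\<close>, this factor is close to \<open>1\<close>, so the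
  next step leads to \<open>w\<close> with conditional probability close to \<open>1/n\<close>. Exponential supermartingales
  then show that no vertex is the first to be visited more than \<open>K ln n\<close> times, and that, subject to
  this cap, every vertex is visited at least \<open>4 \<rho> ln n\<close> times, the error for a single vertex
  being \<open>o(1/n)\<close>.

  For a fixed graph, the first exits of the vertices are dominated by independent uniform choices
  of neighbours. A small set violating (E1) would give two sets \<open>A \<subseteq> D\<close> with \<open>|D| \<le> 2 \<beta> |A| ln n\<close> and
  \<open>\<kappa> |A|\<close> edges of the trace inside \<open>D\<close> touching \<open>A\<close>, where \<open>\<kappa> \<approx> \<rho> ln n\<close>. A given set of \<open>m\<close> edges is traversed by
  first exits with probability at most \<open>(O(\<kappa>)/n)\<^sup>m\<close>, and a union bound concludes. For (E2) the
  union bound is over pairs of disjoint sets, using the exponential moment of the number of edges of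
  the graph between them.
\<close>


subsection \<open>Random subsets\<close>

text \<open>Revealing the graph along the walk meets one obstacle: the edges at \<open>w\<close>
  also determine the degree of \<open>w\<close>, so toggling an edge \<open>vw\<close> would disturb
  every past exit from \<open>w\<close>. The fixed weight \<open>1 / D\<close> for these exits
  removes the dependence. The price is that total weight is not conserved at \<open>w\<close>: it
  can grow there by a factor up to 2, and the exponents of both supermartingales drop by 1 at each
  exit from \<open>w\<close> to pay for it. Both visit estimates for \<open>w\<close> use a cap on
  the visits to the other vertices as well. Looking only at the first vertex to break the cap avoids
  circularity. The factor \<open>1 + \<epsilon>\<close> is decisive in one place: a vertex expects
  about \<open>(1 + \<epsilon>) ln n\<close> visits, and the bound for too few visits is of order
  \<open>n\<close> to the power \<open>-(1 + \<epsilon> / 2)\<close>, which survives a union over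
  the vertices. In the count for (E1), an edge lies in the graph with probability \<open>p\<close>
  and is then chosen by a given exit with probability about \<open>1 / (n p)\<close> at most. The
  \<open>p\<close> cancels, so the estimate is uniform in \<open>p\<close>.\<close>

definition subset_weight :: "real \<Rightarrow> 'a set \<Rightarrow> 'a set \<Rightarrow> real" where
  "subset_weight p E G = p ^ card G * (1 - p) ^ card (E - G)"

text \<open>An explicit finite sum in place of an integral over \<open>gnp\<close>: exchanging sums
  and comparing pointwise raise no integrability questions. \<open>expectation_gnp\<close> is the
  bridge.\<close>

definition subset_mean :: "real \<Rightarrow> 'a set \<Rightarrow> ('a set \<Rightarrow> real) \<Rightarrow> real" where
  "subset_mean p E f = (\<Sum>G\<in>Pow E. subset_weight p E G * f G)"

lemma subset_weight_nonneg: "0 \<le> p \<Longrightarrow> p \<le> 1 \<Longrightarrow> 0 \<le> subset_weight p E G"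
  by (simp add: subset_weight_def)

lemma subset_mean_empty: "subset_mean p {} f = f {}"
  by (simp add: subset_mean_def subset_weight_def)

lemma subset_mean_insert:
  assumes "finite E" "e \<notin> E"
  shows "subset_mean p (insert e E) f = p * subset_mean p E (\<lambda>G. f (insert e G)) + (1 - p) * subset_mean p E f"
proof -
  have inj: "inj_on (insert e) (Pow E)"
    using assms(2) unfolding inj_on_def by (metis Diff_insert_absorb PowD insert_absorb insert_ident subsetD)
  have disj: "Pow E \<inter> insert e ` Pow E = {}"
    using assms(2) by auto
  have 1: "subset_weight p (insert e E) (insert e G) = p * subset_weight p E G" if "G \<subseteq> E" for G
  proof -
    have "finite G" "e \<notin> G" using that assms finite_subset by auto
    moreover have "insert e E - insert e G = E - G" using assms(2) by auto
    ultimately show ?thesis by (simp add: subset_weight_def)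
  qed
  have 2: "subset_weight p (insert e E) G = (1 - p) * subset_weight p E G" if "G \<subseteq> E" for G
  proof -
    have "insert e E - G = insert e (E - G)" using assms(2) that by auto
    then show ?thesis using assms by (simp add: subset_weight_def)
  qed
  have "subset_mean p (insert e E) f = (\<Sum>G\<in>Pow E. subset_weight p (insert e E) G * f G)
      + (\<Sum>G\<in>insert e ` Pow E. subset_weight p (insert e E) G * f G)"
    unfolding subset_mean_def Pow_insert using assms disj by (intro sum.union_disjoint) auto
  also have "(\<Sum>G\<in>insert e ` Pow E. subset_weight p (insert e E) G * f G)
      = (\<Sum>G\<in>Pow E. p * (subset_weight p E G * f (insert e G)))"
    by (subst sum.reindex[OF inj]) (auto intro!: sum.cong simp: 1)
  also have "(\<Sum>G\<in>Pow E. subset_weight p (insert e E) G * f G) = (\<Sum>G\<in>Pow E. (1 - p) * (subset_weight p E G * f G))"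
    by (auto intro!: sum.cong simp: 2)
  finally show ?thesis
    by (simp add: subset_mean_def sum_distrib_left)
qed

lemma subset_mean_add: "subset_mean p E (\<lambda>G. f G + g G) = subset_mean p E f + subset_mean p E g"
  by (simp add: subset_mean_def sum.distrib distrib_left)

lemma subset_mean_diff: "subset_mean p E (\<lambda>G. f G - g G) = subset_mean p E f - subset_mean p E g"
  by (simp add: subset_mean_def sum_subtractf right_diff_distrib)

lemma subset_mean_cmult: "subset_mean p E (\<lambda>G. c * f G) = c * subset_mean p E f"
  by (simp add: subset_mean_def sum_distrib_left mult.left_commute)

lemma subset_mean_sum: "subset_mean p E (\<lambda>G. \<Sum>x\<in>A. f x G) = (\<Sum>x\<in>A. subset_mean p E (f x))"
  unfolding subset_mean_def by (simp add: sum_distrib_left) (rule sum.swap)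

lemma subset_mean_mono:
  assumes "0 \<le> p" "p \<le> 1" "\<And>G. G \<subseteq> E \<Longrightarrow> f G \<le> g G"
  shows "subset_mean p E f \<le> subset_mean p E g"
  unfolding subset_mean_def using assms by (intro sum_mono mult_left_mono) (auto simp: subset_weight_nonneg)

lemma subset_mean_nonneg:
  assumes "0 \<le> p" "p \<le> 1" "\<And>G. G \<subseteq> E \<Longrightarrow> 0 \<le> f G"
  shows "0 \<le> subset_mean p E f"
  unfolding subset_mean_def using assms by (intro sum_nonneg mult_nonneg_nonneg) (auto simp: subset_weight_nonneg)

lemma subset_mean_cong: "(\<And>G. G \<subseteq> E \<Longrightarrow> f G = g G) \<Longrightarrow> subset_mean p E f = subset_mean p E g"
  unfolding subset_mean_def by (intro sum.cong) auto

text \<open>Overwriting the state of \<open>e\<close> by a fresh coin does not change the law. Both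
  averages keep the ground set \<open>E\<close>, so they can be compared directly with a mean over
  the original graphs.\<close>

lemma subset_mean_toggle:
  assumes "finite E" "e \<in> E"
  shows "subset_mean p E f = p * subset_mean p E (\<lambda>G. f (insert e G)) + (1 - p) * subset_mean p E (\<lambda>G. f (G - {e}))"
proof -
  define E' where "E' = E - {e}"
  have E: "E = insert e E'" "finite E'" "e \<notin> E'" using assms by (auto simp: E'_def)
  have 1: "subset_mean p E' (\<lambda>G. f (G - {e})) = subset_mean p E' f"
    using E(3) by (intro subset_mean_cong arg_cong[of _ _ f]) auto
  have 2: "subset_mean p E (\<lambda>G. f (insert e G)) = subset_mean p E' (\<lambda>G. f (insert e G))"
    unfolding E(1) subset_mean_insert[OF E(2,3)] insert_absorb2 by (simp add: left_diff_distrib)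
  have 3: "subset_mean p E (\<lambda>G. f (G - {e})) = subset_mean p E' f"
    unfolding E(1) subset_mean_insert[OF E(2,3)] Diff_insert_absorb insert_Diff_single
    by (simp add: left_diff_distrib 1)
  show ?thesis
    unfolding 2 3 by (simp only: E(1) subset_mean_insert[OF E(2,3)])
qed

lemma subset_mean_prod:
  assumes "finite E"
  shows "subset_mean p E (\<lambda>G. \<Prod>e\<in>E. if e \<in> G then a e else b e) = (\<Prod>e\<in>E. p * a e + (1 - p) * b e)"
  using assms
proof (induction E)
  case empty
  then show ?case by (simp add: subset_mean_empty)
next
  case (insert e E)
  have 1: "subset_mean p E (\<lambda>G. \<Prod>x\<in>insert e E. if x \<in> insert e G then a x else b x)
    = subset_mean p E (\<lambda>G. a e * (\<Prod>x\<in>E. if x \<in> G then a x else b x))"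
    using insert.hyps by (intro subset_mean_cong) (auto intro!: prod.cong)
  have 2: "subset_mean p E (\<lambda>G. \<Prod>x\<in>insert e E. if x \<in> G then a x else b x)
    = subset_mean p E (\<lambda>G. b e * (\<Prod>x\<in>E. if x \<in> G then a x else b x))"
    using insert.hyps by (intro subset_mean_cong) auto
  show ?case
    unfolding subset_mean_insert[OF insert.hyps] 1 2 subset_mean_cmult insert.IH
    using insert.hyps by (simp add: algebra_simps)
qed

lemma subset_mean_const: "finite E \<Longrightarrow> subset_mean p E (\<lambda>_. c) = c"
  by (induction E rule: finite_induct) (auto simp: subset_mean_empty subset_mean_insert algebra_simps)

lemma subset_mean_subset:
  assumes "finite E" "F \<subseteq> E"
  shows "subset_mean p E (\<lambda>G. of_bool (F \<subseteq> G)) = p ^ card F"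
proof -
  have fF: "finite F" using assms finite_subset by blast
  have "subset_mean p E (\<lambda>G. of_bool (F \<subseteq> G)) = subset_mean p E (\<lambda>G. \<Prod>e\<in>E. if e \<in> G then 1 else of_bool (e \<notin> F))"
  proof (intro subset_mean_cong)
    fix G assume "G \<subseteq> E"
    show "of_bool (F \<subseteq> G) = (\<Prod>e\<in>E. if e \<in> G then 1 else of_bool (e \<notin> F) :: real)"
    proof (cases "F \<subseteq> G")
      case True
      then have "(\<Prod>e\<in>E. if e \<in> G then 1 else of_bool (e \<notin> F) :: real) = 1"
        by (intro prod.neutral) auto
      then show ?thesis using True by simp
    next
      case False
      then obtain e where "e \<in> F" "e \<notin> G" by auto
      then have "(\<Prod>e\<in>E. if e \<in> G then 1 else of_bool (e \<notin> F) :: real) = 0"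
        using assms by (intro prod_zero) auto
      then show ?thesis using False by simp
    qed
  qed
  also have "\<dots> = (\<Prod>e\<in>E. if e \<in> F then p else 1)"
    unfolding subset_mean_prod[OF assms(1)] by (intro prod.cong) auto
  also have "\<dots> = p ^ card F"
    using assms by (simp add: prod.If_cases Int_absorb1)
  finally show ?thesis .
qed

lemma subset_mean_exp_card:
  assumes "finite E" "F \<subseteq> E"
  shows "subset_mean p E (\<lambda>G. exp (s * real (card (G \<inter> F)))) = (1 + p * (exp s - 1)) ^ card F"
proof -
  have fF: "finite F" using assms finite_subset by blast
  have "subset_mean p E (\<lambda>G. exp (s * real (card (G \<inter> F))))
      = subset_mean p E (\<lambda>G. \<Prod>e\<in>E. if e \<in> G then (if e \<in> F then exp s else 1) else 1)"
  proof (intro subset_mean_cong)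
    fix G assume G: "G \<subseteq> E"
    have "(\<Prod>e\<in>E. if e \<in> G then (if e \<in> F then exp s else 1) else 1)
      = (\<Prod>e\<in>E. if e \<in> G \<inter> F then exp s else 1)" by (intro prod.cong) auto
    also have "\<dots> = exp s ^ card (E \<inter> (G \<inter> F))"
      using assms(1) by (simp add: prod.If_cases Collect_conj_eq)
    also have "E \<inter> (G \<inter> F) = G \<inter> F" using G by auto
    finally show "exp (s * real (card (G \<inter> F)))
      = (\<Prod>e\<in>E. if e \<in> G then (if e \<in> F then exp s else 1) else 1)"
      by (simp add: exp_of_nat2_mult)
  qed
  also have "\<dots> = (\<Prod>e\<in>E. if e \<in> F then 1 + p * (exp s - 1) else 1)"
    unfolding subset_mean_prod[OF assms(1)] by (intro prod.cong) (auto simp: algebra_simps)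
  also have "\<dots> = (1 + p * (exp s - 1)) ^ card F"
    using assms by (simp add: prod.If_cases Int_absorb1)
  finally show ?thesis .
qed

lemma subset_mean_exp_card_le:
  assumes "finite E" "F \<subseteq> E" "0 \<le> p" "p \<le> 1"
  shows "subset_mean p E (\<lambda>G. exp (s * real (card (G \<inter> F)))) \<le> exp (real (card F) * (p * (exp s - 1)))"
proof -
  have "(1 + p * (exp s - 1)) ^ card F \<le> exp (p * (exp s - 1)) ^ card F"
  proof (rule power_mono)
    have "1 + p * (exp s - 1) = (1 - p) + p * exp s" by (simp add: algebra_simps)
    then show "0 \<le> 1 + p * (exp s - 1)" using assms by (metis add_nonneg_nonneg diff_ge_0_iff_ge exp_ge_zero mult_nonneg_nonneg)
  qed (rule exp_ge_add_one_self)
  then show ?thesis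
    unfolding subset_mean_exp_card[OF assms(1,2)] by (simp add: exp_of_nat_mult)
qed

lemma finite_all_edges: "finite (all_edges n)"
  by (simp add: all_edges_def)

lemma expectation_random_subset:
  fixes f :: "'a set \<Rightarrow> real"
  assumes "finite E" "0 \<le> p" "p \<le> 1"
  shows "measure_pmf.expectation (Pi_pmf E False (\<lambda>_. bernoulli_pmf p)) (\<lambda>h. f {e\<in>E. h e}) = subset_mean p E f"
  using assms(1)
proof (induction E arbitrary: f)
  case empty
  then show ?case by (simp add: subset_mean_empty)
next
  case (insert e E)
  let ?P = "Pi_pmf E False (\<lambda>_. bernoulli_pmf p)"
  have fin: "finite (set_pmf ?P)"
    by (rule finite_subset[OF set_Pi_pmf_subset']) (use insert.hyps in auto)
  have *: "{x. (x = e \<or> x \<in> E) \<and> (if x = e then y else h x)}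
      = (if y then insert e {x\<in>E. h x} else {x\<in>E. h x})" for h y
    using insert.hyps by auto
  have "measure_pmf.expectation (Pi_pmf (insert e E) False (\<lambda>_. bernoulli_pmf p)) (\<lambda>h. f {x\<in>insert e E. h x})
     = (\<Sum>y\<in>UNIV. pmf (bernoulli_pmf p) y *\<^sub>R
          measure_pmf.expectation ?P (\<lambda>h. f (if y then insert e {x\<in>E. h x} else {x\<in>E. h x})))"
    unfolding Pi_pmf_insert'[OF insert.hyps(1,2)]
    using fin by (subst pmf_expectation_bind[where A = UNIV]) (auto simp: map_pmf_def[symmetric] * if_distrib[of f])
  also have "\<dots> = p * subset_mean p E (\<lambda>G. f (insert e G)) + (1 - p) * subset_mean p E f"
    using assms insert.IH[of f] insert.IH[of "\<lambda>G. f (insert e G)"] by (simp add: UNIV_bool)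
  finally show ?case using subset_mean_insert[OF insert.hyps(1,2)] by metis
qed

lemma expectation_gnp:
  assumes "0 \<le> p" "p \<le> 1"
  shows "measure_pmf.expectation (gnp n p) f = subset_mean p (all_edges n) f"
  unfolding gnp_def integral_map_pmf
  by (rule expectation_random_subset[OF finite_all_edges assms])

lemma prob_gnp:
  assumes "0 \<le> p" "p \<le> 1"
  shows "measure_pmf.prob (gnp n p) {G. P G} = subset_mean p (all_edges n) (\<lambda>G. of_bool (P G))"
proof -
  have "measure_pmf.prob (gnp n p) {G. P G} = measure_pmf.expectation (gnp n p) (indicator {G. P G})"
    by simp
  then show ?thesis
    unfolding expectation_gnp[OF assms] by (simp add: indicator_def of_bool_def subset_mean_def)
qed

subsection \<open>Walks\<close>

lemma neighbours_subset: "G \<subseteq> all_edges n \<Longrightarrow> neighbours G v \<subseteq> {1..n} - {v}"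
  unfolding neighbours_def all_edges_def by (auto simp: card_insert_if)

lemma finite_neighbours: "G \<subseteq> all_edges n \<Longrightarrow> finite (neighbours G v)"
  by (rule finite_subset[OF neighbours_subset]) auto

lemma measure_bind_pmf:
  "measure_pmf.prob (bind_pmf M f) X = measure_pmf.expectation M (\<lambda>x. measure_pmf.prob (f x) X)"
  unfolding measure_pmf_bind
  by (rule measure_pmf.measure_bind[where N = "count_space UNIV"])
    (auto simp: measure_pmf_in_subprob_algebra)

lemma srw_prob_Suc:
  assumes "finite (neighbours G v)" "neighbours G v \<noteq> {}"
  shows "measure_pmf.prob (srw G (Suc k) v) {ys. Q ys}
    = (\<Sum>x\<in>neighbours G v. measure_pmf.prob (srw G k x) {ys. Q (v # ys)} / real (card (neighbours G v)))"
proof -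
  let ?N = "neighbours G v"
  have "measure_pmf.prob (srw G (Suc k) v) {ys. Q ys}
      = measure_pmf.expectation (pmf_of_set ?N) (\<lambda>x. measure_pmf.prob (map_pmf ((#) v) (srw G k x)) {ys. Q ys})"
    using assms(2) by (simp add: measure_bind_pmf)
  also have "\<dots> = (\<Sum>x\<in>?N. measure_pmf.prob (srw G k x) {ys. Q (v # ys)}) / real (card ?N)"
    using assms by (simp add: integral_pmf_of_set vimage_def)
  finally show ?thesis by (simp add: sum_divide_distrib)
qed

text \<open>Absence of isolated vertices rules out early stopping; \<open>k\<close> steps then give
  \<open>k + 1\<close> entries, the start included.\<close>

lemma set_srw:
  assumes "\<And>u. neighbours G u \<subseteq> V" "\<And>u. u \<in> V \<Longrightarrow> neighbours G u \<noteq> {}" "finite V"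
    and "v \<in> V" "ys \<in> set_pmf (srw G k v)"
  shows "length ys = Suc k \<and> set ys \<subseteq> V"
  using assms(4,5)
proof (induction k arbitrary: v ys)
  case 0
  then show ?case by simp
next
  case (Suc k)
  have "finite (neighbours G v)" using assms(1,3) finite_subset by blast
  then show ?case using Suc assms(1,2) by (fastforce simp: set_pmf_of_set)
qed

subsection \<open>Weights of histories\<close>

text \<open>Histories of the walk are lists with the current vertex at the head.\<close>

text \<open>
  The probability of a history, except that every exit from \<open>w\<close> has weight \<open>1 / D\<close> whatever the
  degree of \<open>w\<close>. For \<open>D\<close> at most this degree it dominates the probability, and it depends on an edge
  at \<open>w\<close> only through the degree of the other endpoint.
\<close>

fun path_weight :: "nat \<Rightarrow> real \<Rightarrow> nat set set \<Rightarrow> nat list \<Rightarrow> real" where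
  "path_weight w D G (x # v # h) =
     (if {v, x} \<in> G then 1 / (if v = w then D else real (card (neighbours G v))) else 0) * path_weight w D G (v # h)"
| "path_weight w D G [x] = 1"
| "path_weight w D G [] = 1"

text \<open>The other ends of the edges at \<open>w\<close> that the history has already revealed.
  For these vertices the presence of the edge is certain; for all others it is still random.\<close>

fun walk_nbrs :: "nat \<Rightarrow> nat list \<Rightarrow> nat set" where
  "walk_nbrs w (x # v # h) =
     (if x = w then {v} else {}) \<union> (if v = w then {x} else {}) \<union> walk_nbrs w (v # h)"
| "walk_nbrs w [x] = {}"
| "walk_nbrs w [] = {}"

text \<open>Exits made when the edge to \<open>w\<close> was already revealed. Their chance of
  leading to \<open>w\<close> is of order \<open>1 / d\<close> instead of \<open>p / d\<close>,
  hence a separate term in the exponent of \<open>many_visits\<close>.\<close>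

fun nbr_exits :: "nat \<Rightarrow> nat list \<Rightarrow> nat" where
  "nbr_exits w (x # v # h) = (if v \<noteq> w \<and> v \<in> walk_nbrs w (v # h) then 1 else 0) + nbr_exits w (v # h)"
| "nbr_exits w [x] = 0"
| "nbr_exits w [] = 0"

text \<open>The walk \<open>ys\<close> continuing the history \<open>h\<close> reaches \<open>T\<close> before it leaves \<open>Adm\<close>.\<close>

fun hits :: "('a list \<Rightarrow> bool) \<Rightarrow> ('a list \<Rightarrow> bool) \<Rightarrow> 'a list \<Rightarrow> 'a list \<Rightarrow> bool" where
  "hits Adm T h [] = False"
| "hits Adm T h (v # ys) = (T (v # h) \<or> Adm (v # h) \<and> hits Adm T (v # h) ys)"

lemma finite_walk_nbrs: "finite (walk_nbrs w h)"
  by (induction w h rule: walk_nbrs.induct) auto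

text \<open>A visit to \<open>w\<close> reveals at most one edge on arrival and one on departure.
  The count over \<open>tl h\<close> is that of the departures: the current vertex has not been left
  yet.\<close>

lemma card_walk_nbrs: "card (walk_nbrs w h) \<le> count_list h w + count_list (tl h) w"
proof (induction w h rule: walk_nbrs.induct)
  case (1 w x v h)
  have "card (walk_nbrs w (x # v # h)) \<le> card (if x = w then {v} else {})
     + card (if v = w then {x} else {}) + card (walk_nbrs w (v # h))"
    unfolding walk_nbrs.simps by (rule order.trans[OF card_Un_le add_right_mono[OF card_Un_le]])
  then show ?case using "1" by (auto split: if_splits)
qed auto

text \<open>An exit is counted only from a vertex in the revealed set, and this set only grows. So
  all counted exits start in its final value, and \<open>count_list (tl h) y\<close> is the number
  of exits from \<open>y\<close>.\<close>

lemma nbr_exits_le: "nbr_exits w h \<le> (\<Sum>y\<in>walk_nbrs w h. count_list (tl h) y)"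
proof (induction w h rule: walk_nbrs.induct)
  case (1 w x v h)
  have "nbr_exits w (x # v # h) \<le> (\<Sum>y\<in>walk_nbrs w (v # h). count_list (v # h) y)"
  proof (cases "v \<noteq> w \<and> v \<in> walk_nbrs w (v # h)")
    case True
    have "(\<Sum>y\<in>walk_nbrs w (v # h). count_list (v # h) y)
       = (\<Sum>y\<in>walk_nbrs w (v # h). count_list h y + (if v = y then 1 else 0))"
      by (intro sum.cong) auto
    also have "\<dots> = (\<Sum>y\<in>walk_nbrs w (v # h). count_list h y) + 1"
      using True finite_walk_nbrs[of w "v # h"] by (simp add: sum.distrib)
    finally show ?thesis using True "1" by simp
  next
    case False
    then have "nbr_exits w (x # v # h) \<le> (\<Sum>y\<in>walk_nbrs w (v # h). count_list h y)" using "1" by auto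
    also have "\<dots> \<le> (\<Sum>y\<in>walk_nbrs w (v # h). count_list (v # h) y)" by (intro sum_mono) auto
    finally show ?thesis .
  qed
  also have "\<dots> \<le> (\<Sum>y\<in>walk_nbrs w (x # v # h). count_list (v # h) y)"
    using finite_walk_nbrs[of w "x # v # h"] by (intro sum_mono2) auto
  finally show ?case by simp
qed auto

lemma path_weight_nonneg: "0 < D \<Longrightarrow> 0 \<le> path_weight w D G h"
  by (induction w D G h rule: path_weight.induct) auto

lemma path_weight_eq_0: "y \<in> walk_nbrs w h \<Longrightarrow> {y, w} \<notin> G \<Longrightarrow> path_weight w D G h = 0"
  by (induction w h rule: walk_nbrs.induct) (auto simp: insert_commute split: if_splits)

lemma neighbours_insert: "y \<noteq> w \<Longrightarrow> neighbours (insert {y, w} G) u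
    = (if u = y then insert w (neighbours G y) else if u = w then insert y (neighbours G w) else neighbours G u)"
  by (auto simp: neighbours_def doubleton_eq_iff)

lemma neighbours_delete: "y \<noteq> w \<Longrightarrow> neighbours (G - {{y, w}}) u
    = (if u = y then neighbours G y - {w} else if u = w then neighbours G w - {y} else neighbours G u)"
  by (auto simp: neighbours_def doubleton_eq_iff)

text \<open>Only the degree of \<open>y\<close> is felt: the weight of exits from \<open>w\<close>
  ignores the degree of \<open>w\<close>, and the edge itself is not on the path. Each exit from
  \<open>y\<close> changes its factor from \<open>1 / d\<close> to
  \<open>1 / (d + 1)\<close>.\<close>

lemma path_weight_toggle:
  assumes "y \<noteq> w" "y \<notin> walk_nbrs w h" "finite (neighbours G y)"
    and "d = card (neighbours G y - {w})" "0 < d"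
  shows "path_weight w D (insert {y, w} G) h
    = (real d / (real d + 1)) ^ count_list (tl h) y * path_weight w D (G - {{y, w}}) h"
  using assms(2,1,4)
proof (induction w h rule: walk_nbrs.induct)
  case (1 w x v h)
  note yw = "1.prems"(2)
  have IH: "path_weight w D (insert {y, w} G) (v # h)
      = (real d / (real d + 1)) ^ count_list h y * path_weight w D (G - {{y, w}}) (v # h)"
    using "1" by auto
  have ne: "\<not> (v = y \<and> x = w)" "\<not> (v = w \<and> x = y)" using "1.prems" by auto
  then have e: "{v, x} \<in> insert {y, w} G \<longleftrightarrow> {v, x} \<in> G - {{y, w}}"
    by (auto simp: doubleton_eq_iff)
  have d1: "card (neighbours (insert {y, w} G) y) = d + 1"
  proof -
    show ?thesis using assms(3) "1.prems"(3) neighbours_insert[OF yw] by (simp add: card.insert_remove)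
  qed
  have d2: "card (neighbours (G - {{y, w}}) y) = d"
    using "1.prems"(3) neighbours_delete[OF yw] by simp
  have d3: "card (neighbours (insert {y, w} G) v) = card (neighbours (G - {{y, w}}) v)"
    if "v \<noteq> y" "v \<noteq> w" using that by (simp add: neighbours_insert[OF yw] neighbours_delete[OF yw])
  show ?case
  proof (cases "v = y")
    case True
    define q where "q = real d / (real d + 1)"
    have q: "1 / (real d + 1) = q * (1 / real d)" using \<open>0 < d\<close> by (simp add: q_def)
    have d1': "real (card (neighbours (insert {y, w} G) y)) = real d + 1" using d1 by simp
    show ?thesis
      unfolding path_weight.simps IH[folded q_def] e q_def[symmetric] unfolding True d1' d2
      using yw q by auto
  next
    case False
    then show ?thesis using e IH d3 by auto
  qed
qed auto

section \<open>Averaged chance of moving to a fixed vertex\<close>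

text \<open>\<open>w\<close> is the vertex whose visits are counted and \<open>M\<close> the cap on
  visits. By Bernoulli's inequality the condition on \<open>r\<close> makes it a lower bound for the
  factor \<open>(d / (d + 1)) ^ M\<close> arising from \<open>path_weight_toggle\<close>, for every
  \<open>d \<ge> D1\<close>.\<close>

locale visits =
  fixes n :: nat and p :: real and w :: nat and D1 D2 r :: real and M :: nat
  assumes p: "0 < p" "p \<le> 1" and w: "w \<in> {1..n}" and D1: "0 < D1"
    and r: "0 < r" "r \<le> 1 - real M / D1"
begin

abbreviation "E \<equiv> all_edges n"

text \<open>Degrees are taken without \<open>w\<close>, so the event does not depend on the edges at
  \<open>w\<close> and can be carried through a toggle of such an edge.\<close>

definition regular_off :: "nat set set \<Rightarrow> bool" where
  "regular_off G \<longleftrightarrow> (\<forall>v\<in>{1..n} - {w}. D1 \<le> real (card (neighbours G v - {w})) \<and> real (card (neighbours G v - {w})) \<le> D2)"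

text \<open>The unnormalised joint weight of the history and a regular graph. Working with it
  replaces conditioning on the past: a conditional probability becomes a ratio of two masses, which
  is never formed.\<close>

definition mass :: "nat list \<Rightarrow> real" where
  "mass h = subset_mean p E (\<lambda>G. of_bool (regular_off G) * path_weight w D1 G h)"

text \<open>The part of the mass that moves to \<open>w\<close> in the next step.\<close>

definition move_mass :: "nat list \<Rightarrow> real" where
  "move_mass h = subset_mean p E (\<lambda>G. of_bool (regular_off G) * path_weight w D1 G h * (of_bool ({hd h, w} \<in> G) / real (card (neighbours G (hd h)))))"

lemma subset_mean_p_mono: "(\<And>G. G \<subseteq> E \<Longrightarrow> f G \<le> g G) \<Longrightarrow> subset_mean p E f \<le> subset_mean p E g"
  using p by (intro subset_mean_mono) auto

lemma path_weight_pos: "0 \<le> path_weight w D1 G h"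
  using D1 by (rule path_weight_nonneg)

lemma mass_nonneg: "0 \<le> mass h"
  unfolding mass_def using p by (intro subset_mean_nonneg) (auto simp: path_weight_pos)

lemma edge_in_E: "y \<in> {1..n} \<Longrightarrow> y \<noteq> w \<Longrightarrow> {y, w} \<in> E"
  using w by (auto simp: all_edges_def)

lemma regular_off_insert: "y \<noteq> w \<Longrightarrow> regular_off (insert {y, w} G) = regular_off G"
  unfolding regular_off_def by (intro ball_cong refl) (auto simp: neighbours_insert)

lemma regular_off_delete: "y \<noteq> w \<Longrightarrow> regular_off (G - {{y, w}}) = regular_off G"
  unfolding regular_off_def by (intro ball_cong refl) (auto simp: neighbours_delete)

text \<open>The edge is added only inside the weight, so this is \<open>1 / p\<close> times the mass of the graphs containing it.\<close>

definition mass_with :: "nat \<Rightarrow> nat list \<Rightarrow> real" where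
  "mass_with y h = subset_mean p E (\<lambda>G. of_bool (regular_off G) * path_weight w D1 (insert {y, w} G) h)"

lemma subset_mean_edge:
  assumes "y \<in> {1..n}" "y \<noteq> w"
  shows "subset_mean p E (\<lambda>G. of_bool (regular_off G) * path_weight w D1 G h * (of_bool ({y, w} \<in> G) * f G))
    = p * subset_mean p E (\<lambda>G. of_bool (regular_off G) * path_weight w D1 (insert {y, w} G) h * f (insert {y, w} G))"
  by (subst subset_mean_toggle[OF finite_all_edges edge_in_E[OF assms]])
    (use assms in \<open>simp add: regular_off_insert subset_mean_def\<close>)

text \<open>The toggle writes \<open>mass h\<close> as
  \<open>p * mass_with y h + (1 - p) * Q\<close>, with \<open>Q\<close> the mass when the edge is
  removed. The degree factor is at most 1, and under the cap at least \<open>r\<close>. So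
  \<open>mass_with y h\<close> is at most \<open>Q\<close> and at least \<open>r * Q\<close>, and
  the mixture lies between the two.\<close>

lemma mass_toggle:
  assumes "y \<in> {1..n}" "y \<noteq> w" "y \<notin> walk_nbrs w h"
  shows "mass_with y h \<le> mass h"
    and "count_list (tl h) y \<le> M \<Longrightarrow> r * mass h \<le> mass_with y h"
proof -
  let ?e = "{y, w}"
  define Q where "Q = subset_mean p E (\<lambda>G. of_bool (regular_off G) * path_weight w D1 (G - {?e}) h)"
  have mass: "mass h = p * mass_with y h + (1 - p) * Q"
    unfolding mass_def mass_with_def Q_def
    by (subst subset_mean_toggle[OF finite_all_edges edge_in_E[OF assms(1,2)]])
      (use assms in \<open>simp add: regular_off_insert regular_off_delete\<close>)
  have t: "path_weight w D1 (insert ?e G) h \<le> path_weight w D1 (G - {?e}) h \<and>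
     (count_list (tl h) y \<le> M \<longrightarrow> r * path_weight w D1 (G - {?e}) h \<le> path_weight w D1 (insert ?e G) h)"
    if "G \<subseteq> E" "regular_off G" for G
  proof -
    define d where "d = card (neighbours G y - {w})"
    have dD: "D1 \<le> real d" using that assms unfolding regular_off_def d_def by auto
    then have d: "0 < d" using D1 by linarith
    let ?q = "real d / (real d + 1)"
    note tog = path_weight_toggle[OF assms(2,3) finite_neighbours[OF that(1)] d_def d, of D1]
    have q: "0 \<le> ?q" "?q \<le> 1" using d by auto
    have 1: "?q ^ k \<le> 1" for k using q by (rule power_le_one)
    have 2: "r \<le> ?q ^ k" if "k \<le> M" for k
    proof -
      have "real M / (real d + 1) \<le> real M / D1" using D1 dD by (intro divide_left_mono) auto
      then have "r \<le> 1 + real M * (-1 / (real d + 1))" using r by simp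
      also have "\<dots> \<le> (1 + (-1 / (real d + 1))) ^ M" by (rule Bernoulli_inequality) (auto simp: field_simps)
      also have "1 + (-1 / (real d + 1)) = ?q" by (simp add: field_simps)
      also have "?q ^ M \<le> ?q ^ k" using q that by (intro power_decreasing) auto
      finally show ?thesis .
    qed
    show ?thesis unfolding tog
      using mult_right_mono[OF 1 path_weight_pos] mult_right_mono[OF 2 path_weight_pos] by simp
  qed
  have PQ: "mass_with y h \<le> Q"
    unfolding mass_with_def Q_def by (rule subset_mean_p_mono) (use t in auto)
  have "(1 - p) * mass_with y h \<le> (1 - p) * Q" using PQ p by (intro mult_left_mono) auto
  then show "mass_with y h \<le> mass h" unfolding mass by (simp add: algebra_simps)
  assume c: "count_list (tl h) y \<le> M"
  have "p * mass_with y h \<le> p * Q" using PQ p by (intro mult_left_mono) auto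
  then have "mass h \<le> Q" unfolding mass by (simp add: algebra_simps)
  then have "r * mass h \<le> r * Q" using r by simp
  also have "r * Q \<le> mass_with y h"
    unfolding mass_with_def Q_def subset_mean_cmult[symmetric] by (rule subset_mean_p_mono) (use t c in auto)
  finally show "r * mass h \<le> mass_with y h" .
qed

lemma card_neighbours_w:
  assumes "G \<subseteq> E" "regular_off G" "v \<in> {1..n}" "v \<noteq> w"
  shows "D1 \<le> real (card (neighbours G v))" "real (card (neighbours G v)) \<le> D2 + 1"
proof -
  have f: "finite (neighbours G v)" using assms(1) by (rule finite_neighbours)
  have d: "D1 \<le> real (card (neighbours G v - {w}))" "real (card (neighbours G v - {w})) \<le> D2"
    using assms unfolding regular_off_def by auto
  have "card (neighbours G v - {w}) \<le> card (neighbours G v)" using f by (intro card_mono) auto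
  then show "D1 \<le> real (card (neighbours G v))" using d by linarith
  have "card (neighbours G v) \<le> card (neighbours G v - {w}) + 1"
    using f by (cases "w \<in> neighbours G v") auto
  then show "real (card (neighbours G v)) \<le> D2 + 1" using d by linarith
qed

lemma weighted_le: "(regular_off G \<Longrightarrow> t \<le> c) \<Longrightarrow> of_bool (regular_off G) * path_weight w D1 G' h * t \<le> c * (of_bool (regular_off G) * path_weight w D1 G' h)"
  using mult_right_mono[OF _ path_weight_pos, of t c G' h] by (cases "regular_off G") (auto simp: mult.commute)

lemma weighted_ge: "(regular_off G \<Longrightarrow> c \<le> t) \<Longrightarrow> c * (of_bool (regular_off G) * path_weight w D1 G' h) \<le> of_bool (regular_off G) * path_weight w D1 G' h * t"
  using mult_right_mono[OF _ path_weight_pos, of c t G' h] by (cases "regular_off G") (auto simp: mult.commute)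

text \<open>By \<open>mass_toggle\<close> an unrevealed edge is present with a chance close to
  \<open>p\<close> even given the past; the walk then uses it with probability one over the degree,
  which lies between \<open>D1\<close> and \<open>D2 + 1\<close>.\<close>

lemma move_mass_bounds_new:
  assumes "v \<in> {1..n}" "v \<noteq> w" "v \<notin> walk_nbrs w (v # h)"
  shows "move_mass (v # h) \<le> p / D1 * mass (v # h)"
    and "count_list h v \<le> M \<Longrightarrow> 0 \<le> D2 \<Longrightarrow> r * p / (D2 + 1) * mass (v # h) \<le> move_mass (v # h)"
proof -
  let ?f = "\<lambda>G. 1 / real (card (neighbours G v))"
  have "move_mass (v # h) = p * subset_mean p E (\<lambda>G. of_bool (regular_off G) * path_weight w D1 (insert {v, w} G) (v # h) * ?f (insert {v, w} G))"
    unfolding move_mass_def using subset_mean_edge[OF assms(1,2), of "v # h" ?f] by simp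
  note move_mass = this
  have b: "1 / (D2 + 1) \<le> ?f (insert {v, w} G)" "?f (insert {v, w} G) \<le> 1 / D1"
    if "G \<subseteq> E" "regular_off G" for G
  proof -
    have "insert {v, w} G \<subseteq> E" "regular_off (insert {v, w} G)"
      using that assms edge_in_E regular_off_insert by auto
    note c = card_neighbours_w[OF this assms(1,2)]
    show "?f (insert {v, w} G) \<le> 1 / D1" using D1 c by (intro divide_left_mono) auto
    show "1 / (D2 + 1) \<le> ?f (insert {v, w} G)" using D1 c by (intro divide_left_mono) auto
  qed
  have "move_mass (v # h) \<le> p * (1 / D1 * mass_with v (v # h))"
    unfolding move_mass mass_with_def subset_mean_cmult[symmetric] using p
    by (intro mult_left_mono subset_mean_p_mono weighted_le) (use b in auto)
  also have "\<dots> \<le> p * (1 / D1 * mass (v # h))"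
    using p D1 mass_toggle(1)[OF assms] by (intro mult_left_mono) auto
  finally show "move_mass (v # h) \<le> p / D1 * mass (v # h)" by simp
  assume c: "count_list h v \<le> M" and D2: "0 \<le> D2"
  have "r * p / (D2 + 1) * mass (v # h) = p * (1 / (D2 + 1) * (r * mass (v # h)))" by simp
  also have "\<dots> \<le> p * (1 / (D2 + 1) * mass_with v (v # h))"
    using p D2 mass_toggle(2)[OF assms] c by (intro mult_left_mono) auto
  also have "\<dots> \<le> move_mass (v # h)"
    unfolding move_mass mass_with_def subset_mean_cmult[symmetric] using p
    by (intro mult_left_mono subset_mean_p_mono weighted_ge) (use b in auto)
  finally show "r * p / (D2 + 1) * mass (v # h) \<le> move_mass (v # h)" .
qed

text \<open>After a traversal of \<open>vw\<close> only graphs containing this edge carry weight, so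
  no factor \<open>p\<close> appears. The lower bound is weakened by \<open>r * p \<le> 1\<close> to
  agree with that for an unrevealed edge.\<close>

lemma move_mass_bounds_old:
  assumes "v \<in> {1..n}" "v \<noteq> w" "v \<in> walk_nbrs w (v # h)"
  shows "move_mass (v # h) \<le> 1 / D1 * mass (v # h)"
    and "0 \<le> D2 \<Longrightarrow> r * p / (D2 + 1) * mass (v # h) \<le> move_mass (v # h)"
proof -
  let ?f = "\<lambda>G. 1 / real (card (neighbours G v))"
  have move_mass: "move_mass (v # h) = subset_mean p E (\<lambda>G. of_bool (regular_off G) * path_weight w D1 G (v # h) * ?f G)"
    unfolding move_mass_def using path_weight_eq_0[OF assms(3)] by (intro subset_mean_cong) auto
  have b: "1 / (D2 + 1) \<le> ?f G" "?f G \<le> 1 / D1" if "G \<subseteq> E" "regular_off G" for G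
  proof -
    note c = card_neighbours_w[OF that assms(1,2)]
    show "?f G \<le> 1 / D1" using D1 c by (intro divide_left_mono) auto
    show "1 / (D2 + 1) \<le> ?f G" using D1 c by (intro divide_left_mono) auto
  qed
  show "move_mass (v # h) \<le> 1 / D1 * mass (v # h)"
    unfolding move_mass mass_def subset_mean_cmult[symmetric]
    by (intro subset_mean_p_mono weighted_le) (use b in auto)
  assume D2: "0 \<le> D2"
  have "r * p \<le> 1 * 1" using r p D1 by (intro mult_mono) (auto intro: order.trans)
  then have "r * p / (D2 + 1) * mass (v # h) \<le> 1 / (D2 + 1) * mass (v # h)"
    using D2 by (intro mult_right_mono divide_right_mono mass_nonneg) auto
  also have "\<dots> \<le> move_mass (v # h)"
    unfolding move_mass mass_def subset_mean_cmult[symmetric]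
    by (intro subset_mean_p_mono weighted_ge) (use b in auto)
  finally show "r * p / (D2 + 1) * mass (v # h) \<le> move_mass (v # h)" .
qed

text \<open>Exits from \<open>v \<noteq> w\<close> carry their true probabilities, so mass is
  conserved in this step. As \<open>U\<close> takes one value at \<open>w\<close> and one elsewhere,
  only \<open>move_mass\<close> enters besides the total.\<close>

lemma step_other:
  assumes "v \<in> {1..n}" "v \<noteq> w"
    and U: "U (w # v # h) = Uw" "\<And>x. x \<noteq> w \<Longrightarrow> U (x # v # h) = Uo"
  shows "(\<Sum>x\<in>{1..n}. mass (x # v # h) * U (x # v # h)) = Uo * mass (v # h) + (Uw - Uo) * move_mass (v # h)"
proof -
  have "(\<Sum>x\<in>{1..n}. mass (x # v # h) * U (x # v # h))
      = subset_mean p E (\<lambda>G. \<Sum>x\<in>{1..n}. U (x # v # h) * (of_bool (regular_off G) * path_weight w D1 G (x # v # h)))"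
    unfolding mass_def subset_mean_sum subset_mean_cmult by (simp add: mult.commute)
  also have "\<dots> = subset_mean p E (\<lambda>G. Uo * (of_bool (regular_off G) * path_weight w D1 G (v # h))
      + (Uw - Uo) * (of_bool (regular_off G) * path_weight w D1 G (v # h) * (of_bool ({v, w} \<in> G) / real (card (neighbours G v)))))"
  proof (intro subset_mean_cong)
    fix G assume G: "G \<subseteq> E"
    let ?d = "real (card (neighbours G v))"
    have N: "neighbours G v \<subseteq> {1..n}" "finite (neighbours G v)"
      using neighbours_subset[OF G] finite_neighbours[OF G] by auto
    have s: "(\<Sum>x\<in>{1..n}. U (x # v # h) * (of_bool ({v, x} \<in> G) / ?d))
        = Uo + (Uw - Uo) * (of_bool ({v, w} \<in> G) / ?d)" if "regular_off G"
    proof -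
      have d: "0 < ?d" using card_neighbours_w(1)[OF G that assms(1,2)] D1 by linarith
      have "(\<Sum>x\<in>{1..n}. U (x # v # h) * (of_bool ({v, x} \<in> G) / ?d))
         = (\<Sum>x\<in>{1..n}. Uo * (of_bool (x \<in> neighbours G v) / ?d)
            + (if x = w then (Uw - Uo) * (of_bool ({v, w} \<in> G) / ?d) else 0))"
        using U by (intro sum.cong) (auto simp: neighbours_def algebra_simps diff_divide_distrib)
      also have "\<dots> = Uo * ((\<Sum>x\<in>{1..n}. of_bool (x \<in> neighbours G v)) / ?d)
          + (Uw - Uo) * (of_bool ({v, w} \<in> G) / ?d)"
        using w by (simp add: sum.distrib flip: sum_distrib_left sum_divide_distrib)
      also have "(\<Sum>x\<in>{1..n}. of_bool (x \<in> neighbours G v)) = ?d"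
        using N by (simp add: Int_absorb1)
      finally show ?thesis using d by simp
    qed
    have "(\<Sum>x\<in>{1..n}. U (x # v # h) * (of_bool (regular_off G) * path_weight w D1 G (x # v # h)))
      = of_bool (regular_off G) * path_weight w D1 G (v # h) * (\<Sum>x\<in>{1..n}. U (x # v # h) * (of_bool ({v, x} \<in> G) / ?d))"
      unfolding sum_distrib_left using assms(2) by (intro sum.cong) auto
    then show "(\<Sum>x\<in>{1..n}. U (x # v # h) * (of_bool (regular_off G) * path_weight w D1 G (x # v # h)))
      = Uo * (of_bool (regular_off G) * path_weight w D1 G (v # h))
      + (Uw - Uo) * (of_bool (regular_off G) * path_weight w D1 G (v # h) * (of_bool ({v, w} \<in> G) / ?d))"
      using s by (cases "regular_off G") (auto simp: algebra_simps)
  qed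
  also have "\<dots> = Uo * mass (v # h) + (Uw - Uo) * move_mass (v # h)"
    unfolding subset_mean_add subset_mean_cmult mass_def move_mass_def by simp
  finally show ?thesis .
qed

text \<open>Exits from \<open>w\<close> carry weight \<open>1 / D1\<close>, so conservation fails. A
  vertex whose edge to \<open>w\<close> is unrevealed receives at most the fraction
  \<open>p / D1\<close> of the mass, a revealed neighbour at most \<open>1 / D1\<close>.\<close>

lemma step_target:
  assumes U: "\<And>x. x \<noteq> w \<Longrightarrow> U (x # w # h) = Uo" and Uo: "0 \<le> Uo"
  shows "(\<Sum>x\<in>{1..n}. mass (x # w # h) * U (x # w # h))
     \<le> Uo * ((real n * p + real (card (walk_nbrs w (w # h)))) / D1) * mass (w # h)"
proof -
  let ?A = "walk_nbrs w (w # h)"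
  have 1: "mass (x # w # h) * U (x # w # h) \<le> Uo / D1 * (p * mass (w # h)) + (if x \<in> ?A then Uo / D1 * mass (w # h) else 0)"
    if x: "x \<in> {1..n}" for x
  proof (cases "x = w")
    case True
    \<comment> \<open>\<open>{w, w}\<close> is a singleton and thus no edge of a simple
      graph.\<close>
    have "mass (x # w # h) = 0"
      unfolding mass_def True using w
      by (subst subset_mean_cong[where g = "\<lambda>_. 0"]) (auto simp: all_edges_def subset_mean_def)
    then show ?thesis using Uo D1 p mass_nonneg[of "w # h"] by auto
  next
    case False
    have "mass (x # w # h) = 1 / D1 * subset_mean p E (\<lambda>G. of_bool (regular_off G) * path_weight w D1 G (w # h) * (of_bool ({x, w} \<in> G) * 1))"
      unfolding mass_def subset_mean_cmult[symmetric] by (intro subset_mean_cong) (auto simp: insert_commute)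
    note mx = this
    also have "\<dots> = 1 / D1 * (p * mass_with x (w # h))"
      unfolding subset_mean_edge[OF x False] mass_with_def by simp
    finally have mx': "mass (x # w # h) = 1 / D1 * (p * mass_with x (w # h))" .
    have "mass (x # w # h) \<le> 1 / D1 * mass (w # h)"
      unfolding mx unfolding mass_def using D1
      by (intro mult_left_mono subset_mean_p_mono) (auto simp: path_weight_pos)
    then have a: "Uo * mass (x # w # h) \<le> Uo / D1 * mass (w # h)"
      using Uo mult_left_mono[of "mass (x # w # h)"] by fastforce
    have "mass (x # w # h) \<le> 1 / D1 * (p * mass (w # h))" if "x \<notin> ?A"
      unfolding mx' using p D1 mass_toggle(1)[OF x False that] by (intro mult_left_mono) auto
    then have b: "Uo * mass (x # w # h) \<le> Uo / D1 * (p * mass (w # h))" if "x \<notin> ?A"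
      using Uo that mult_left_mono[of "mass (x # w # h)"] by fastforce
    have c: "0 \<le> Uo / D1 * (p * mass (w # h))" using Uo D1 p mass_nonneg[of "w # h"] by auto
    show ?thesis using a b c U[OF False] by (auto simp: mult.commute)
  qed
  have "(\<Sum>x\<in>{1..n}. mass (x # w # h) * U (x # w # h))
    \<le> (\<Sum>x\<in>{1..n}. Uo / D1 * (p * mass (w # h)) + (if x \<in> ?A then Uo / D1 * mass (w # h) else 0))"
    by (rule sum_mono[OF 1])
  also have "\<dots> = real n * (Uo / D1 * (p * mass (w # h))) + real (card ({1..n} \<inter> ?A)) * (Uo / D1 * mass (w # h))"
    by (simp add: sum.distrib sum.If_cases)
  also have "\<dots> \<le> real n * (Uo / D1 * (p * mass (w # h))) + real (card ?A) * (Uo / D1 * mass (w # h))"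
    using finite_walk_nbrs D1 Uo mass_nonneg[of "w # h"]
    by (intro add_left_mono mult_right_mono) (auto intro!: card_mono divide_nonneg_pos mult_nonneg_nonneg)
  also have "\<dots> = Uo * ((real n * p + real (card ?A)) / D1) * mass (w # h)"
    by (simp add: algebra_simps add_divide_distrib)
  finally show ?thesis .
qed

text \<open>If \<open>mass * U\<close> is a supermartingale while \<open>Adm\<close> holds, optional stopping bounds the probability of reaching \<open>T\<close>.\<close>

lemma hits_bound:
  fixes U :: "nat list \<Rightarrow> real"
  assumes step: "\<And>v h. v \<in> {1..n} \<Longrightarrow> Adm (v # h) \<Longrightarrow>
        (\<Sum>x\<in>{1..n}. mass (x # v # h) * U (x # v # h)) \<le> mass (v # h) * U (v # h)"
    and U: "\<And>h. 0 \<le> U h" "\<And>h. T h \<Longrightarrow> 1 \<le> U h"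
    and good: "\<And>G. G \<subseteq> E \<Longrightarrow> good G \<Longrightarrow> regular_off G \<and> D1 \<le> real (card (neighbours G w)) \<and> (\<forall>v\<in>{1..n}. neighbours G v \<noteq> {})"
    and "v \<in> {1..n}"
  shows "subset_mean p E (\<lambda>G. of_bool (good G) * path_weight w D1 G (v # h) * measure_pmf.prob (srw G m v) {ys. hits Adm T h ys})
     \<le> mass (v # h) * U (v # h)"
  using assms(5)
proof (induction m arbitrary: v h)
  case base: 0
  have "subset_mean p E (\<lambda>G. of_bool (good G) * path_weight w D1 G (v # h) * measure_pmf.prob (srw G 0 v) {ys. hits Adm T h ys})
    \<le> subset_mean p E (\<lambda>G. U (v # h) * (of_bool (regular_off G) * path_weight w D1 G (v # h)))"
  proof (rule subset_mean_p_mono)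
    fix G assume "G \<subseteq> E"
    note gG = good[OF this]
    show "of_bool (good G) * path_weight w D1 G (v # h) * measure_pmf.prob (srw G 0 v) {ys. hits Adm T h ys}
      \<le> U (v # h) * (of_bool (regular_off G) * path_weight w D1 G (v # h))"
      using gG path_weight_pos[of G "v # h"] U(1)[of "v # h"] U(2)[of "v # h"] mult_right_mono[of 1 "U (v # h)" "path_weight w D1 G (v # h)"]
      by (auto simp: of_bool_def indicator_def)
  qed
  then show ?case unfolding subset_mean_cmult mass_def by (simp add: mult.commute)
next
  case (Suc m)
  show ?case
  proof (cases "T (v # h) \<or> \<not> Adm (v # h)")
    case True
    have "subset_mean p E (\<lambda>G. of_bool (good G) * path_weight w D1 G (v # h) * measure_pmf.prob (srw G (Suc m) v) {ys. hits Adm T h ys})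
      \<le> subset_mean p E (\<lambda>G. U (v # h) * (of_bool (regular_off G) * path_weight w D1 G (v # h)))"
    proof (rule subset_mean_p_mono)
      fix G assume G: "G \<subseteq> E"
      have *: "measure_pmf.prob (srw G (Suc m) v) {ys. hits Adm T h ys} \<le> U (v # h)" if "good G"
      proof (cases "T (v # h)")
        case True
        have "measure_pmf.prob (srw G (Suc m) v) {ys. hits Adm T h ys} \<le> 1" by simp
        then show ?thesis using U(2)[OF True] by linarith
      next
        case False
        have "neighbours G v \<noteq> {}" using good[OF G that] Suc.prems by blast
        then show ?thesis using True False U(1)[of "v # h"] finite_neighbours[OF G]
          by (subst srw_prob_Suc) auto
      qed
      show "of_bool (good G) * path_weight w D1 G (v # h) * measure_pmf.prob (srw G (Suc m) v) {ys. hits Adm T h ys}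
        \<le> U (v # h) * (of_bool (regular_off G) * path_weight w D1 G (v # h))"
        using good[OF G] * path_weight_pos[of G "v # h"] U(1)[of "v # h"]
          mult_left_mono[OF *, of "path_weight w D1 G (v # h)"]
        by (cases "good G") (auto simp: mult.commute)
    qed
    then show ?thesis unfolding subset_mean_cmult mass_def by (simp add: mult.commute)
  next
    case False
    let ?P = "\<lambda>G x. measure_pmf.prob (srw G m x) {ys. hits Adm T (v # h) ys}"
    have "subset_mean p E (\<lambda>G. of_bool (good G) * path_weight w D1 G (v # h) * measure_pmf.prob (srw G (Suc m) v) {ys. hits Adm T h ys})
      \<le> subset_mean p E (\<lambda>G. \<Sum>x\<in>{1..n}. of_bool (good G) * path_weight w D1 G (x # v # h) * ?P G x)"
    proof (rule subset_mean_p_mono)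
      fix G assume G: "G \<subseteq> E"
      show "of_bool (good G) * path_weight w D1 G (v # h) * measure_pmf.prob (srw G (Suc m) v) {ys. hits Adm T h ys}
        \<le> (\<Sum>x\<in>{1..n}. of_bool (good G) * path_weight w D1 G (x # v # h) * ?P G x)"
      proof (cases "good G")
        case True
        note gG = good[OF G True]
        have N: "neighbours G v \<subseteq> {1..n}" "finite (neighbours G v)" "neighbours G v \<noteq> {}"
          using neighbours_subset[OF G] finite_neighbours[OF G] gG Suc.prems by auto
        let ?d = "real (card (neighbours G v))"
        have d: "0 < ?d" using N by (simp add: card_gt_0_iff)
        have 1: "hits Adm T h (v # ys) = hits Adm T (v # h) ys" for ys using False by simp
        have "path_weight w D1 G (v # h) * measure_pmf.prob (srw G (Suc m) v) {ys. hits Adm T h ys}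
          = (\<Sum>x\<in>neighbours G v. 1 / ?d * (path_weight w D1 G (v # h) * ?P G x))"
          unfolding srw_prob_Suc[OF N(2,3)] 1 sum_distrib_left by (intro sum.cong) auto
        also have "\<dots> \<le> (\<Sum>x\<in>neighbours G v. path_weight w D1 G (x # v # h) * ?P G x)"
        proof (rule sum_mono)
          fix x assume "x \<in> neighbours G v"
          then have "path_weight w D1 G (x # v # h) * ?P G x = 1 / (if v = w then D1 else ?d) * (path_weight w D1 G (v # h) * ?P G x)"
            by (simp add: neighbours_def)
          \<comment> \<open>For \<open>v = w\<close> this uses that a good graph has degree at least
            \<open>D1\<close> at \<open>w\<close>: the weight dominates the true step
            probability.\<close>
          moreover have "1 / ?d \<le> 1 / (if v = w then D1 else ?d)"
            using gG D1 by (auto intro!: divide_left_mono)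
          ultimately show "1 / ?d * (path_weight w D1 G (v # h) * ?P G x) \<le> path_weight w D1 G (x # v # h) * ?P G x"
            using path_weight_pos[of G "v # h"] by (metis mult_right_mono mult_nonneg_nonneg measure_nonneg)
        qed
        also have "\<dots> \<le> (\<Sum>x\<in>{1..n}. path_weight w D1 G (x # v # h) * ?P G x)"
          using N path_weight_pos by (intro sum_mono2) (auto intro!: mult_nonneg_nonneg simp del: path_weight.simps)
        finally show ?thesis using True by simp
      qed simp
    qed
    also have "\<dots> \<le> (\<Sum>x\<in>{1..n}. mass (x # v # h) * U (x # v # h))"
      unfolding subset_mean_sum by (intro sum_mono Suc.IH)
    also have "\<dots> \<le> mass (v # h) * U (v # h)"
      using False Suc.prems by (intro step) auto
    finally show ?thesis .
  qed
qed

end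

section \<open>Exponential supermartingales for the visits to one vertex\<close>

lemma exp_two_le: "exp (2::real) \<le> 9"
proof -
  have "exp (2::real) = exp 1 * exp 1" by (simp flip: exp_add)
  also have "\<dots> \<le> 3 * 3" using exp_le by (intro mult_mono) auto
  finally show ?thesis by simp
qed

context visits
begin

text \<open>Under the cap, the growth of mass at an exit from \<open>w\<close> is small enough to be
  absorbed by a drop of 1 in the exponent.\<close>

lemma walk_nbrs_bound:
  assumes "\<forall>y. count_list (w # h) y \<le> M" "real n * p + 2 * real M \<le> 2 * D1"
  shows "(real n * p + real (card (walk_nbrs w (w # h)))) / D1 \<le> 2"
proof -
  have "card (walk_nbrs w (w # h)) \<le> count_list (w # h) w + count_list h w"
    using card_walk_nbrs[of w "w # h"] by simp
  moreover have "count_list (w # h) w \<le> M" using assms(1) by blast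
  ultimately have "card (walk_nbrs w (w # h)) \<le> 2 * M" by simp
  then have "real n * p + real (card (walk_nbrs w (w # h))) \<le> 2 * D1" using assms(2) by linarith
  then show ?thesis using D1 by (simp add: field_simps)
qed

text \<open>The exponent \<open>V\<close> earns 2 for a visit to \<open>w\<close> and gives back 1
  at an exit from \<open>w\<close>, to absorb the growth of mass there. The drift caused by the
  reward is at most \<open>8 = 9 - 1\<close> times the chance of moving to \<open>w\<close>, since
  \<open>exp 2 \<le> 9\<close>. The term with \<open>a\<close> compensates it at unrevealed edges,
  that with \<open>b\<close> at revealed ones.\<close>

lemma many_visits:
  assumes good: "\<And>G. G \<subseteq> E \<Longrightarrow> good G \<Longrightarrow> regular_off G \<and> D1 \<le> real (card (neighbours G w)) \<and> (\<forall>v\<in>{1..n}. neighbours G v \<noteq> {})"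
    and v0: "v0 \<in> {1..n}" and np: "real n * p + 2 * real M \<le> 2 * D1"
  shows "subset_mean p E (\<lambda>G. of_bool (good G) * measure_pmf.prob (srw G m v0)
      {ys. hits (\<lambda>h. \<forall>y. count_list h y \<le> M)
        (\<lambda>h. length h \<le> L \<and> count_list h w = Suc M \<and> (\<forall>y. count_list h y \<le> Suc M)) [] ys})
    \<le> exp (2 + 8 * p * real L / D1 + 16 * (real M + 1)\<^sup>2 / D1 - (real M + 1))" (is "?lhs \<le> _")
proof -
  define a where "a = 8 * p / D1"
  define b where "b = 8 / D1"
  have ab: "0 \<le> a" "0 \<le> b" using p D1 by (auto simp: a_def b_def)
  \<comment> \<open>Chosen so that \<open>V \<ge> 0\<close> on the target: at a breach the visits
    leave at least \<open>2 * (M + 1) - (M + 1)\<close>, and there are at most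
    \<open>2 * (M + 1)\<close> revealed neighbours with at most \<open>M + 1\<close> exits
    each.\<close>
  define c0 where "c0 = a * real L + 2 * b * (real M + 1)\<^sup>2 - (real M + 1)"
  define V where "V h = 2 * real (count_list h w) - real (count_list (tl h) w)
      - a * real (length h) - b * real (nbr_exits w h) + c0" for h
  define U where "U h = exp (V h)" for h
  let ?T = "\<lambda>h. length h \<le> L \<and> count_list h w = Suc M \<and> (\<forall>y. count_list h y \<le> Suc M)"
  let ?A = "\<lambda>h. \<forall>y. count_list h y \<le> M"
  have step: "(\<Sum>x\<in>{1..n}. mass (x # v # h) * U (x # v # h)) \<le> mass (v # h) * U (v # h)"
    if v: "v \<in> {1..n}" and A: "?A (v # h)" for v h
  proof (cases "v = w")
    case True
    have "(\<Sum>x\<in>{1..n}. mass (x # w # h) * U (x # w # h))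
       \<le> exp (V (w # h) - 1 - a) * ((real n * p + real (card (walk_nbrs w (w # h)))) / D1) * mass (w # h)"
      by (rule step_target) (auto simp: U_def V_def algebra_simps)
    also have "\<dots> \<le> exp (V (w # h) - 1 - a) * 2 * mass (w # h)"
      using walk_nbrs_bound[OF A[unfolded True] np] by (intro mult_right_mono mult_left_mono mass_nonneg) auto
    also have "\<dots> \<le> exp (V (w # h) - 1 - a) * exp 1 * mass (w # h)"
      using exp_ge_add_one_self[of 1] by (intro mult_right_mono mult_left_mono mass_nonneg) auto
    also have "\<dots> = exp (V (w # h) - a) * mass (w # h)" by (simp flip: exp_add)
    also have "\<dots> \<le> U (w # h) * mass (w # h)"
      using ab unfolding U_def by (intro mult_right_mono mass_nonneg) auto
    finally show ?thesis using True by (simp add: mult.commute)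
  next
    case False
    define i :: real where "i = of_bool (v \<in> walk_nbrs w (v # h))"
    define hi where "hi = (if v \<in> walk_nbrs w (v # h) then 1 else p) / D1"
    have hi: "8 * hi \<le> a + b * i" using ab p D1 by (auto simp: hi_def i_def a_def b_def)
    have move_mass: "move_mass (v # h) \<le> hi * mass (v # h)"
      using move_mass_bounds_new(1)[OF v False] move_mass_bounds_old(1)[OF v False] by (auto simp: hi_def)
    define Uo where "Uo = exp (V (v # h) - a - b * i)"
    have "(\<Sum>x\<in>{1..n}. mass (x # v # h) * U (x # v # h))
       = Uo * mass (v # h) + (Uo * exp 2 - Uo) * move_mass (v # h)"
      unfolding Uo_def exp_add[symmetric] using False
      by (intro step_other v) (auto simp: U_def V_def i_def algebra_simps)
    also have "\<dots> \<le> Uo * mass (v # h) + (Uo * 9 - Uo) * (hi * mass (v # h))"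
    proof (intro add_left_mono mult_mono move_mass)
      show "Uo * exp 2 - Uo \<le> Uo * 9 - Uo" using exp_two_le by (simp add: Uo_def)
      show "0 \<le> move_mass (v # h)" unfolding move_mass_def using p by (intro subset_mean_nonneg) (auto simp: path_weight_pos)
    qed (auto simp: Uo_def)
    also have "\<dots> = Uo * (1 + 8 * hi) * mass (v # h)" by (simp add: algebra_simps)
    also have "\<dots> \<le> Uo * exp (8 * hi) * mass (v # h)"
      by (intro mult_right_mono mult_left_mono mass_nonneg exp_ge_add_one_self) (auto simp: Uo_def)
    also have "\<dots> \<le> U (v # h) * mass (v # h)"
      unfolding Uo_def U_def exp_add[symmetric] using hi by (intro mult_right_mono mass_nonneg) auto
    finally show ?thesis by (simp add: mult.commute)
  qed
  have T: "1 \<le> U h" if "?T h" for h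
  proof -
    have tl: "count_list (tl h) y \<le> Suc M" for y
    proof -
      have "count_list (tl h) y \<le> count_list h y" by (cases h) auto
      also have "\<dots> \<le> Suc M" using that by blast
      finally show ?thesis .
    qed
    have "nbr_exits w h \<le> (\<Sum>y\<in>walk_nbrs w h. Suc M)"
      by (rule order.trans[OF nbr_exits_le sum_mono[OF tl]])
    also have "\<dots> \<le> (2 * Suc M) * Suc M"
    proof -
      have "card (walk_nbrs w h) \<le> 2 * Suc M" using card_walk_nbrs[of w h] that tl[of w] by simp
      then show ?thesis by (simp only: sum_constant of_nat_id mult_right_mono)
    qed
    finally have "real (nbr_exits w h) \<le> real ((2 * Suc M) * Suc M)" by (rule of_nat_mono)
    also have "\<dots> = 2 * (real M + 1)\<^sup>2" by (simp add: power2_eq_square algebra_simps)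
    finally have "b * real (nbr_exits w h) \<le> b * (2 * (real M + 1)\<^sup>2)" using ab by (intro mult_left_mono)
    moreover have "a * real (length h) \<le> a * real L" using that ab by (intro mult_left_mono) auto
    moreover have "2 * real (count_list h w) - real (count_list (tl h) w) \<ge> real M + 1"
      using that tl[of w] by simp
    ultimately have "0 \<le> V h" unfolding V_def c0_def by (simp add: algebra_simps)
    then show ?thesis by (simp add: U_def)
  qed
  have "?lhs \<le> mass [v0] * U [v0]"
    using hits_bound[where U = U and good = good and Adm = ?A and T = ?T and v = v0 and h = "[]" and m = m,
        OF step _ T good v0] by (simp add: U_def)
  also have "\<dots> \<le> 1 * exp (2 + c0)"
  proof (rule mult_mono)
    have "mass [v0] \<le> subset_mean p E (\<lambda>_. 1)" unfolding mass_def by (rule subset_mean_p_mono) auto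
    then show "mass [v0] \<le> 1" by (simp add: subset_mean_const finite_all_edges)
    show "U [v0] \<le> exp (2 + c0)" using ab by (simp add: U_def V_def)
  qed (auto simp: U_def)
  also have "2 + c0 = 2 + 8 * p * real L / D1 + 16 * (real M + 1)\<^sup>2 / D1 - (real M + 1)"
    by (simp add: c0_def a_def b_def)
  finally show ?thesis by simp
qed

text \<open>Each visit to \<open>w\<close> costs \<open>s\<close> in the exponent, and
  \<open>a\<close> is the resulting decay rate per step, because under the cap the chance of moving
  to \<open>w\<close> is at least \<open>r * p / (D2 + 1)\<close>. The 1 in \<open>s + 1\<close>
  pays for the exits from \<open>w\<close>, where mass may grow.\<close>

lemma few_visits:
  assumes good: "\<And>G. G \<subseteq> E \<Longrightarrow> good G \<Longrightarrow> regular_off G \<and> D1 \<le> real (card (neighbours G w)) \<and> (\<forall>v\<in>{1..n}. neighbours G v \<noteq> {})"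
    and v0: "v0 \<in> {1..n}" and np: "real n * p + 2 * real M \<le> 2 * D1"
    and s: "0 \<le> s" and D2: "0 \<le> D2" and a_def: "a = (1 - exp (- s)) * (r * p / (D2 + 1))" and a: "a \<le> 1 / 4"
  shows "subset_mean p E (\<lambda>G. of_bool (good G) * measure_pmf.prob (srw G m v0)
      {ys. hits (\<lambda>h. \<forall>y. count_list h y \<le> M)
        (\<lambda>h. length h = Suc L \<and> count_list h w \<le> j) [] ys})
    \<le> exp ((s + 1) * real j - a * real L)" (is "?lhs \<le> _")
proof -
  have a0: "0 \<le> a" using s p r D2 by (auto simp: a_def)
  define c0 where "c0 = (s + 1) * real j - a * real (Suc L)"
  define V where "V h = - s * real (count_list h w) - real (count_list (tl h) w) + a * real (length h) + c0" for h
  define U where "U h = exp (V h)" for h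
  let ?T = "\<lambda>h. length h = Suc L \<and> count_list h w \<le> j"
  let ?A = "\<lambda>h. \<forall>y. count_list h y \<le> M"
  \<comment> \<open>At an exit from \<open>w\<close> the exponent drops by 1 while the compensator
    adds \<open>a\<close>; what remains must still absorb the growth factor 2.\<close>
  have e34: "2 \<le> exp (1 - a)"
  proof -
    have "2 \<le> 1 + (3/4) + (3/4)\<^sup>2 / (2::real)" by (simp add: power2_eq_square)
    also have "\<dots> \<le> exp (3 / 4)" by (rule exp_lower_Taylor_quadratic) simp
    also have "\<dots> \<le> exp (1 - a)" using a by simp
    finally show ?thesis .
  qed
  have step: "(\<Sum>x\<in>{1..n}. mass (x # v # h) * U (x # v # h)) \<le> mass (v # h) * U (v # h)"
    if v: "v \<in> {1..n}" and A: "?A (v # h)" for v h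
  proof (cases "v = w")
    case True
    have "(\<Sum>x\<in>{1..n}. mass (x # w # h) * U (x # w # h))
       \<le> exp (V (w # h) - 1 + a) * ((real n * p + real (card (walk_nbrs w (w # h)))) / D1) * mass (w # h)"
      by (rule step_target) (auto simp: U_def V_def algebra_simps)
    also have "\<dots> \<le> exp (V (w # h) - 1 + a) * 2 * mass (w # h)"
      using walk_nbrs_bound[OF A[unfolded True] np] by (intro mult_right_mono mult_left_mono mass_nonneg) auto
    also have "\<dots> \<le> exp (V (w # h) - 1 + a) * exp (1 - a) * mass (w # h)"
      using e34 by (intro mult_right_mono mult_left_mono mass_nonneg) auto
    also have "\<dots> = U (w # h) * mass (w # h)" by (simp add: U_def flip: exp_add)
    finally show ?thesis using True by (simp add: mult.commute)
  next
    case False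
    define lo where "lo = r * p / (D2 + 1)"
    have "count_list (v # h) v \<le> M" using A by blast
    then have c: "count_list h v \<le> M" by simp
    have move_mass: "lo * mass (v # h) \<le> move_mass (v # h)"
      using move_mass_bounds_new(2)[OF v False _ c D2] move_mass_bounds_old(2)[OF v False _ D2] unfolding lo_def by blast
    define Uo where "Uo = exp (V (v # h) + a)"
    have "(\<Sum>x\<in>{1..n}. mass (x # v # h) * U (x # v # h))
       = Uo * mass (v # h) + (Uo * exp (- s) - Uo) * move_mass (v # h)"
      unfolding Uo_def exp_add[symmetric] using False
      by (intro step_other v) (auto simp: U_def V_def algebra_simps)
    also have "\<dots> = Uo * mass (v # h) - Uo * (1 - exp (- s)) * move_mass (v # h)" by (simp add: algebra_simps)
    also have "\<dots> \<le> Uo * mass (v # h) - Uo * (1 - exp (- s)) * (lo * mass (v # h))"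
      using s by (intro diff_left_mono mult_left_mono move_mass) (auto simp: Uo_def)
    also have "\<dots> = Uo * (1 + - a) * mass (v # h)" by (simp add: algebra_simps a_def lo_def)
    also have "\<dots> \<le> Uo * exp (- a) * mass (v # h)"
      by (intro mult_right_mono mult_left_mono mass_nonneg exp_ge_add_one_self) (auto simp: Uo_def)
    also have "\<dots> = U (v # h) * mass (v # h)"
      unfolding Uo_def U_def exp_add[symmetric] by simp
    finally show ?thesis by (simp add: mult.commute)
  qed
  have T: "1 \<le> U h" if "?T h" for h
  proof -
    have "count_list (tl h) w \<le> count_list h w" by (cases h) auto
    then have "count_list (tl h) w \<le> j" using that by simp
    moreover have "s * real (count_list h w) \<le> s * real j" using that s by (intro mult_left_mono) auto
    ultimately have "0 \<le> V h" unfolding V_def c0_def using that by (simp add: algebra_simps)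
    then show ?thesis by (simp add: U_def)
  qed
  have "?lhs \<le> mass [v0] * U [v0]"
    using hits_bound[where U = U and good = good and Adm = ?A and T = ?T and v = v0 and h = "[]" and m = m,
        OF step _ T good v0] by (simp add: U_def)
  also have "\<dots> \<le> 1 * exp (a + c0)"
  proof (rule mult_mono)
    have "mass [v0] \<le> subset_mean p E (\<lambda>_. 1)" unfolding mass_def by (rule subset_mean_p_mono) auto
    then show "mass [v0] \<le> 1" by (simp add: subset_mean_const finite_all_edges)
    show "U [v0] \<le> exp (a + c0)" using s by (simp add: U_def V_def)
  qed (auto simp: U_def)
  also have "a + c0 = (s + 1) * real j - a * real L"
    by (simp add: c0_def algebra_simps)
  finally show ?thesis by simp
qed

end

text \<open>At the first breach of the cap only the vertex just entered exceeds \<open>M\<close>,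
  and by exactly one; all earlier histories are admissible.\<close>

lemma hits_many:
  assumes "\<forall>y. count_list h y \<le> M" "length h + length ys \<le> L" "\<not> (\<forall>y. count_list (rev ys @ h) y \<le> M)"
  shows "\<exists>w\<in>set ys. hits (\<lambda>h. \<forall>y. count_list h y \<le> M)
        (\<lambda>h. length h \<le> L \<and> count_list h w = Suc M \<and> (\<forall>y. count_list h y \<le> Suc M)) h ys"
  using assms
proof (induction ys arbitrary: h)
  case Nil
  then show ?case by auto
next
  case (Cons v ys)
  show ?case
  proof (cases "\<forall>y. count_list (v # h) y \<le> M")
    case True
    have "\<exists>w\<in>set ys. hits (\<lambda>h. \<forall>y. count_list h y \<le> M)
        (\<lambda>h. length h \<le> L \<and> count_list h w = Suc M \<and> (\<forall>y. count_list h y \<le> Suc M)) (v # h) ys"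
      by (rule Cons.IH[OF True]) (use Cons.prems in auto)
    then show ?thesis using True by auto
  next
    case False
    then obtain y where "\<not> count_list (v # h) y \<le> M" by auto
    moreover have "count_list h y \<le> M" using Cons.prems(1) by blast
    ultimately have "y = v" by (auto split: if_splits)
    have "count_list h v = M" using \<open>y = v\<close> \<open>\<not> count_list (v # h) y \<le> M\<close> \<open>count_list h y \<le> M\<close> by simp
    moreover have "count_list (v # h) z \<le> Suc M" for z using Cons.prems(1)[rule_format, of z] by auto
    ultimately show ?thesis using Cons.prems(2) by (intro bexI[of _ v]) auto
  qed
qed

text \<open>The histories passed on the way are suffixes of the reversed walk and inherit its cap.
  \<open>Suc L\<close> is the number of vertices in a walk of \<open>L\<close> steps.\<close>

lemma hits_few:
  assumes "\<forall>y. count_list (rev ys @ h) y \<le> M" "length h + length ys = Suc L" "ys \<noteq> []"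
    "count_list (rev ys @ h) w \<le> j"
  shows "hits (\<lambda>h. \<forall>y. count_list h y \<le> M) (\<lambda>h. length h = Suc L \<and> count_list h w \<le> j) h ys"
  using assms
proof (induction ys arbitrary: h)
  case (Cons v ys)
  show ?case
  proof (cases "ys = []")
    case True
    then show ?thesis using Cons.prems by auto
  next
    case False
    have "count_list (v # h) y \<le> M" for y
    proof -
      have "count_list (rev (v # ys) @ h) y \<le> M" using Cons.prems(1) by blast
      then show ?thesis by (auto split: if_splits)
    qed
    moreover have "hits (\<lambda>h. \<forall>y. count_list h y \<le> M) (\<lambda>h. length h = Suc L \<and> count_list h w \<le> j) (v # h) ys"
      by (rule Cons.IH) (use Cons.prems False in auto)
    ultimately show ?thesis by simp
  qed
qed simp

subsection \<open>Exits from the vertices\<close>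

fun exits_from :: "nat \<Rightarrow> nat list \<Rightarrow> nat list" where
  "exits_from u (a # b # xs) = (if a = u then b # exits_from u (b # xs) else exits_from u (b # xs))"
| "exits_from u [x] = []"
| "exits_from u [] = []"

text \<open>The last vertex of the walk is visited without being left, hence the
  \<open>Suc\<close>.\<close>

lemma length_exits_from: "count_list ys u \<le> Suc (length (exits_from u ys))"
  by (induction u ys rule: exits_from.induct) auto

lemma exits_from_walk_edges: "x \<in> set (exits_from u ys) \<Longrightarrow> {u, x} \<in># walk_edges ys"
  by (induction u ys rule: exits_from.induct) (auto simp: walk_edges_def split: if_splits)

lemma prob_mono_pmf:
  assumes "\<And>y. y \<in> set_pmf M \<Longrightarrow> P y \<Longrightarrow> Q y"
  shows "measure_pmf.prob M {y. P y} \<le> measure_pmf.prob M {y. Q y}"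
  using assms by (intro measure_pmf.finite_measure_mono_AE) (auto simp: AE_measure_pmf_iff)

lemma prob_UN_pmf_le:
  assumes "finite I" "\<And>y. y \<in> set_pmf M \<Longrightarrow> P y \<Longrightarrow> \<exists>i\<in>I. Q i y"
  shows "measure_pmf.prob M {y. P y} \<le> (\<Sum>i\<in>I. measure_pmf.prob M {y. Q i y})"
proof -
  have "measure_pmf.prob M {y. P y} \<le> measure_pmf.prob M {y. \<exists>i\<in>I. Q i y}"
    by (rule prob_mono_pmf[OF assms(2)])
  also have "{y. \<exists>i\<in>I. Q i y} = (\<Union>i\<in>I. {y. Q i y})" by auto
  also have "measure_pmf.prob M \<dots> \<le> (\<Sum>i\<in>I. measure_pmf.prob M {y. Q i y})"
    using assms(1) by (intro measure_pmf.finite_measure_subadditive_finite) auto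
  finally show ?thesis .
qed

lemma hd_srw: "ys \<in> set_pmf (srw G k v) \<Longrightarrow> \<exists>zs. ys = v # zs"
  by (cases k) (auto split: if_splits)

lemma exits_from_srw:
  assumes "\<And>u. finite (neighbours G u)" "ys \<in> set_pmf (srw G k v)"
  shows "set (exits_from u ys) \<subseteq> neighbours G u"
  using assms(2)
proof (induction k arbitrary: v ys)
  case (Suc k)
  show ?case
  proof (cases "neighbours G v = {}")
    case False
    then obtain x zs where x: "x \<in> neighbours G v" "zs \<in> set_pmf (srw G k x)" "ys = v # zs"
      using Suc.prems assms(1) by auto
    obtain zs' where "zs = x # zs'" using hd_srw[OF x(2)] by auto
    then show ?thesis using Suc.IH[OF x(2)] x by auto
  qed (use Suc.prems in auto)
qed auto

text \<open>Successive exits from a vertex behave like independent uniform draws from its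
  neighbourhood. Induction on the steps spends one demand whenever the walk leaves a vertex that
  still has one, so the demands \<open>r\<close> and \<open>R\<close> vary. There is only an
  inequality, since the walk may end with demands unmet.\<close>

lemma exits_prob:
  assumes N: "\<And>u. neighbours G u \<subseteq> V" "\<And>u. u \<in> V \<Longrightarrow> neighbours G u \<noteq> {}" "finite V"
    and I: "finite I" and v: "v \<in> V"
  shows "measure_pmf.prob (srw G m v)
      {ys. \<forall>u\<in>I. r u \<le> length (exits_from u ys) \<and> (\<forall>i<r u. exits_from u ys ! i \<in> R u i)}
    \<le> (\<Prod>u\<in>I. \<Prod>i<r u. real (card (neighbours G u \<inter> R u i)) / real (card (neighbours G u)))"
  using v
proof (induction m arbitrary: v r R)
  case 0
  let ?P = "\<Prod>u\<in>I. \<Prod>i<r u. real (card (neighbours G u \<inter> R u i)) / real (card (neighbours G u))"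
  have P: "0 \<le> ?P" by (intro prod_nonneg) auto
  show ?case
  proof (cases "\<forall>u\<in>I. r u = 0")
    case True
    then have "?P = 1" by (intro prod.neutral) auto
    then show ?thesis by simp
  next
    case False
    then have "measure_pmf.prob (srw G 0 v)
      {ys. \<forall>u\<in>I. r u \<le> length (exits_from u ys) \<and> (\<forall>i<r u. exits_from u ys ! i \<in> R u i)} = 0"
      by (auto simp: indicator_def)
    then show ?thesis using P by linarith
  qed
next
  case (Suc m)
  let ?N = "neighbours G v"
  let ?f = "\<lambda>r R. \<Prod>u\<in>I. \<Prod>i<r u. real (card (neighbours G u \<inter> R u i)) / real (card (neighbours G u))"
  let ?E = "\<lambda>r R ys. \<forall>u\<in>I. r u \<le> length (exits_from u ys) \<and> (\<forall>i<r u. exits_from u ys ! i \<in> R u i)"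
  have fN: "finite ?N" using N finite_subset by blast
  note ne = N(2)[OF Suc.prems]
  have d: "0 < real (card ?N)" using fN ne by (simp add: card_gt_0_iff)
  note rec = srw_prob_Suc[OF fN ne, of m "?E r R"]
  show ?case
  proof (cases "v \<in> I \<and> 0 < r v")
    case True
    \<comment> \<open>The step from \<open>v\<close> serves the first demand at \<open>v\<close>;
      the remaining ones move up by one place.\<close>
    define r' where "r' = r(v := r v - 1)"
    define R' where "R' = R(v := (\<lambda>i. R v (Suc i)))"
    have b: "measure_pmf.prob (srw G m x) {ys. ?E r R (v # ys)} \<le> of_bool (x \<in> R v 0) * ?f r' R'"
      if x: "x \<in> ?N" for x
    proof (cases "x \<in> R v 0")
      case xR: True
      have "measure_pmf.prob (srw G m x) {ys. ?E r R (v # ys)} \<le> measure_pmf.prob (srw G m x) {ys. ?E r' R' ys}"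
      proof (rule prob_mono_pmf)
        fix ys assume "ys \<in> set_pmf (srw G m x)" and E: "?E r R (v # ys)"
        then obtain zs where ys: "ys = x # zs" using hd_srw by blast
        show "?E r' R' ys"
        proof
          fix u assume u: "u \<in> I"
          show "r' u \<le> length (exits_from u ys) \<and> (\<forall>i<r' u. exits_from u ys ! i \<in> R' u i)"
          proof (cases "u = v")
            case uv: True
            have "r v \<le> Suc (length (exits_from v ys)) \<and> (\<forall>i<r v. (x # exits_from v ys) ! i \<in> R v i)"
              using E u ys uv by auto
            then have "r v - 1 \<le> length (exits_from v ys) \<and> (\<forall>i<r v - 1. exits_from v ys ! i \<in> R v (Suc i))"
              by (auto simp: less_diff_conv le_diff_conv)
            then show ?thesis using uv by (simp add: r'_def R'_def)
          next
            case False
            then show ?thesis using E u ys by (auto simp: r'_def R'_def)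
          qed
        qed
      qed
      also have "\<dots> \<le> ?f r' R'" using N(1) x by (intro Suc.IH) auto
      finally show ?thesis using xR by simp
    next
      case False
      have "measure_pmf.prob (srw G m x) {ys. ?E r R (v # ys)} \<le> measure_pmf.prob (srw G m x) {ys. False}"
      proof (rule prob_mono_pmf)
        fix ys assume "ys \<in> set_pmf (srw G m x)" and E: "?E r R (v # ys)"
        then obtain zs where ys: "ys = x # zs" using hd_srw by blast
        then have "exits_from v (v # ys) ! 0 \<in> R v 0" using E True by blast
        then show False using False ys by simp
      qed
      then show ?thesis using False by simp
    qed
    have "measure_pmf.prob (srw G (Suc m) v) {ys. ?E r R ys}
       \<le> (\<Sum>x\<in>?N. of_bool (x \<in> R v 0) * ?f r' R' / real (card ?N))"
      unfolding rec by (intro sum_mono divide_right_mono b) auto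
    also have "\<dots> = real (card (?N \<inter> R v 0)) / real (card ?N) * ?f r' R'"
      using fN by (simp flip: sum_distrib_right sum_divide_distrib)
    also have "?f r' R' = (\<Prod>i<r v - 1. real (card (?N \<inter> R v (Suc i))) / real (card ?N))
        * (\<Prod>u\<in>I - {v}. \<Prod>i<r u. real (card (neighbours G u \<inter> R u i)) / real (card (neighbours G u)))"
      using I True by (subst prod.remove[of _ v]) (auto simp: r'_def R'_def intro!: prod.cong)
    also have "real (card (?N \<inter> R v 0)) / real (card ?N) * \<dots> = ?f r R"
    proof -
      obtain k where k: "r v = Suc k" using True by (metis gr0_implies_Suc)
      have eq: "?f r R = (\<Prod>i<r v. real (card (?N \<inter> R v i)) / real (card ?N))
        * (\<Prod>u\<in>I - {v}. \<Prod>i<r u. real (card (neighbours G u \<inter> R u i)) / real (card (neighbours G u)))"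
        using I True by (intro prod.remove) auto
      show ?thesis unfolding eq k prod.lessThan_Suc_shift by (simp only: diff_Suc_1 mult.assoc comp_def)
    qed
    finally show ?thesis .
  next
    case False
    have b: "measure_pmf.prob (srw G m x) {ys. ?E r R (v # ys)} \<le> ?f r R" if x: "x \<in> ?N" for x
    proof -
      have "measure_pmf.prob (srw G m x) {ys. ?E r R (v # ys)} \<le> measure_pmf.prob (srw G m x) {ys. ?E r R ys}"
      proof (rule prob_mono_pmf)
        fix ys assume "ys \<in> set_pmf (srw G m x)" and E: "?E r R (v # ys)"
        then obtain zs where ys: "ys = x # zs" using hd_srw by blast
        show "?E r R ys"
        proof
          fix u assume u: "u \<in> I"
          then have E': "r u \<le> length (exits_from u (v # ys)) \<and> (\<forall>i<r u. exits_from u (v # ys) ! i \<in> R u i)"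
            using bspec[OF E] by simp
          show "r u \<le> length (exits_from u ys) \<and> (\<forall>i<r u. exits_from u ys ! i \<in> R u i)"
          proof (cases "u = v")
            case True
            then show ?thesis using False u by simp
          next
            case False
            then have "exits_from u (v # ys) = exits_from u ys" by (simp add: ys)
            then show ?thesis using E' by simp
          qed
        qed
      qed
      also have "\<dots> \<le> ?f r R" using N(1) x by (intro Suc.IH) auto
      finally show ?thesis .
    qed
    have "measure_pmf.prob (srw G (Suc m) v) {ys. ?E r R ys} \<le> (\<Sum>x\<in>?N. ?f r R / real (card ?N))"
      unfolding rec by (intro sum_mono divide_right_mono b) auto
    also have "\<dots> = ?f r R" using d by simp
    finally show ?thesis .
  qed
qed

section \<open>Prescribed edges among the first exits\<close>

text \<open>Meaningful only when every vertex has at least \<open>k\<close> exits, because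
  \<open>!\<close> is unspecified past the end of a list; the events below always include this
  condition.\<close>

definition first_exits :: "nat \<Rightarrow> nat \<Rightarrow> nat list \<Rightarrow> nat set set" where
  "first_exits n k ys = {{u, exits_from u ys ! i} |u i. u \<in> {1..n} \<and> i < k}"

text \<open>Assign to every edge of \<open>F\<close> one of its ends \<open>u\<close> and the index
  \<open>i < k\<close> of an exit that produced it: \<open>2 * k\<close> choices per edge. For a
  fixed injective assignment the draws are at distinct places, each correct with probability at most
  \<open>1 / D\<close>.\<close>

lemma edges_prob:
  assumes G: "G \<subseteq> all_edges n" and d: "\<And>u. u \<in> {1..n} \<Longrightarrow> D \<le> real (card (neighbours G u))" and D: "0 < D"
    and v: "v \<in> {1..n}" and F: "F \<subseteq> all_edges n"
  shows "measure_pmf.prob (srw G m v)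
      {ys. (\<forall>u\<in>{1..n}. k \<le> length (exits_from u ys)) \<and> F \<subseteq> first_exits n k ys}
    \<le> of_bool (F \<subseteq> G) * (2 * real k / D) ^ card F"
proof -
  have N: "neighbours G u \<subseteq> {1..n}" "finite (neighbours G u)" for u
    using neighbours_subset[OF G] finite_neighbours[OF G] by auto
  have ne: "neighbours G u \<noteq> {}" if "u \<in> {1..n}" for u
    using d[OF that] D by auto
  have fF: "finite F" using F finite_all_edges finite_subset by blast
  define S where "S e = e \<times> {..<k}" for e :: "nat set"
  have cS: "finite (S e) \<and> card (S e) = 2 * k" if "e \<in> F" for e
    using F that by (auto simp: S_def all_edges_def card_cartesian_product intro: finite_subset)
  let ?len = "\<lambda>ys. \<forall>u\<in>{1..n}. k \<le> length (exits_from u ys)"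
  let ?Q = "\<lambda>\<phi> ys. ?len ys \<and> (\<forall>e\<in>F. {fst (\<phi> e), exits_from (fst (\<phi> e)) ys ! snd (\<phi> e)} = e)"
  have "measure_pmf.prob (srw G m v) {ys. ?len ys \<and> F \<subseteq> first_exits n k ys}
    \<le> (\<Sum>\<phi>\<in>PiE F S. measure_pmf.prob (srw G m v) {ys. ?Q \<phi> ys})"
  proof (rule prob_UN_pmf_le)
    show "finite (PiE F S)" using fF cS by (intro finite_PiE) auto
    fix ys assume ys: "?len ys \<and> F \<subseteq> first_exits n k ys"
    have ex: "\<forall>e\<in>F. \<exists>s. s \<in> S e \<and> {fst s, exits_from (fst s) ys ! snd s} = e"
    proof
      fix e assume "e \<in> F"
      then obtain u i where e: "e = {u, exits_from u ys ! i}" "i < k"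
        using ys unfolding first_exits_def by blast
      show "\<exists>s. s \<in> S e \<and> {fst s, exits_from (fst s) ys ! snd s} = e"
        by (rule exI[of _ "(u, i)"]) (simp add: e S_def)
    qed
    from bchoice[OF ex] obtain \<phi> where
      "\<forall>e\<in>F. \<phi> e \<in> S e \<and> {fst (\<phi> e), exits_from (fst (\<phi> e)) ys ! snd (\<phi> e)} = e" ..
    then show "\<exists>\<phi>\<in>PiE F S. ?Q \<phi> ys"
      using ys by (intro bexI[of _ "restrict \<phi> F"]) auto
  qed
  also have "\<dots> \<le> (\<Sum>\<phi>\<in>PiE F S. of_bool (F \<subseteq> G) * (1 / D) ^ card F)"
  proof (rule sum_mono)
    fix \<phi> assume \<phi>: "\<phi> \<in> PiE F S"
    \<comment> \<open>A place without an assigned edge is unrestricted; a place given two different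
      edges admits no vertex, so assignments that are not injective contribute 0.\<close>
    define R where "R u i = {x. \<forall>e\<in>F. \<phi> e = (u, i) \<longrightarrow> {u, x} = e}" for u i
    define c where "c s = real (card (neighbours G (fst s) \<inter> R (fst s) (snd s))) / real (card (neighbours G (fst s)))" for s
    have im: "\<phi> ` F \<subseteq> {1..n} \<times> {..<k}"
    proof
      fix s assume "s \<in> \<phi> ` F"
      then obtain e where e: "e \<in> F" "s = \<phi> e" by auto
      then have "s \<in> S e" "e \<subseteq> {1..n}" using PiE_mem[OF \<phi>] F by (auto simp: all_edges_def)
      then show "s \<in> {1..n} \<times> {..<k}" unfolding S_def by auto
    qed
    have c0: "0 \<le> c s" for s by (simp add: c_def)
    have "measure_pmf.prob (srw G m v) {ys. ?Q \<phi> ys}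
      \<le> measure_pmf.prob (srw G m v) {ys. \<forall>u\<in>{1..n}. k \<le> length (exits_from u ys) \<and> (\<forall>i<k. exits_from u ys ! i \<in> R u i)}"
      by (rule prob_mono_pmf) (auto simp: R_def)
    also have "\<dots> \<le> (\<Prod>u\<in>{1..n}. \<Prod>i<k. c (u, i))"
      unfolding c_def fst_conv snd_conv using N ne v by (intro exits_prob[where V = "{1..n}"]) auto
    also have "\<dots> = (\<Prod>s\<in>{1..n} \<times> {..<k}. c s)"
      by (simp add: prod.cartesian_product)
    also have "\<dots> \<le> of_bool (F \<subseteq> G) * (1 / D) ^ card F"
    proof (cases "F \<subseteq> G \<and> inj_on \<phi> F")
      case True
      have "(\<Prod>s\<in>{1..n} \<times> {..<k}. c s) \<le> (\<Prod>s\<in>{1..n} \<times> {..<k}. if s \<in> \<phi> ` F then 1 / D else 1)"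
      proof (intro prod_mono conjI c0)
        fix s assume s: "s \<in> {1..n} \<times> {..<k}"
        let ?N = "neighbours G (fst s)"
        have u: "fst s \<in> {1..n}" using s by auto
        have dpos: "0 < real (card ?N)" using d[OF u] D by linarith
        show "c s \<le> (if s \<in> \<phi> ` F then 1 / D else 1)"
        proof (cases "s \<in> \<phi> ` F")
          case True
          then obtain e where e: "e \<in> F" "\<phi> e = s" by auto
          have "x = y" if "x \<in> R (fst s) (snd s)" "y \<in> R (fst s) (snd s)" for x y
          proof -
            have "{fst s, x} = e" "{fst s, y} = e" using that e by (auto simp: R_def)
            then show ?thesis by (metis doubleton_eq_iff)
          qed
          then have "card (?N \<inter> R (fst s) (snd s)) \<le> 1"
            using N(2)[of "fst s"] by (subst card_le_Suc0_iff_eq[folded One_nat_def]) auto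
          then have "c s \<le> 1 / real (card ?N)" unfolding c_def by (intro divide_right_mono) auto
          also have "\<dots> \<le> 1 / D" using D d[OF u] by (intro divide_left_mono) auto
          finally show ?thesis using True by simp
        next
          case False
          have "card (?N \<inter> R (fst s) (snd s)) \<le> card ?N" using N(2) by (intro card_mono) auto
          then show ?thesis using False dpos by (simp add: c_def)
        qed
      qed
      also have "\<dots> = (1 / D) ^ card (\<phi> ` F)"
        using im by (simp add: prod.If_cases Int_absorb1)
      also have "card (\<phi> ` F) = card F" using True by (simp add: card_image)
      finally show ?thesis using True by simp
    next
      case False
      have "\<exists>s\<in>\<phi> ` F. c s = 0"
      proof (cases "F \<subseteq> G")
        case True
        then obtain e e' where e: "e \<in> F" "e' \<in> F" "e \<noteq> e'" "\<phi> e = \<phi> e'"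
          using False by (auto simp: inj_on_def)
        have "R (fst (\<phi> e)) (snd (\<phi> e)) = {}"
          using e by (auto simp: R_def)
        then have "c (\<phi> e) = 0" by (simp add: c_def)
        then show ?thesis using e(1) by blast
      next
        case False
        then obtain e where e: "e \<in> F" "e \<notin> G" by auto
        have "neighbours G (fst (\<phi> e)) \<inter> R (fst (\<phi> e)) (snd (\<phi> e)) = {}"
          using e by (fastforce simp: R_def neighbours_def)
        then have "c (\<phi> e) = 0" by (simp add: c_def)
        then show ?thesis using e(1) by blast
      qed
      then have "\<exists>s\<in>{1..n} \<times> {..<k}. c s = 0" using im by blast
      then have "(\<Prod>s\<in>{1..n} \<times> {..<k}. c s) = 0" by (intro prod_zero) simp
      moreover have "0 \<le> of_bool (F \<subseteq> G) * (1 / D) ^ card F" using D by simp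
      ultimately show ?thesis by linarith
    qed
    finally show "measure_pmf.prob (srw G m v) {ys. ?Q \<phi> ys} \<le> of_bool (F \<subseteq> G) * (1 / D) ^ card F" .
  qed
  also have "\<dots> = real (card (PiE F S)) * (of_bool (F \<subseteq> G) * (1 / D) ^ card F)" by simp
  also have "card (PiE F S) = (2 * k) ^ card F"
    using cS fF by (simp add: card_PiE)
  finally show ?thesis by (cases "F \<subseteq> G") (simp_all add: power_divide power_mult_distrib)
qed

lemma binomial_exp_bound:
  assumes "0 < k"
  shows "real (n choose k) \<le> (exp 1 * real n / real k) ^ k"
proof -
  have "real k ^ k / fact k \<le> exp (real k)"
  proof -
    have "(\<Sum>i\<in>{k}. real k ^ i / fact i) \<le> (\<Sum>i. real k ^ i / fact i)"
      using summable_exp[of "real k"] by (intro sum_le_suminf) (auto simp: field_simps)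
    then show ?thesis by (simp add: exp_def field_simps)
  qed
  then have 1: "real k ^ k \<le> exp 1 ^ k * fact k"
    by (simp add: field_simps flip: exp_of_nat_mult)
  have "real (n choose k) * real k ^ k \<le> real (n choose k) * (exp 1 ^ k * fact k)"
    using 1 by (intro mult_left_mono) auto
  also have "\<dots> = exp 1 ^ k * real ((n choose k) * fact k)" by simp
  also have "\<dots> \<le> exp 1 ^ k * real (n ^ k)"
    by (intro mult_left_mono of_nat_mono binomial_fact_pow) auto
  finally show ?thesis using assms by (simp add: field_simps power_mult_distrib)
qed

text \<open>All of the first \<open>k\<close> exits lie in some \<open>q\<close>-element set of
  neighbours. Choosing that set costs at most \<open>(e d / q) ^ q\<close>, and
  \<open>k \<ge> 2 * q\<close> draws inside it gain \<open>(q / d) ^ (2 * q)\<close>, which leaves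
  one factor \<open>q / d\<close> per element.\<close>

lemma few_distinct_exits:
  assumes G: "G \<subseteq> all_edges n" and ne: "\<And>u. u \<in> {1..n} \<Longrightarrow> neighbours G u \<noteq> {}"
    and v: "v \<in> {1..n}" and u: "u \<in> {1..n}" and q: "0 < q" "2 * q \<le> k"
    and d: "d = card (neighbours G u)" "q \<le> d"
  shows "measure_pmf.prob (srw G m v) {ys. k \<le> length (exits_from u ys) \<and> card (set (take k (exits_from u ys))) < q}
    \<le> (exp 1 * real q / real d) ^ q"
proof -
  let ?N = "neighbours G u"
  have N: "neighbours G x \<subseteq> {1..n}" "finite (neighbours G x)" for x
    using neighbours_subset[OF G] finite_neighbours[OF G] by auto
  define QQ where "QQ = {Q. Q \<subseteq> ?N \<and> card Q = q}"
  have "measure_pmf.prob (srw G m v) {ys. k \<le> length (exits_from u ys) \<and> card (set (take k (exits_from u ys))) < q}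
    \<le> (\<Sum>Q\<in>QQ. measure_pmf.prob (srw G m v) {ys. k \<le> length (exits_from u ys) \<and> set (take k (exits_from u ys)) \<subseteq> Q})"
  proof (rule prob_UN_pmf_le)
    show "finite QQ" using N by (auto simp: QQ_def)
    fix ys assume ys: "ys \<in> set_pmf (srw G m v)" and P: "k \<le> length (exits_from u ys) \<and> card (set (take k (exits_from u ys))) < q"
    have "set (take k (exits_from u ys)) \<subseteq> ?N"
      using exits_from_srw[OF N(2) ys, of u] set_take_subset by fastforce
    then obtain Q where "set (take k (exits_from u ys)) \<subseteq> Q" "Q \<subseteq> ?N" "card Q = q"
      using exists_subset_between[of "set (take k (exits_from u ys))" q ?N] P d N(2) by auto
    then show "\<exists>Q\<in>QQ. k \<le> length (exits_from u ys) \<and> set (take k (exits_from u ys)) \<subseteq> Q"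
      using P by (auto simp: QQ_def)
  qed
  also have "\<dots> \<le> (\<Sum>Q\<in>QQ. (real q / real d) ^ k)"
  proof (rule sum_mono)
    fix Q assume Q: "Q \<in> QQ"
    have "measure_pmf.prob (srw G m v) {ys. k \<le> length (exits_from u ys) \<and> set (take k (exits_from u ys)) \<subseteq> Q}
      \<le> measure_pmf.prob (srw G m v) {ys. \<forall>x\<in>{u}. k \<le> length (exits_from x ys) \<and> (\<forall>i<k. exits_from x ys ! i \<in> Q)}"
    proof (rule prob_mono_pmf)
      fix ys assume a: "k \<le> length (exits_from u ys) \<and> set (take k (exits_from u ys)) \<subseteq> Q"
      have "exits_from u ys ! i \<in> Q" if "i < k" for i
      proof -
        have "take k (exits_from u ys) ! i \<in> set (take k (exits_from u ys))" using a that by (intro nth_mem) auto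
        then show ?thesis using a that by auto
      qed
      then show "\<forall>x\<in>{u}. k \<le> length (exits_from x ys) \<and> (\<forall>i<k. exits_from x ys ! i \<in> Q)" using a by auto
    qed
    also have "\<dots> \<le> (\<Prod>x\<in>{u}. \<Prod>i<k. real (card (neighbours G x \<inter> Q)) / real (card (neighbours G x)))"
      using exits_prob[where I = "{u}" and r = "\<lambda>_. k" and R = "\<lambda>_ _. Q" and V = "{1..n}"] N ne v by auto
    also have "\<dots> = (real q / real d) ^ k"
      using Q d by (auto simp: QQ_def Int_absorb1)
    finally show "measure_pmf.prob (srw G m v) {ys. k \<le> length (exits_from u ys) \<and> set (take k (exits_from u ys)) \<subseteq> Q}
      \<le> (real q / real d) ^ k" .
  qed
  also have "\<dots> = real (d choose q) * (real q / real d) ^ k"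
    using N d by (simp add: QQ_def n_subsets)
  also have "\<dots> \<le> (exp 1 * real d / real q) ^ q * (real q / real d) ^ (2 * q)"
    using q d by (intro mult_mono binomial_exp_bound power_decreasing) auto
  also have "\<dots> = (exp 1 * real d / real q * (real q / real d * (real q / real d))) ^ q"
    by (simp only: power_mult_distrib power_mult power2_eq_square)
  also have "exp 1 * real d / real q * (real q / real d * (real q / real d)) = exp 1 * real q / real d"
    using q d by simp
  finally show ?thesis .
qed

section \<open>Small sets that do not expand\<close>

definition touching :: "'a set \<Rightarrow> 'a set \<Rightarrow> 'a set set" where
  "touching A D = {e. e \<subseteq> D \<and> e \<inter> A \<noteq> {} \<and> card e = 2}"

text \<open>Counting only pairs that meet \<open>A\<close> gives a bound linear in
  \<open>card A\<close>. In \<open>dense_sets_bound\<close> the size \<open>a\<close> then cancels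
  from the base of the binomial estimate.\<close>

lemma card_touching:
  assumes "finite A" "finite D"
  shows "finite (touching A D) \<and> card (touching A D) \<le> card A * card D"
proof -
  have "touching A D \<subseteq> (\<lambda>(a, b). {a, b}) ` (A \<times> D)"
  proof
    fix e assume e: "e \<in> touching A D"
    then obtain a where a: "a \<in> e" "a \<in> A" by (auto simp: touching_def)
    then obtain b where "e = {a, b}"
      using e by (auto simp: touching_def card_2_iff)
    then show "e \<in> (\<lambda>(a, b). {a, b}) ` (A \<times> D)" using a e by (auto simp: touching_def)
  qed
  moreover have "finite ((\<lambda>(a, b). {a, b}) ` (A \<times> D))" using assms by auto
  moreover have "card ((\<lambda>(a, b). {a, b}) ` (A \<times> D)) \<le> card A * card D"
    using assms card_image_le[of "A \<times> D"] by (simp add: card_cartesian_product)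
  ultimately show ?thesis by (meson card_mono finite_subset le_trans)
qed

text \<open>Each \<open>u \<in> A\<close> contributes at least \<open>2 * \<kappa>\<close> exits, and an edge inside \<open>A\<close> is counted at most twice.\<close>

lemma dense_set:
  assumes A: "A \<subseteq> {1..n}" and q: "card A + card (nbhd n (walk_edges ys) A) \<le> q" "q \<le> n"
    and len: "\<And>u. u \<in> {1..n} \<Longrightarrow> k \<le> length (exits_from u ys)"
    and nb: "\<And>u. set (exits_from u ys) \<subseteq> {1..n} - {u}"
    and dist: "\<And>u. u \<in> {1..n} \<Longrightarrow> 2 * \<kappa> \<le> card (set (take k (exits_from u ys)))"
  shows "\<exists>D F. A \<subseteq> D \<and> D \<subseteq> {1..n} \<and> card D = q \<and> F \<subseteq> touching A D \<and> card F = card A * \<kappa>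
      \<and> F \<subseteq> first_exits n k ys"
proof -
  have fA: "finite A" using A finite_subset by blast
  let ?N = "nbhd n (walk_edges ys) A"
  have N: "?N \<subseteq> {1..n}" by (auto simp: nbhd_def)
  have "card (A \<union> ?N) \<le> q" using card_Un_le[of A ?N] q by linarith
  then obtain D where D: "A \<union> ?N \<subseteq> D" "D \<subseteq> {1..n}" "card D = q"
    using exists_subset_between[of "A \<union> ?N" q "{1..n}"] A N q by auto
  define S where "S = (SIGMA u:A. set (take k (exits_from u ys)))"
  define FA where "FA = (\<lambda>(u, x). {u, x}) ` S"
  have fS: "finite S" using fA by (simp add: S_def)
  have mem: "u \<in> A \<and> x \<in> D \<and> x \<noteq> u \<and> (\<exists>i<k. x = exits_from u ys ! i)" if "(u, x) \<in> S" for u x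
  proof -
    have u: "u \<in> A" and x: "x \<in> set (take k (exits_from u ys))" using that by (auto simp: S_def)
    have x': "x \<in> set (exits_from u ys)" using x set_take_subset by fastforce
    have "\<exists>i<k. x = exits_from u ys ! i" using x by (auto simp: in_set_conv_nth)
    moreover have "x \<in> A \<or> x \<in> ?N"
      using exits_from_walk_edges[OF x'] u nb[of u] x' by (auto simp: nbhd_def)
    ultimately show ?thesis using u D(1) nb[of u] x' by auto
  qed
  have FA: "FA \<subseteq> touching A D" "FA \<subseteq> first_exits n k ys"
    using mem A D(1) by (fastforce simp: FA_def touching_def first_exits_def)+
  have "card A * (2 * \<kappa>) = (\<Sum>u\<in>A. 2 * \<kappa>)" by simp
  also have "\<dots> \<le> (\<Sum>u\<in>A. card (set (take k (exits_from u ys))))"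
    using A by (intro sum_mono dist) auto
  also have "\<dots> = card S" using fA by (simp add: S_def)
  also have "\<dots> \<le> card (\<Union>e\<in>FA. {s \<in> S. (case s of (u, x) \<Rightarrow> {u, x}) = e})"
    using fS by (intro card_mono) (auto simp: FA_def)
  also have "\<dots> \<le> (\<Sum>e\<in>FA. card {s \<in> S. (case s of (u, x) \<Rightarrow> {u, x}) = e})"
    using fS by (intro card_UN_le) (simp add: FA_def)
  also have "\<dots> \<le> (\<Sum>e\<in>FA. 2)"
  proof (rule sum_mono)
    fix e assume "e \<in> FA"
    then obtain a b where e: "e = {a, b}" by (auto simp: FA_def)
    have "{s \<in> S. (case s of (u, x) \<Rightarrow> {u, x}) = e} \<subseteq> {(a, b), (b, a)}"
      unfolding e by (clarsimp simp: doubleton_eq_iff)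
    then have "card {s \<in> S. (case s of (u, x) \<Rightarrow> {u, x}) = e} \<le> card {(a, b), (b, a)}"
      by (intro card_mono) simp_all
    also have "\<dots> \<le> 2" by (cases "a = b") simp_all
    finally show "card {s \<in> S. (case s of (u, x) \<Rightarrow> {u, x}) = e} \<le> 2" .
  qed
  finally have "card A * \<kappa> \<le> card FA" by simp
  then obtain F where F: "F \<subseteq> FA" "card F = card A * \<kappa>" by (rule obtain_subset_with_card_n)
  have "A \<subseteq> D" using D(1) by blast
  moreover have "F \<subseteq> touching A D" "F \<subseteq> first_exits n k ys" using F(1) FA by blast+
  ultimately show ?thesis using D(2,3) F(2) by blast
qed

text \<open>A union over \<open>A\<close>, \<open>D\<close> and the edge set \<open>F\<close>. The
  power \<open>a * \<kappa>\<close> combines three factors per edge: the choice of \<open>F\<close>,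
  its presence in the graph (\<open>p\<close>), and its traversal by first exits
  (\<open>2 * k / D1\<close>).\<close>

lemma dense_sets_bound:
  assumes p: "0 \<le> p" "p \<le> 1" and D1: "0 < D1" and v: "v \<in> {1..n}" and \<kappa>: "0 < \<kappa>" and a: "0 < a" "a \<le> q" and q: "q \<le> n"
    and good: "\<And>G u. G \<subseteq> all_edges n \<Longrightarrow> good G \<Longrightarrow> u \<in> {1..n} \<Longrightarrow> D1 \<le> real (card (neighbours G u))"
  shows "subset_mean p (all_edges n) (\<lambda>G. of_bool (good G) * measure_pmf.prob (srw G m v)
      {ys. (\<forall>u\<in>{1..n}. k \<le> length (exits_from u ys)) \<and> (\<exists>A D F. A \<subseteq> {1..n} \<and> card A = a \<and> D \<subseteq> {1..n} \<and> card D = q \<and>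
          F \<subseteq> touching A D \<and> card F = a * \<kappa> \<and> F \<subseteq> first_exits n k ys)})
    \<le> real n ^ a * (exp 1 * real n / real q) ^ q * (2 * exp 1 * real q * real k * p / (real \<kappa> * D1)) ^ (a * \<kappa>)"
    (is "?lhs \<le> _")
proof -
  define AA where "AA = {A. A \<subseteq> {1..n} \<and> card A = a}"
  define DD where "DD = {D. D \<subseteq> {1..n} \<and> card D = q}"
  define FF where "FF A D = {F. F \<subseteq> touching A D \<and> card F = a * \<kappa>}" for A D :: "nat set"
  have fin: "finite AA" "finite DD" by (auto simp: AA_def DD_def)
  have fF: "finite (FF A D)" "real (card (FF A D)) \<le> (exp 1 * real q / real \<kappa>) ^ (a * \<kappa>)" "F \<in> FF A D \<Longrightarrow> F \<subseteq> all_edges n"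
    if "A \<in> AA" "D \<in> DD" for A D F
  proof -
    have AD: "finite A" "finite D" "card A = a" "card D = q" "D \<subseteq> {1..n}"
      using that by (auto simp: AA_def DD_def intro: finite_subset)
    note t = card_touching[OF AD(1,2)]
    show "finite (FF A D)" using t by (simp add: FF_def)
    have "card (FF A D) = card (touching A D) choose (a * \<kappa>)" using t by (simp add: FF_def n_subsets)
    also have "\<dots> \<le> (a * q) choose (a * \<kappa>)" using t AD by (intro binomial_right_mono) auto
    finally have "real (card (FF A D)) \<le> real ((a * q) choose (a * \<kappa>))" by (rule of_nat_mono)
    also have "\<dots> \<le> (exp 1 * real (a * q) / real (a * \<kappa>)) ^ (a * \<kappa>)"
      using a \<kappa> by (intro binomial_exp_bound) auto
    also have "exp 1 * real (a * q) / real (a * \<kappa>) = exp 1 * real q / real \<kappa>" using a by simp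
    finally show "real (card (FF A D)) \<le> (exp 1 * real q / real \<kappa>) ^ (a * \<kappa>)" .
    show "F \<subseteq> all_edges n" if "F \<in> FF A D"
      using that AD by (auto simp: FF_def touching_def all_edges_def)
  qed
  let ?Q = "\<lambda>F ys. (\<forall>u\<in>{1..n}. k \<le> length (exits_from u ys)) \<and> F \<subseteq> first_exits n k ys"
  let ?x = "(2 * real k / D1) ^ (a * \<kappa>)"
  have "?lhs \<le> subset_mean p (all_edges n) (\<lambda>G. \<Sum>A\<in>AA. \<Sum>D\<in>DD. \<Sum>F\<in>FF A D. ?x * of_bool (F \<subseteq> G))"
  proof (rule subset_mean_mono[OF p])
    fix G assume G: "G \<subseteq> all_edges n"
    show "of_bool (good G) * measure_pmf.prob (srw G m v)
      {ys. (\<forall>u\<in>{1..n}. k \<le> length (exits_from u ys)) \<and> (\<exists>A D F. A \<subseteq> {1..n} \<and> card A = a \<and> D \<subseteq> {1..n} \<and> card D = q \<and>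
          F \<subseteq> touching A D \<and> card F = a * \<kappa> \<and> F \<subseteq> first_exits n k ys)}
      \<le> (\<Sum>A\<in>AA. \<Sum>D\<in>DD. \<Sum>F\<in>FF A D. ?x * of_bool (F \<subseteq> G))"
    proof (cases "good G")
      case True
      have "measure_pmf.prob (srw G m v)
        {ys. (\<forall>u\<in>{1..n}. k \<le> length (exits_from u ys)) \<and> (\<exists>A D F. A \<subseteq> {1..n} \<and> card A = a \<and> D \<subseteq> {1..n} \<and> card D = q \<and>
          F \<subseteq> touching A D \<and> card F = a * \<kappa> \<and> F \<subseteq> first_exits n k ys)}
        \<le> (\<Sum>A\<in>AA. measure_pmf.prob (srw G m v) {ys. \<exists>D\<in>DD. \<exists>F\<in>FF A D. ?Q F ys})"
        by (rule prob_UN_pmf_le) (auto simp: fin AA_def DD_def FF_def)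
      also have "\<dots> \<le> (\<Sum>A\<in>AA. \<Sum>D\<in>DD. measure_pmf.prob (srw G m v) {ys. \<exists>F\<in>FF A D. ?Q F ys})"
        by (intro sum_mono prob_UN_pmf_le fin) auto
      also have "\<dots> \<le> (\<Sum>A\<in>AA. \<Sum>D\<in>DD. \<Sum>F\<in>FF A D. measure_pmf.prob (srw G m v) {ys. ?Q F ys})"
        by (intro sum_mono prob_UN_pmf_le fF) auto
      also have "\<dots> \<le> (\<Sum>A\<in>AA. \<Sum>D\<in>DD. \<Sum>F\<in>FF A D. ?x * of_bool (F \<subseteq> G))"
      proof (intro sum_mono)
        fix A D F assume "A \<in> AA" "D \<in> DD" "F \<in> FF A D"
        then have "F \<subseteq> all_edges n" "card F = a * \<kappa>" using fF(3) by (auto simp: FF_def)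
        then show "measure_pmf.prob (srw G m v) {ys. ?Q F ys} \<le> ?x * of_bool (F \<subseteq> G)"
          using edges_prob[OF G good[OF G True] D1 v, of F m k] by (simp add: mult.commute)
      qed
      finally show ?thesis using True by simp
    next
      case False
      then show ?thesis using D1 by (auto intro!: sum_nonneg)
    qed
  qed
  also have "\<dots> = (\<Sum>A\<in>AA. \<Sum>D\<in>DD. \<Sum>F\<in>FF A D. ?x * p ^ (a * \<kappa>))"
    unfolding subset_mean_sum subset_mean_cmult using fF(3)
    by (intro sum.cong refl arg_cong2[of _ _ _ _ "(*)"]) (auto simp: subset_mean_subset[OF finite_all_edges] FF_def)
  also have "\<dots> = (\<Sum>A\<in>AA. \<Sum>D\<in>DD. real (card (FF A D)) * (?x * p ^ (a * \<kappa>)))" by simp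
  also have "\<dots> \<le> (\<Sum>A\<in>AA. \<Sum>D\<in>DD. (exp 1 * real q / real \<kappa>) ^ (a * \<kappa>) * (?x * p ^ (a * \<kappa>)))"
    using p D1 by (intro sum_mono mult_right_mono fF) auto
  also have "\<dots> = real (n choose a) * real (n choose q) * ((exp 1 * real q / real \<kappa>) ^ (a * \<kappa>) * (?x * p ^ (a * \<kappa>)))"
    by (simp add: AA_def DD_def n_subsets)
  also have "(exp 1 * real q / real \<kappa>) ^ (a * \<kappa>) * (?x * p ^ (a * \<kappa>))
     = (2 * exp 1 * real q * real k * p / (real \<kappa> * D1)) ^ (a * \<kappa>)"
    unfolding power_mult_distrib[symmetric] by (simp add: mult_ac)
  also have "real (n choose a) * real (n choose q) * \<dots> \<le> real n ^ a * (exp 1 * real n / real q) ^ q * \<dots>"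
  proof (intro mult_right_mono mult_mono)
    have "(n choose a) * 1 \<le> (n choose a) * fact a" by (intro mult_left_mono fact_ge_1) auto
    also have "\<dots> \<le> n ^ a" by (rule binomial_fact_pow)
    finally show "real (n choose a) \<le> real n ^ a" by (metis mult_1_right of_nat_mono of_nat_power)
    show "real (n choose q) \<le> (exp 1 * real n / real q) ^ q"
      using a by (intro binomial_exp_bound) auto
  qed (use p D1 in auto)
  finally show ?thesis .
qed

section \<open>Pairs of sets with no traversed edge between them\<close>

definition between :: "'a set \<Rightarrow> 'a set \<Rightarrow> 'a set set" where
  "between A B = (\<lambda>(a, b). {a, b}) ` (A \<times> B)"

lemma card_between:
  assumes "A \<inter> B = {}"
  shows "card (between A B) = card A * card B"
proof -
  have "inj_on (\<lambda>(a, b). {a, b}) (A \<times> B)"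
    using assms by (auto simp: inj_on_def doubleton_eq_iff)
  then show ?thesis by (simp add: between_def card_image card_cartesian_product)
qed

text \<open>Only exits from \<open>A\<close> are examined: each of the first \<open>k\<close> exits
  from a vertex of \<open>A\<close> must avoid \<open>B\<close>. The bound is kept as an exponential
  of the number of graph edges between the sets, so that averaging over the graph gives a moment
  generating function.\<close>

lemma no_edge_prob:
  assumes G: "G \<subseteq> all_edges n" and d: "\<And>u. u \<in> {1..n} \<Longrightarrow> 0 < card (neighbours G u) \<and> real (card (neighbours G u)) \<le> D2"
    and v: "v \<in> {1..n}" and A: "A \<subseteq> {1..n}"
  shows "measure_pmf.prob (srw G m v) {ys. (\<forall>u\<in>{1..n}. k \<le> length (exits_from u ys)) \<and>
      \<not> (\<exists>a\<in>A. \<exists>b\<in>B. {a, b} \<in># walk_edges ys)} \<le> exp (- (real k / D2) * real (card (G \<inter> between A B)))"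
proof -
  have N: "neighbours G x \<subseteq> {1..n}" "finite (neighbours G x)" for x
    using neighbours_subset[OF G] finite_neighbours[OF G] by auto
  have ne: "neighbours G x \<noteq> {}" if "x \<in> {1..n}" for x using d[OF that] by auto
  have fA: "finite A" using A finite_subset by blast
  have "measure_pmf.prob (srw G m v) {ys. (\<forall>u\<in>{1..n}. k \<le> length (exits_from u ys)) \<and>
      \<not> (\<exists>a\<in>A. \<exists>b\<in>B. {a, b} \<in># walk_edges ys)}
    \<le> measure_pmf.prob (srw G m v) {ys. \<forall>u\<in>A. k \<le> length (exits_from u ys) \<and> (\<forall>i<k. exits_from u ys ! i \<in> - B)}"
  proof (rule prob_mono_pmf)
    fix ys assume ys: "(\<forall>u\<in>{1..n}. k \<le> length (exits_from u ys)) \<and> \<not> (\<exists>a\<in>A. \<exists>b\<in>B. {a, b} \<in># walk_edges ys)"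
    show "\<forall>u\<in>A. k \<le> length (exits_from u ys) \<and> (\<forall>i<k. exits_from u ys ! i \<in> - B)"
    proof (intro ballI conjI allI impI)
      fix u assume u: "u \<in> A"
      then show len: "k \<le> length (exits_from u ys)" using ys A by blast
      fix i assume "i < k"
      then have "exits_from u ys ! i \<in> set (exits_from u ys)" using len by auto
      from exits_from_walk_edges[OF this] show "exits_from u ys ! i \<in> - B" using ys u by auto
    qed
  qed
  also have "\<dots> \<le> (\<Prod>u\<in>A. \<Prod>i<k. real (card (neighbours G u \<inter> - B)) / real (card (neighbours G u)))"
    using exits_prob[where I = A and r = "\<lambda>_. k" and R = "\<lambda>_ _. - B" and V = "{1..n}"] N ne v fA by auto
  also have "\<dots> \<le> (\<Prod>u\<in>A. exp (- (real k / D2) * real (card (neighbours G u \<inter> B))))"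
  proof (intro prod_mono conjI prod_nonneg)
    fix u assume "u \<in> A"
    then have u: "u \<in> {1..n}" using A by blast
    let ?d = "real (card (neighbours G u))" and ?b = "real (card (neighbours G u \<inter> B))"
    have "card (neighbours G u) = card (neighbours G u \<inter> B) + card (neighbours G u \<inter> - B)"
      using N(2)[of u] by (subst card_Un_disjoint[symmetric]) (auto intro: arg_cong[of _ _ card])
    then have "real (card (neighbours G u \<inter> - B)) = ?d - ?b" by simp
    then have "real (card (neighbours G u \<inter> - B)) / ?d = 1 + - (?b / ?d)"
      using d[OF u] by (simp add: diff_divide_distrib)
    also have "\<dots> \<le> 1 + - (?b / D2)"
      using d[OF u] by (intro add_left_mono le_imp_neg_le divide_left_mono) auto
    also have "\<dots> \<le> exp (- (?b / D2))" by (rule exp_ge_add_one_self)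
    finally have "(real (card (neighbours G u \<inter> - B)) / ?d) ^ k \<le> exp (- (?b / D2)) ^ k"
      by (intro power_mono) auto
    also have "\<dots> = exp (- (real k / D2) * ?b)" by (simp flip: exp_of_nat_mult)
    finally show "(\<Prod>i<k. real (card (neighbours G u \<inter> - B)) / ?d) \<le> exp (- (real k / D2) * ?b)" by simp
  qed auto
  also have "\<dots> = exp (- (real k / D2) * real (\<Sum>u\<in>A. card (neighbours G u \<inter> B)))"
    using fA by (simp add: exp_sum[symmetric] sum_distrib_left[symmetric] sum_negf sum_divide_distrib[symmetric])
  also have "\<dots> \<le> exp (- (real k / D2) * real (card (G \<inter> between A B)))"
  proof -
    have "card (G \<inter> between A B) \<le> card (\<Union>u\<in>A. (\<lambda>b. {u, b}) ` (neighbours G u \<inter> B))"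
      using fA N(2) by (intro card_mono) (auto simp: between_def neighbours_def)
    also have "\<dots> \<le> (\<Sum>u\<in>A. card ((\<lambda>b. {u, b}) ` (neighbours G u \<inter> B)))" by (rule card_UN_le[OF fA])
    also have "\<dots> \<le> (\<Sum>u\<in>A. card (neighbours G u \<inter> B))"
      using N(2) by (intro sum_mono card_image_le) auto
    finally have "real (card (G \<inter> between A B)) \<le> real (\<Sum>u\<in>A. card (neighbours G u \<inter> B))" by (rule of_nat_mono)
    moreover have "0 \<le> real k / D2" using d[OF v] by (intro divide_nonneg_nonneg) auto
    ultimately have "real k / D2 * real (card (G \<inter> between A B)) \<le> real k / D2 * real (\<Sum>u\<in>A. card (neighbours G u \<inter> B))"
      by (intro mult_left_mono)
    then show ?thesis by simp
  qed
  finally show ?thesis .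
qed

lemma exp_neg_le: "0 \<le> t \<Longrightarrow> t \<le> 1 \<Longrightarrow> exp (- t) - 1 \<le> - t / (2::real)"
proof -
  assume t: "0 \<le> t" "t \<le> 1"
  have "exp (- t) \<le> 1 / (1 + t)"
    using exp_ge_add_one_self[of t] t by (simp add: exp_minus field_simps)
  also have "1 / (1 + t) = 1 - t / (1 + t)" using t by (simp add: field_simps)
  also have "\<dots> \<le> 1 - t / 2" using t by (intro diff_left_mono divide_left_mono) auto
  finally show ?thesis by simp
qed

text \<open>For disjoint sets of size \<open>s\<close> the number of graph edges between them is
  binomial with \<open>s * s\<close> trials. The condition \<open>k \<le> D2\<close> keeps
  \<open>t = k / D2\<close> in the range where \<open>exp (- t) - 1 \<le> - t / 2\<close>.\<close>

lemma no_edges_bound: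
  assumes p: "0 \<le> p" "p \<le> 1" and v: "v \<in> {1..n}" and s: "0 < s" and k: "real k \<le> D2" and D2: "0 < D2"
    and good: "\<And>G u. G \<subseteq> all_edges n \<Longrightarrow> good G \<Longrightarrow> u \<in> {1..n} \<Longrightarrow>
       0 < card (neighbours G u) \<and> real (card (neighbours G u)) \<le> D2"
  shows "subset_mean p (all_edges n) (\<lambda>G. of_bool (good G) * measure_pmf.prob (srw G m v)
      {ys. (\<forall>u\<in>{1..n}. k \<le> length (exits_from u ys)) \<and> (\<exists>A B. A \<subseteq> {1..n} \<and> card A = s \<and> B \<subseteq> {1..n} \<and> card B = s \<and>
          A \<inter> B = {} \<and> \<not> (\<exists>a\<in>A. \<exists>b\<in>B. {a, b} \<in># walk_edges ys))})
    \<le> (exp 1 * real n / real s) ^ (2 * s) * exp (- (real s)\<^sup>2 * p * real k / (2 * D2))" (is "?lhs \<le> _")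
proof -
  define AA where "AA = {A. A \<subseteq> {1..n} \<and> card A = s}"
  define PP where "PP = {(A, B). A \<in> AA \<and> B \<in> AA \<and> A \<inter> B = {}}"
  have sub: "PP \<subseteq> AA \<times> AA" by (auto simp: PP_def)
  have fA: "finite AA" by (simp add: AA_def)
  have "card PP \<le> card (AA \<times> AA)" using sub fA by (intro card_mono) simp_all
  then have PP: "finite PP" "card PP \<le> card AA * card AA"
    using sub fA finite_subset[OF sub] by (simp_all add: card_cartesian_product)
  let ?Q = "\<lambda>P ys. (\<forall>u\<in>{1..n}. k \<le> length (exits_from u ys)) \<and> \<not> (\<exists>a\<in>fst P. \<exists>b\<in>snd P. {a, b} \<in># walk_edges ys)"
  have "?lhs \<le> subset_mean p (all_edges n) (\<lambda>G. \<Sum>P\<in>PP. exp (- (real k / D2) * real (card (G \<inter> between (fst P) (snd P)))))"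
  proof (rule subset_mean_mono[OF p])
    fix G assume G: "G \<subseteq> all_edges n"
    show "of_bool (good G) * measure_pmf.prob (srw G m v)
      {ys. (\<forall>u\<in>{1..n}. k \<le> length (exits_from u ys)) \<and> (\<exists>A B. A \<subseteq> {1..n} \<and> card A = s \<and> B \<subseteq> {1..n} \<and> card B = s \<and>
          A \<inter> B = {} \<and> \<not> (\<exists>a\<in>A. \<exists>b\<in>B. {a, b} \<in># walk_edges ys))}
      \<le> (\<Sum>P\<in>PP. exp (- (real k / D2) * real (card (G \<inter> between (fst P) (snd P)))))"
    proof (cases "good G")
      case True
      have "measure_pmf.prob (srw G m v)
        {ys. (\<forall>u\<in>{1..n}. k \<le> length (exits_from u ys)) \<and> (\<exists>A B. A \<subseteq> {1..n} \<and> card A = s \<and> B \<subseteq> {1..n} \<and> card B = s \<and>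
          A \<inter> B = {} \<and> \<not> (\<exists>a\<in>A. \<exists>b\<in>B. {a, b} \<in># walk_edges ys))}
        \<le> (\<Sum>P\<in>PP. measure_pmf.prob (srw G m v) {ys. ?Q P ys})"
      proof (rule prob_UN_pmf_le[OF PP(1)], elim conjE exE)
        fix ys A B assume "\<forall>u\<in>{1..n}. k \<le> length (exits_from u ys)" "A \<subseteq> {1..n}" "card A = s" "B \<subseteq> {1..n}" "card B = s"
          "A \<inter> B = {}" "\<not> (\<exists>a\<in>A. \<exists>b\<in>B. {a, b} \<in># walk_edges ys)"
        then show "\<exists>P\<in>PP. ?Q P ys" by (intro bexI[of _ "(A, B)"]) (simp_all add: PP_def AA_def)
      qed
      also have "\<dots> \<le> (\<Sum>P\<in>PP. exp (- (real k / D2) * real (card (G \<inter> between (fst P) (snd P)))))"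
        using good[OF G True] v by (intro sum_mono no_edge_prob[OF G]) (auto simp: PP_def AA_def)
      finally show ?thesis using True by simp
    qed (auto intro!: sum_nonneg)
  qed
  also have "\<dots> \<le> (\<Sum>P\<in>PP. exp (- (real s)\<^sup>2 * p * real k / (2 * D2)))"
    unfolding subset_mean_sum
  proof (rule sum_mono)
    fix P assume P: "P \<in> PP"
    have sub: "between (fst P) (snd P) \<subseteq> all_edges n"
      using P by (auto simp: PP_def AA_def between_def all_edges_def card_insert_if)
    have c: "card (between (fst P) (snd P)) = s * s"
      using P by (auto simp: PP_def AA_def card_between)
    have "subset_mean p (all_edges n) (\<lambda>G. exp (- (real k / D2) * real (card (G \<inter> between (fst P) (snd P)))))
       \<le> exp (real (s * s) * (p * (exp (- (real k / D2)) - 1)))"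
      using subset_mean_exp_card_le[OF finite_all_edges sub p] unfolding c .
    also have "\<dots> \<le> exp (real (s * s) * (p * (- (real k / D2) / 2)))"
      using k D2 p by (intro exp_le_cancel_iff[THEN iffD2] mult_left_mono exp_neg_le) auto
    finally show "subset_mean p (all_edges n) (\<lambda>G. exp (- (real k / D2) * real (card (G \<inter> between (fst P) (snd P)))))
       \<le> exp (- (real s)\<^sup>2 * p * real k / (2 * D2))"
      by (simp add: power2_eq_square mult_ac)
  qed
  also have "\<dots> = real (card PP) * exp (- (real s)\<^sup>2 * p * real k / (2 * D2))" by simp
  also have "\<dots> \<le> (exp 1 * real n / real s) ^ (2 * s) * exp (- (real s)\<^sup>2 * p * real k / (2 * D2))"
  proof (intro mult_right_mono)
    have "real (card PP) \<le> real (n choose s) * real (n choose s)"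
      using PP(2) by (simp add: AA_def n_subsets flip: of_nat_mult)
    also have "\<dots> \<le> (exp 1 * real n / real s) ^ s * (exp 1 * real n / real s) ^ s"
      using s by (intro mult_mono binomial_exp_bound) auto
    finally show "real (card PP) \<le> (exp 1 * real n / real s) ^ (2 * s)"
      by (simp add: mult_2 power_add)
  qed auto
  finally show ?thesis .
qed

section \<open>Concentration of the degrees\<close>

lemma card_neighbours:
  assumes "G \<subseteq> all_edges n" "u \<in> {1..n}"
  shows "card (neighbours G u) = card (G \<inter> between {u} ({1..n} - {u}))"
proof -
  have "G \<inter> between {u} ({1..n} - {u}) = (\<lambda>x. {u, x}) ` neighbours G u"
    using neighbours_subset[OF assms(1), of u] by (auto simp: between_def neighbours_def)
  moreover have "inj_on (\<lambda>x. {u, x}) (neighbours G u)" by (auto simp: inj_on_def doubleton_eq_iff)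
  ultimately show ?thesis by (simp add: card_image)
qed

text \<open>Exponential Markov inequality; the sign of \<open>s\<close> decides whether it bounds
  the upper or the lower tail.\<close>

lemma degree_tail:
  assumes p: "0 \<le> p" "p \<le> 1" and u: "u \<in> {1..n}"
  shows "subset_mean p (all_edges n) (\<lambda>G. of_bool (x \<le> s * real (card (neighbours G u))))
    \<le> exp (real (n - 1) * p * (exp s - 1) - x)"
proof -
  let ?F = "between {u} ({1..n} - {u})"
  have sub: "?F \<subseteq> all_edges n"
    using u by (auto simp: between_def all_edges_def card_insert_if)
  have c: "card ?F = n - 1" using u by (subst card_between) auto
  have "subset_mean p (all_edges n) (\<lambda>G. of_bool (x \<le> s * real (card (neighbours G u))))
    \<le> subset_mean p (all_edges n) (\<lambda>G. exp (- x) * exp (s * real (card (G \<inter> ?F))))"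
    using card_neighbours[OF _ u] by (intro subset_mean_mono p) (auto simp: exp_add[symmetric] of_bool_def)
  also have "\<dots> \<le> exp (- x) * exp (real (n - 1) * (p * (exp s - 1)))"
    unfolding subset_mean_cmult using subset_mean_exp_card_le[OF finite_all_edges sub p, of s] c by simp
  also have "\<dots> = exp (real (n - 1) * p * (exp s - 1) - x)"
    by (simp add: exp_add[symmetric] mult.assoc)
  finally show ?thesis .
qed

subsection \<open>The failure probability\<close>

text \<open>The margin 1 in the lower bound covers the possible loss of the edge to \<open>w\<close>
  when degrees are taken without \<open>w\<close>.\<close>

definition regular_graph :: "nat \<Rightarrow> real \<Rightarrow> real \<Rightarrow> nat set set \<Rightarrow> bool" where
  "regular_graph n D1 D2 G \<longleftrightarrow> (\<forall>u\<in>{1..n}. D1 + 1 \<le> real (card (neighbours G u)) \<and> real (card (neighbours G u)) \<le> D2)"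

text \<open>\<open>k\<close> is \<open>4 * \<kappa>\<close> because two halvings follow:
  \<open>few_distinct_exits\<close> finds \<open>2 * \<kappa>\<close> distinct vertices among
  \<open>4 * \<kappa>\<close> exits, and \<open>dense_set\<close> keeps \<open>\<kappa>\<close>
  edges per vertex since an edge may be seen from both ends.\<close>

lemma failure_bound:
  fixes n L \<kappa> M s0 :: nat and p D1 D2 r s a \<beta> :: real
  defines "k \<equiv> 4 * \<kappa>" and "Am \<equiv> nat \<lfloor>real n / ln (real n)\<rfloor>"
    and "s0 \<equiv> nat \<lceil>real n * ln (ln (real n)) powr 1.5 / ln (real n)\<rceil>"
  assumes p: "0 < p" "p \<le> 1" and v0: "v0 \<in> {1..n}" and D1: "0 < D1" and D2: "0 < D2"
    and r: "0 < r" "r \<le> 1 - real M / D1" and np: "real n * p + 2 * real M \<le> 2 * D1"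
    and s: "0 \<le> s" and a: "a = (1 - exp (- s)) * (r * p / (D2 + 1))" "a \<le> 1 / 4"
    and \<kappa>: "0 < \<kappa>" "2 * real \<kappa> \<le> D1" "4 * real \<kappa> \<le> D2"
    and q: "\<And>i. i \<in> {1..Am} \<Longrightarrow> real i + real i * (\<beta> * ln (real n)) \<le> real (q i) \<and> q i \<le> n" and \<beta>: "0 \<le> \<beta> * ln (real n)"
    and s0: "0 < s0"
  shows "subset_mean p (all_edges n) (\<lambda>G. measure_pmf.prob (srw G L v0) {ys. \<not> (E1 \<beta> n (walk_edges ys) \<and> E2 n (walk_edges ys))})
    \<le> subset_mean p (all_edges n) (\<lambda>G. of_bool (\<not> regular_graph n D1 D2 G))
     + real n * exp (2 + 8 * p * real (Suc L) / D1 + 16 * (real M + 1)\<^sup>2 / D1 - (real M + 1))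
     + real n * exp ((s + 1) * real k - a * real L)
     + real n * (exp 1 * (2 * real \<kappa>) / D1) ^ (2 * \<kappa>)
     + (\<Sum>i\<in>{1..Am}. real n ^ i * (exp 1 * real n / real (q i)) ^ q i * (2 * exp 1 * real (q i) * real k * p / (real \<kappa> * D1)) ^ (i * \<kappa>))
     + (exp 1 * real n / real s0) ^ (2 * s0) * exp (- (real s0)\<^sup>2 * p * real k / (2 * D2))"
    (is "subset_mean p _ ?fail \<le> ?b0 + ?b1 + ?b2 + ?b3 + ?b4 + ?b5")
proof -
  let ?E = "all_edges n" and ?V = "{1..n}"
  let ?good = "regular_graph n D1 D2"
  let ?P = "\<lambda>G X. measure_pmf.prob (srw G L v0) {ys. X ys}"
  let ?A = "\<lambda>h. \<forall>y. count_list h y \<le> M"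
  define X1 where "X1 w ys = hits ?A (\<lambda>h. length h \<le> Suc L \<and> count_list h w = Suc M \<and> (\<forall>y. count_list h y \<le> Suc M)) [] ys" for w and ys :: "nat list"
  define X2 where "X2 w ys = hits ?A (\<lambda>h. length h = Suc L \<and> count_list h w \<le> k) [] ys" for w and ys :: "nat list"
  define X3 where "X3 u ys = (k \<le> length (exits_from u ys) \<and> card (set (take k (exits_from u ys))) < 2 * \<kappa>)" for u ys
  define X4 where "X4 i ys = ((\<forall>u\<in>{1..n}. k \<le> length (exits_from u ys)) \<and> (\<exists>A D F. A \<subseteq> {1..n} \<and> card A = i \<and> D \<subseteq> {1..n} \<and> card D = q i \<and>
          F \<subseteq> touching A D \<and> card F = i * \<kappa> \<and> F \<subseteq> first_exits n k ys))" for i ys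
  define X5 where "X5 ys = ((\<forall>u\<in>{1..n}. k \<le> length (exits_from u ys)) \<and> (\<exists>A B. A \<subseteq> {1..n} \<and> card A = s0 \<and> B \<subseteq> {1..n} \<and> card B = s0 \<and>
          A \<inter> B = {} \<and> \<not> (\<exists>a\<in>A. \<exists>b\<in>B. {a, b} \<in># walk_edges ys)))" for ys
  have deg: "D1 + 1 \<le> real (card (neighbours G u))" "real (card (neighbours G u)) \<le> D2" "neighbours G u \<noteq> {}"
    if "?good G" "u \<in> ?V" for G u
    using that D1 unfolding regular_graph_def by fastforce+
  have vis: "visits n p w D1 r M" if "w \<in> ?V" for w
    using that p D1 r by unfold_locales auto
  have vgood: "visits.regular_off n w D1 D2 G \<and> D1 \<le> real (card (neighbours G w)) \<and> (\<forall>v\<in>{1..n}. neighbours G v \<noteq> {})"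
    if w: "w \<in> ?V" and G: "G \<subseteq> ?E" "?good G" for w G
  proof -
    have "D1 \<le> real (card (neighbours G v - {w})) \<and> real (card (neighbours G v - {w})) \<le> D2" if "v \<in> ?V" for v
    proof -
      have "card (neighbours G v) \<le> card (neighbours G v - {w}) + 1"
        using finite_neighbours[OF G(1)] by (cases "w \<in> neighbours G v") auto
      moreover have "card (neighbours G v - {w}) \<le> card (neighbours G v)"
        using finite_neighbours[OF G(1)] by (intro card_mono) auto
      ultimately show ?thesis using deg[OF G(2) that] by linarith
    qed
    then show ?thesis
      unfolding visits.regular_off_def[OF vis[OF w]] using deg(3)[OF G(2)] deg(1)[OF G(2) w] by auto
  qed
  \<comment> \<open>The order matters: absence of \<open>X1\<close> gives the cap, the cap lets
    absence of \<open>X2\<close> force \<open>k\<close> exits from every vertex, and the remaining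
    events are read off from these exits.\<close>
  have incl: "(\<exists>w\<in>?V. X1 w ys) \<or> (\<exists>w\<in>?V. X2 w ys) \<or> (\<exists>u\<in>?V. X3 u ys) \<or> (\<exists>i\<in>{1..Am}. X4 i ys) \<or> X5 ys"
    if G: "G \<subseteq> ?E" "?good G" and ys: "ys \<in> set_pmf (srw G L v0)"
      and bad: "\<not> (E1 \<beta> n (walk_edges ys) \<and> E2 n (walk_edges ys))" for G ys
  proof (rule ccontr)
    assume neg: "\<not> ?thesis"
    have N: "neighbours G u \<subseteq> ?V - {u}" "finite (neighbours G u)" for u
      using neighbours_subset[OF G(1)] finite_neighbours[OF G(1)] by auto
    have len: "length ys = Suc L" "set ys \<subseteq> ?V"
      using set_srw[OF _ _ _ v0 ys] N(1) deg(3)[OF G(2)] by blast+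
    have cap: "\<forall>y. count_list (rev ys @ []) y \<le> M"
    proof (rule ccontr)
      assume "\<not> ?thesis"
      then have "\<exists>w\<in>set ys. X1 w ys" unfolding X1_def by (intro hits_many) (auto simp: len)
      then show False using neg len by blast
    qed
    have exits: "k \<le> length (exits_from u ys)" if "u \<in> ?V" for u
    proof (rule ccontr)
      assume "\<not> ?thesis"
      then have "count_list ys u \<le> k" using length_exits_from[of ys u] by linarith
      then have "X2 u ys" unfolding X2_def using cap by (intro hits_few) (use len in auto)
      then show False using neg that by blast
    qed
    have dist: "2 * \<kappa> \<le> card (set (take k (exits_from u ys)))" if "u \<in> ?V" for u
      using neg that exits[OF that] unfolding X3_def by (meson not_le)
    have nb: "set (exits_from u ys) \<subseteq> ?V - {u}" for u using exits_from_srw[OF N(2) ys] N(1) by blast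
    have "E1 \<beta> n (walk_edges ys)"
      unfolding E1_def
    proof (intro allI impI, rule ccontr)
      fix A assume A: "A \<subseteq> {1..n}" "real (card A) \<le> real n / ln (real n)"
        and c: "\<not> real (card A) * (\<beta> * ln (real n)) \<le> real (card (nbhd n (walk_edges ys) A))"
      let ?i = "card A"
      have "?i \<noteq> 0" using c by (metis mult_zero_left of_nat_0 of_nat_0_le_iff)
      moreover have "?i \<le> Am" using A(2) unfolding Am_def by (simp add: le_nat_floor)
      ultimately have i: "?i \<in> {1..Am}" by auto
      have "real (?i + card (nbhd n (walk_edges ys) A)) \<le> real (q ?i)" using q[OF i] c by linarith
      then have "?i + card (nbhd n (walk_edges ys) A) \<le> q ?i" by (simp only: of_nat_le_iff)
      from dense_set[OF A(1) this conjunct2[OF q[OF i]] exits nb dist]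
      have "X4 ?i ys" unfolding X4_def using exits A(1) by blast
      then show False using neg i by blast
    qed
    moreover have "E2 n (walk_edges ys)"
      unfolding E2_def
    proof (intro allI impI, rule ccontr)
      fix A B
      let ?x = "real n * ln (ln (real n)) powr 1.5 / ln (real n)"
      assume AB: "A \<subseteq> {1..n} \<and> B \<subseteq> {1..n} \<and> A \<inter> B = {} \<and> ?x \<le> real (card A) \<and> ?x \<le> real (card B)"
        and c: "\<not> (\<exists>a\<in>A. \<exists>b\<in>B. {a, b} \<in># walk_edges ys)"
      have "s0 \<le> card A" "s0 \<le> card B" using AB unfolding s0_def by (auto simp: nat_le_iff ceiling_le_iff)
      obtain A' where A': "A' \<subseteq> A" "card A' = s0"
        using obtain_subset_with_card_n[OF \<open>s0 \<le> card A\<close>] by blast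
      obtain B' where B': "B' \<subseteq> B" "card B' = s0"
        using obtain_subset_with_card_n[OF \<open>s0 \<le> card B\<close>] by blast
      have "A' \<subseteq> {1..n}" "B' \<subseteq> {1..n}" "A' \<inter> B' = {}" using A' B' AB by blast+
      moreover have "\<not> (\<exists>a\<in>A'. \<exists>b\<in>B'. {a, b} \<in># walk_edges ys)" using c A'(1) B'(1) by blast
      ultimately have "X5 ys" unfolding X5_def using exits A'(2) B'(2) by blast
      then show False using neg by blast
    qed
    ultimately show False using bad by blast
  qed
  have pw: "?fail G \<le> of_bool (\<not> ?good G) + (\<Sum>w\<in>?V. of_bool (?good G) * ?P G (X1 w))
      + (\<Sum>w\<in>?V. of_bool (?good G) * ?P G (X2 w)) + (\<Sum>w\<in>?V. of_bool (?good G) * ?P G (X3 w))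
      + (\<Sum>i\<in>{1..Am}. of_bool (?good G) * ?P G (X4 i)) + of_bool (?good G) * ?P G X5"
    if G: "G \<subseteq> ?E" for G
  proof (cases "?good G")
    case False
    then show ?thesis by simp
  next
    case True
    \<comment> \<open>Tags 0 to 4 merge the five families of events into one index set, so that a
      single union bound covers them.\<close>
    define J where "J = (\<lambda>w. (0::nat, w)) ` ?V \<union> (\<lambda>w. (1, w)) ` ?V \<union> (\<lambda>w. (2, w)) ` ?V \<union> (\<lambda>w. (3, w)) ` {1..Am} \<union> {(4, 0::nat)}"
    define Z where "Z t ys = (if fst t = 0 then X1 (snd t) ys else if fst t = 1 then X2 (snd t) ys
        else if fst t = 2 then X3 (snd t) ys else if fst t = 3 then X4 (snd t) ys else X5 ys)" for t :: "nat \<times> nat" and ys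
    have "?fail G \<le> (\<Sum>t\<in>J. ?P G (Z t))"
    proof (rule prob_UN_pmf_le)
      show "finite J" by (simp add: J_def)
      fix ys assume "ys \<in> set_pmf (srw G L v0)" "\<not> (E1 \<beta> n (walk_edges ys) \<and> E2 n (walk_edges ys))"
      from incl[OF G True this] show "\<exists>t\<in>J. Z t ys"
        unfolding J_def Z_def bex_Un by auto
    qed
    also have "\<dots> = (\<Sum>w\<in>?V. ?P G (X1 w)) + (\<Sum>w\<in>?V. ?P G (X2 w)) + (\<Sum>w\<in>?V. ?P G (X3 w))
      + (\<Sum>i\<in>{1..Am}. ?P G (X4 i)) + ?P G X5"
    proof -
      have inj: "inj_on (\<lambda>w. (c, w)) B" for c :: nat and B :: "nat set" by (simp add: inj_on_def)
      have Z: "Z (0, w) = X1 w" "Z (Suc 0, w) = X2 w" "Z (2, w) = X3 w" "Z (3, w) = X4 w" "Z (4, w) = X5" for w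
        by (simp_all add: Z_def fun_eq_iff)
      show ?thesis unfolding J_def
        by (subst sum.union_disjoint, simp, simp, force)+
          (simp add: sum.reindex[OF inj] Z)
    qed
    finally show ?thesis using True by simp
  qed
  have "subset_mean p ?E ?fail \<le> subset_mean p ?E (\<lambda>G. of_bool (\<not> ?good G) + (\<Sum>w\<in>?V. of_bool (?good G) * ?P G (X1 w))
      + (\<Sum>w\<in>?V. of_bool (?good G) * ?P G (X2 w)) + (\<Sum>w\<in>?V. of_bool (?good G) * ?P G (X3 w))
      + (\<Sum>i\<in>{1..Am}. of_bool (?good G) * ?P G (X4 i)) + of_bool (?good G) * ?P G X5)"
    using p by (intro subset_mean_mono pw) auto
  also have "\<dots> = ?b0 + (\<Sum>w\<in>?V. subset_mean p ?E (\<lambda>G. of_bool (?good G) * ?P G (X1 w)))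
      + (\<Sum>w\<in>?V. subset_mean p ?E (\<lambda>G. of_bool (?good G) * ?P G (X2 w)))
      + (\<Sum>w\<in>?V. subset_mean p ?E (\<lambda>G. of_bool (?good G) * ?P G (X3 w)))
      + (\<Sum>i\<in>{1..Am}. subset_mean p ?E (\<lambda>G. of_bool (?good G) * ?P G (X4 i))) + subset_mean p ?E (\<lambda>G. of_bool (?good G) * ?P G X5)"
    unfolding subset_mean_add subset_mean_sum ..
  also have "\<dots> \<le> ?b0 + (\<Sum>w\<in>?V. exp (2 + 8 * p * real (Suc L) / D1 + 16 * (real M + 1)\<^sup>2 / D1 - (real M + 1)))
      + (\<Sum>w\<in>?V. exp ((s + 1) * real k - a * real L))
      + (\<Sum>w\<in>?V. (exp 1 * (2 * real \<kappa>) / D1) ^ (2 * \<kappa>)) + ?b4 + ?b5"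
  proof (intro add_mono sum_mono order_refl)
    fix w assume w: "w \<in> ?V"
    show "subset_mean p ?E (\<lambda>G. of_bool (?good G) * ?P G (X1 w))
        \<le> exp (2 + 8 * p * real (Suc L) / D1 + 16 * (real M + 1)\<^sup>2 / D1 - (real M + 1))"
      unfolding X1_def by (rule visits.many_visits[OF vis[OF w] vgood[OF w] v0 np])
    show "subset_mean p ?E (\<lambda>G. of_bool (?good G) * ?P G (X2 w)) \<le> exp ((s + 1) * real k - a * real L)"
      unfolding X2_def using D2
      by (intro visits.few_visits[OF vis[OF w] vgood[OF w] v0 np s _ a]) auto
    have "subset_mean p ?E (\<lambda>G. of_bool (?good G) * ?P G (X3 w)) \<le> subset_mean p ?E (\<lambda>G. (exp 1 * (2 * real \<kappa>) / D1) ^ (2 * \<kappa>))"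
    proof (rule subset_mean_mono)
      fix G assume G: "G \<subseteq> ?E"
      show "of_bool (?good G) * ?P G (X3 w) \<le> (exp 1 * (2 * real \<kappa>) / D1) ^ (2 * \<kappa>)"
      proof (cases "?good G")
        case True
        note d = deg[OF True w]
        have "2 * \<kappa> \<le> card (neighbours G w)" using d(1) \<kappa>(2) by linarith
        then have "?P G (X3 w) \<le> (exp 1 * real (2 * \<kappa>) / real (card (neighbours G w))) ^ (2 * \<kappa>)"
          unfolding X3_def using \<kappa>(1) by (intro few_distinct_exits[OF G deg(3)[OF True] v0 w]) (auto simp: k_def)
        also have "\<dots> \<le> (exp 1 * (2 * real \<kappa>) / D1) ^ (2 * \<kappa>)"
          using d D1 by (intro power_mono) (auto intro!: frac_le)
        finally show ?thesis using True by simp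
      qed (use D1 in simp)
    qed (use p in auto)
    then show "subset_mean p ?E (\<lambda>G. of_bool (?good G) * ?P G (X3 w)) \<le> (exp 1 * (2 * real \<kappa>) / D1) ^ (2 * \<kappa>)"
      by (simp add: subset_mean_const finite_all_edges)
  next
    fix i assume i: "i \<in> {1..Am}"
    have "real i \<le> real (q i)"
      using q[OF i] mult_nonneg_nonneg[OF of_nat_0_le_iff \<beta>, of i] by linarith
    moreover have "D1 \<le> real (card (neighbours G u))" if "?good G" "u \<in> ?V" for G u
      using deg(1)[OF that] by simp
    ultimately show "subset_mean p ?E (\<lambda>G. of_bool (?good G) * ?P G (X4 i)) \<le> real n ^ i * (exp 1 * real n / real (q i)) ^ q i
        * (2 * exp 1 * real (q i) * real k * p / (real \<kappa> * D1)) ^ (i * \<kappa>)"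
      unfolding X4_def using p D1 v0 \<kappa> i q[OF i] by (intro dense_sets_bound) auto
  next
    have "0 < card (neighbours G u) \<and> real (card (neighbours G u)) \<le> D2" if "?good G" "u \<in> ?V" for G u
      using deg(1,2)[OF that] D1 by linarith
    then show "subset_mean p ?E (\<lambda>G. of_bool (?good G) * ?P G X5) \<le> ?b5"
      unfolding X5_def using p v0 s0 \<kappa> D2 by (intro no_edges_bound) (auto simp: k_def)
  qed
  also have "\<dots> = ?b0 + ?b1 + ?b2 + ?b3 + ?b4 + ?b5" by simp
  finally show ?thesis .
qed

text \<open>Chernoff bounds with parameter \<open>\<delta> / 2\<close>, the minimiser of
  \<open>s\<^sup>2 - s * \<delta>\<close>, in both directions. The 2 in the first exponent absorbs
  the replacement of \<open>n\<close> by \<open>n - 1\<close> trials and the margin 1 in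
  \<open>regular_graph\<close>.\<close>

lemma irregular_bound:
  assumes p: "0 \<le> p" "p \<le> 1" and d: "0 \<le> \<delta>" "\<delta> \<le> 1"
  shows "subset_mean p (all_edges n) (\<lambda>G. of_bool (\<not> regular_graph n ((1 - \<delta>) * (real n * p)) ((1 + \<delta>) * (real n * p)) G))
    \<le> real n * (exp (2 - \<delta>\<^sup>2 * (real n * p) / 4) + exp (- (\<delta>\<^sup>2 * (real n * p) / 4)))"
proof -
  let ?E = "all_edges n" and ?x = "real n * p"
  let ?D1 = "(1 - \<delta>) * ?x" and ?D2 = "(1 + \<delta>) * ?x"
  let ?d = "\<lambda>G u. real (card (neighbours G u))"
  have x: "0 \<le> ?x" using p by simp
  have n1: "real (n - 1) * p \<le> ?x" "?x - 1 \<le> real (n - 1) * p"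
  proof -
    show "real (n - 1) * p \<le> ?x" using p by (intro mult_right_mono) auto
    have "?x \<le> (real (n - 1) + 1) * p" using p by (intro mult_right_mono) auto
    then show "?x - 1 \<le> real (n - 1) * p" using p by (simp add: algebra_simps)
  qed
  have up: "subset_mean p ?E (\<lambda>G. of_bool (\<delta> / 2 * ?D2 \<le> \<delta> / 2 * ?d G u)) \<le> exp (- (\<delta>\<^sup>2 * ?x / 4))" if u: "u \<in> {1..n}" for u
  proof -
    have "exp (\<delta> / 2) \<le> 1 + \<delta> / 2 + (\<delta> / 2)\<^sup>2" using d by (intro exp_bound) auto
    then have "real (n - 1) * p * (exp (\<delta> / 2) - 1) \<le> ?x * (\<delta> / 2 + (\<delta> / 2)\<^sup>2)"
      using n1 x d p by (intro mult_mono) auto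
    then have "real (n - 1) * p * (exp (\<delta> / 2) - 1) - \<delta> / 2 * ?D2 \<le> - (\<delta>\<^sup>2 * ?x / 4)"
      by (simp add: power2_eq_square algebra_simps)
    then show ?thesis using degree_tail[OF p u, of "\<delta> / 2 * ?D2" "\<delta> / 2"] by (meson exp_le_cancel_iff order.trans)
  qed
  have low: "subset_mean p ?E (\<lambda>G. of_bool (- (\<delta> / 2) * (?D1 + 1) \<le> - (\<delta> / 2) * ?d G u)) \<le> exp (2 - \<delta>\<^sup>2 * ?x / 4)"
    if u: "u \<in> {1..n}" for u
  proof -
    have "exp (- (\<delta> / 2)) - 1 \<le> - (\<delta> / 2) + (\<delta> / 2)\<^sup>2"
    proof -
      have "exp (- (\<delta> / 2)) * (1 + \<delta> / 2) \<le> exp (- (\<delta> / 2)) * exp (\<delta> / 2)"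
        by (intro mult_left_mono exp_ge_add_one_self) auto
      then have "exp (- (\<delta> / 2)) \<le> 1 / (1 + \<delta> / 2)" using d by (simp add: exp_minus field_simps)
      also have "\<dots> \<le> 1 - \<delta> / 2 + (\<delta> / 2)\<^sup>2"
      proof -
        have "1 \<le> (1 - \<delta> / 2 + (\<delta> / 2)\<^sup>2) * (1 + \<delta> / 2)"
          using d by (simp add: power2_eq_square algebra_simps)
        then show ?thesis using d by (simp add: divide_le_eq)
      qed
      finally show ?thesis by simp
    qed
    moreover have "- (\<delta> / 2) + (\<delta> / 2)\<^sup>2 \<le> 0"
      using d mult_left_mono[of \<delta> 1 \<delta>] by (simp add: power2_eq_square)
    ultimately have "real (n - 1) * p * (exp (- (\<delta> / 2)) - 1) \<le> real (n - 1) * p * (- (\<delta> / 2) + (\<delta> / 2)\<^sup>2)"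
      using p by (intro mult_left_mono) auto
    also have "\<dots> \<le> (?x - 1) * (- (\<delta> / 2) + (\<delta> / 2)\<^sup>2)"
      using n1(2) \<open>- (\<delta> / 2) + (\<delta> / 2)\<^sup>2 \<le> 0\<close> by (intro mult_right_mono_neg)
    finally have 1: "real (n - 1) * p * (exp (- (\<delta> / 2)) - 1) - - (\<delta> / 2) * (?D1 + 1)
       \<le> (?x - 1) * (- (\<delta> / 2) + (\<delta> / 2)\<^sup>2) + \<delta> / 2 * (?D1 + 1)" by linarith
    also have "\<dots> = - (\<delta>\<^sup>2 * ?x / 4) + \<delta> - \<delta>\<^sup>2 / 4"
      by (simp add: power2_eq_square field_simps)
    also have "\<dots> \<le> 2 - \<delta>\<^sup>2 * ?x / 4" using d zero_le_power2[of \<delta>] by linarith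
    finally show ?thesis using degree_tail[OF p u, of "- (\<delta> / 2) * (?D1 + 1)" "- (\<delta> / 2)"] by (meson exp_le_cancel_iff order.trans)
  qed
  have "subset_mean p ?E (\<lambda>G. of_bool (\<not> regular_graph n ?D1 ?D2 G))
    \<le> subset_mean p ?E (\<lambda>G. \<Sum>u\<in>{1..n}. of_bool (- (\<delta> / 2) * (?D1 + 1) \<le> - (\<delta> / 2) * ?d G u) + of_bool (\<delta> / 2 * ?D2 \<le> \<delta> / 2 * ?d G u))"
  proof (rule subset_mean_mono[OF p])
    fix G
    let ?f = "\<lambda>u. of_bool (- (\<delta> / 2) * (?D1 + 1) \<le> - (\<delta> / 2) * ?d G u) + of_bool (\<delta> / 2 * ?D2 \<le> \<delta> / 2 * ?d G u) :: real"
    show "of_bool (\<not> regular_graph n ?D1 ?D2 G) \<le> (\<Sum>u\<in>{1..n}. ?f u)"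
    proof (cases "regular_graph n ?D1 ?D2 G")
      case False
      then obtain u where u: "u \<in> {1..n}" "?d G u \<le> ?D1 + 1 \<or> ?D2 \<le> ?d G u"
        unfolding regular_graph_def by fastforce
      have "0 \<le> \<delta> / 2" "- (\<delta> / 2) \<le> 0" using d by auto
      then have "- (\<delta> / 2) * (?D1 + 1) \<le> - (\<delta> / 2) * ?d G u \<or> \<delta> / 2 * ?D2 \<le> \<delta> / 2 * ?d G u"
        using u(2) mult_left_mono[of ?D2 "?d G u" "\<delta> / 2"] mult_left_mono_neg[of "?d G u" "?D1 + 1" "- (\<delta> / 2)"] by blast
      then have "1 \<le> ?f u" by auto
      also have "?f u \<le> (\<Sum>u\<in>{1..n}. ?f u)" using u by (intro member_le_sum) auto
      finally show ?thesis using False by simp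
    qed (auto intro!: sum_nonneg)
  qed
  also have "\<dots> \<le> (\<Sum>u\<in>{1..n}. exp (2 - \<delta>\<^sup>2 * ?x / 4) + exp (- (\<delta>\<^sup>2 * ?x / 4)))"
    unfolding subset_mean_sum subset_mean_add by (intro sum_mono add_mono up low)
  finally show ?thesis by simp
qed

section \<open>Numerical estimates for large n\<close>

text \<open>
  \<open>\<delta>\<close> is the relative error in degrees and hitting probabilities, \<open>K ln n\<close> the cap on the number of
  visits, and \<open>4 * \<rho> * ln n\<close> the number of exits guaranteed for every vertex. The value \<open>e\<^sup>-\<^sup>s = \<delta>\<close>
  is the discount per visit in the lower tail. The three summands of \<open>C\<close> serve the cap on the
  visits, the concentration of the degrees, and the distinctness of the exits.
\<close>

locale large_n =
  fixes n :: nat and p \<epsilon> \<delta> K s \<rho> C \<beta> l x :: real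
  assumes eps: "0 < \<epsilon>" and delta: "0 < \<delta>" "\<delta> \<le> 1 / 16" "\<delta> * (1 + \<epsilon>) \<le> \<epsilon> / 16"
    and K: "K = 20 * (1 + \<epsilon>)" and s: "s = - ln \<delta>"
    and rho: "0 < \<rho>" "\<rho> \<le> 1" "4 * \<rho> * (s + 1) \<le> \<epsilon> / 8"
    and C: "C = 400 * K / \<delta> + 8 / \<delta>\<^sup>2 + 7 * exp (3 / \<rho>)"
    and beta: "\<beta> = exp (- 17 / \<rho>) / 2"
    and l: "l = ln (real n)" and x: "x = real n * p" and p: "p \<le> 1" and xC: "C * l \<le> x"
    and n: "4 \<le> n" "20 \<le> l" "2 \<le> \<rho> * l" "2 \<le> \<beta> * l" "l\<^sup>2 \<le> real n" "1 \<le> ln l"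
      "3 + 2 * ln l \<le> \<rho> / 2 * ln l powr 1.5"
begin

definition "D1 = (1 - \<delta>) * x"
definition "D2 = (1 + \<delta>) * x"
definition "M = nat \<lceil>K * l\<rceil>"
definition "\<kappa> = nat \<lfloor>\<rho> * l\<rfloor>"
definition "r = 1 - \<delta>"
definition "a = (1 - exp (- s)) * (r * p / (D2 + 1))"
definition "L = nat \<lfloor>(1 + \<epsilon>) * real n * l\<rfloor>"
text \<open>Twice the expansion aimed at: once \<open>\<beta> * l \<ge> 2\<close>, the surplus makes
  room for the set itself and for rounding down.\<close>

definition "q i = nat \<lfloor>2 * \<beta> * real i * l\<rfloor>"
definition "s0 = nat \<lceil>real n * ln l powr 1.5 / l\<rceil>"

lemma n_pos: "0 < real n" "4 \<le> real n" using n(1) by auto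

lemma n_exp: "real n = exp l" using n_pos by (simp add: l)

lemma K_ge: "20 \<le> K" using eps by (simp add: K)

lemma C_ge: "400 * K / \<delta> \<le> C" "8 / \<delta>\<^sup>2 \<le> C" "7 * exp (3 / \<rho>) \<le> C" "400 * K \<le> C"
proof -
  have a: "0 \<le> 400 * K / \<delta>" "0 \<le> 8 / \<delta>\<^sup>2" "0 \<le> 7 * exp (3 / \<rho>)" using K_ge delta by auto
  show 1: "400 * K / \<delta> \<le> C" "8 / \<delta>\<^sup>2 \<le> C" "7 * exp (3 / \<rho>) \<le> C" using a unfolding C by linarith+
  have "400 * K / 1 \<le> 400 * K / \<delta>" using K_ge delta by (intro divide_left_mono) auto
  then show "400 * K \<le> C" using 1 by simp
qed

lemma x_ge: "400 * K * l \<le> x" "400 * K / \<delta> * l \<le> x" "8 / \<delta>\<^sup>2 * l \<le> x" "7 * exp (3 / \<rho>) * l \<le> x"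
  using C_ge mult_right_mono[OF C_ge(1), of l] mult_right_mono[OF C_ge(2), of l] mult_right_mono[OF C_ge(3), of l]
    mult_right_mono[OF C_ge(4), of l] n xC by linarith+

lemma x_pos: "1 \<le> x" "1 \<le> \<delta> * x"
proof -
  have "1 * 1 \<le> K * l" using K_ge n by (intro mult_mono) auto
  then have Kl: "1 \<le> 400 * K * l" by simp
  then show "1 \<le> x" using x_ge by linarith
  have "400 * K * l \<le> \<delta> * x" using x_ge(2) delta by (simp add: field_simps)
  then show "1 \<le> \<delta> * x" using Kl by linarith
qed

lemma p_pos: "0 < p" using x_pos n_pos unfolding x by (metis less_le_trans zero_less_one zero_less_mult_pos)

lemma D1_ge: "15 / 16 * x \<le> D1" "0 < D1"
proof -
  have "15 / 16 * x \<le> (1 - \<delta>) * x" using delta x_pos by (intro mult_right_mono) auto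
  then show "15 / 16 * x \<le> D1" by (simp add: D1_def)
  then show "0 < D1" using x_pos by linarith
qed

lemma M_bounds: "K * l \<le> real M" "real M + 1 \<le> 2 * K * l"
proof -
  have Kl: "20 * 20 \<le> K * l" using K_ge n by (intro mult_mono) auto
  show "K * l \<le> real M" unfolding M_def by (rule real_nat_ceiling_ge)
  have "real M \<le> K * l + 1" using Kl unfolding M_def by linarith
  then show "real M + 1 \<le> 2 * K * l" using Kl by linarith
qed

lemma kappa_bounds: "\<rho> * l / 2 \<le> real \<kappa>" "real \<kappa> \<le> \<rho> * l" "real \<kappa> \<le> l" "0 < \<kappa>"
proof -
  show k: "real \<kappa> \<le> \<rho> * l" unfolding \<kappa>_def using n by (intro of_nat_floor) auto
  have "\<rho> * l - 1 \<le> real \<kappa>" unfolding \<kappa>_def using n by linarith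
  then show "\<rho> * l / 2 \<le> real \<kappa>" using n by linarith
  then show "0 < \<kappa>" using n by linarith
  have "\<rho> * l \<le> 1 * l" using rho n by (intro mult_right_mono) auto
  then show "real \<kappa> \<le> l" using k by linarith
qed

lemma r_ok: "0 < r" "r \<le> 1 - real M / D1"
proof -
  show "0 < r" using delta by (simp add: r_def)
  have "real M \<le> 2 * K * l" using M_bounds by linarith
  also have "\<dots> \<le> \<delta> * (15 / 16 * (400 * K / \<delta> * l))" using K_ge n delta by simp
  also have "\<dots> \<le> \<delta> * (15 / 16 * x)" using x_ge(2) delta by (intro mult_left_mono) auto
  also have "\<dots> \<le> \<delta> * D1" using D1_ge delta by (intro mult_left_mono) auto
  finally show "r \<le> 1 - real M / D1" using D1_ge by (simp add: r_def field_simps)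
qed

lemma np_ok: "real n * p + 2 * real M \<le> 2 * D1"
proof -
  have "2 * real M \<le> 4 * K * l" using M_bounds by linarith
  also have "\<dots> \<le> x / 100" using x_ge(1) by simp
  finally show ?thesis using D1_ge x_pos by (simp add: x)
qed

lemma s_ok: "0 \<le> s" "exp (- s) = \<delta>"
  using delta by (auto simp: s)

text \<open>Three losses enter \<open>a * n\<close>: \<open>1 - exp (- s) = 1 - \<delta>\<close>,
  \<open>r = 1 - \<delta>\<close>, and \<open>D2 + 1 \<le> (1 + 2 * \<delta>) * x\<close>, where
  \<open>\<delta> * x \<ge> 1\<close> absorbs the additive 1. Together they leave at least
  \<open>1 - 4 * \<delta>\<close>.\<close>

lemma a_ok: "a \<le> 1 / 4" "(1 - 4 * \<delta>) / real n \<le> a"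
proof -
  have D2: "x \<le> D2 + 1" "0 < D2 + 1" using delta x_pos by (auto simp: D2_def algebra_simps)
  have "a \<le> 1 * (1 * p / x)" unfolding a_def s_ok r_def using delta p_pos D2 x_pos
    by (intro mult_mono divide_left_mono frac_le mult_right_mono) auto
  also have "\<dots> = 1 / real n" using p_pos n_pos by (simp add: x)
  also have "\<dots> \<le> 1 / 4" using n_pos by (intro divide_left_mono) auto
  finally show "a \<le> 1 / 4" .
  have D2': "D2 + 1 \<le> (1 + 2 * \<delta>) * x" using x_pos by (simp add: D2_def algebra_simps)
  have "(1 - 4 * \<delta>) * (1 + 2 * \<delta>) \<le> (1 - \<delta>) * (1 - \<delta>)" using delta by (simp add: algebra_simps)
  then have "1 - 4 * \<delta> \<le> (1 - \<delta>) * (1 - \<delta>) / (1 + 2 * \<delta>)" using delta by (simp add: pos_le_divide_eq)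
  then have "(1 - 4 * \<delta>) / real n \<le> (1 - \<delta>) * (1 - \<delta>) / (1 + 2 * \<delta>) / real n"
    using n_pos by (intro divide_right_mono) auto
  also have "\<dots> = (1 - \<delta>) * ((1 - \<delta>) / (1 + 2 * \<delta>) * (p / x))"
    using p_pos n_pos by (simp add: x)
  also have "(1 - \<delta>) / (1 + 2 * \<delta>) * (p / x) = (1 - \<delta>) * p / ((1 + 2 * \<delta>) * x)"
    by (rule times_divide_times_eq)
  also have "(1 - \<delta>) * ((1 - \<delta>) * p / ((1 + 2 * \<delta>) * x)) \<le> a" unfolding a_def s_ok r_def using delta p_pos D2 D2' x_pos
    by (intro mult_left_mono divide_left_mono) auto
  finally show "(1 - 4 * \<delta>) / real n \<le> a" .
qed

lemma L_bounds: "real (Suc L) \<le> (1 + \<epsilon>) * real n * l + 1" "(1 + \<epsilon>) * real n * l - 1 \<le> real L"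
proof -
  have "0 \<le> (1 + \<epsilon>) * real n * l" using eps n by auto
  then show "real (Suc L) \<le> (1 + \<epsilon>) * real n * l + 1" "(1 + \<epsilon>) * real n * l - 1 \<le> real L"
    unfolding L_def by linarith+
qed

lemma irregular_small: "subset_mean p (all_edges n) (\<lambda>G. of_bool (\<not> regular_graph n D1 D2 G)) \<le> 10 / real n"
proof -
  \<comment> \<open>The summand \<open>8 / \<delta>\<^sup>2\<close> of \<open>C\<close> gives a
    decay by two powers of \<open>n\<close>, one of which the union over the vertices
    consumes.\<close>
  have e: "2 * l \<le> \<delta>\<^sup>2 * x / 4" using x_ge(3) delta by (simp add: field_simps)
  have "subset_mean p (all_edges n) (\<lambda>G. of_bool (\<not> regular_graph n D1 D2 G))
    \<le> real n * (exp (2 - \<delta>\<^sup>2 * x / 4) + exp (- (\<delta>\<^sup>2 * x / 4)))"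
    using irregular_bound[of p \<delta> n] p p_pos delta
    unfolding x[symmetric] D1_def[symmetric] D2_def[symmetric] by simp
  also have "\<dots> \<le> real n * (exp (2 - 2 * l) + exp (- (2 * l)))"
    using e by (intro mult_left_mono add_mono) auto
  also have "\<dots> = (exp 2 + 1) / real n" by (simp add: n_exp exp_diff exp_minus field_simps flip: exp_add)
  also have "\<dots> \<le> 10 / real n" using exp_two_le by (intro divide_right_mono) auto
  finally show ?thesis .
qed

text \<open>The time term stays below \<open>9 * (1 + \<epsilon>) * l\<close>, as
  \<open>8 * 16 / 15 < 9\<close>, and the term from revealed neighbours is at most a tenth of
  \<open>M + 1\<close>. The value \<open>K = 20 * (1 + \<epsilon>)\<close> outweighs both and leaves
  more than \<open>2 * l\<close>.\<close>

lemma many_visits_small: "real n * exp (2 + 8 * p * real (Suc L) / D1 + 16 * (real M + 1)\<^sup>2 / D1 - (real M + 1)) \<le> 9 / real n"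
proof -
  have "8 * p * real (Suc L) / D1 \<le> 8 * p * ((1 + \<epsilon>) * real n * l + 1) / (15 / 16 * x)"
    using L_bounds D1_ge p_pos x_pos by (intro frac_le mult_left_mono) auto
  also have "\<dots> = 128 / 15 * ((1 + \<epsilon>) * l) + 128 / 15 / real n"
    using p_pos n_pos by (simp add: x field_simps)
  also have "\<dots> \<le> 9 * ((1 + \<epsilon>) * l)"
  proof -
    have "128 / 15 / real n \<le> 128 / 15 / 4" using n_pos by (intro divide_left_mono) auto
    moreover have "1 * 20 \<le> (1 + \<epsilon>) * l" using eps n by (intro mult_mono) auto
    ultimately show ?thesis by simp
  qed
  finally have 1: "8 * p * real (Suc L) / D1 \<le> 9 * ((1 + \<epsilon>) * l)" .
  have "16 * (real M + 1)\<^sup>2 / D1 \<le> 16 * ((real M + 1) * (2 * K * l)) / (15 / 16 * (400 * K * l))"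
    unfolding power2_eq_square using M_bounds D1_ge x_ge(1) K_ge n
    by (intro frac_le mult_left_mono) auto
  also have "\<dots> = (real M + 1) * (512 / 6000)" using K_ge n by (simp add: field_simps)
  also have "\<dots> \<le> (real M + 1) * (1 / 10)" by (intro mult_left_mono) auto
  finally have 2: "16 * (real M + 1)\<^sup>2 / D1 \<le> (real M + 1) / 10" by simp
  have 3: "20 * ((1 + \<epsilon>) * l) \<le> real M"
  proof -
    have "20 * ((1 + \<epsilon>) * l) = K * l" by (simp add: K)
    then show ?thesis using M_bounds(1) by linarith
  qed
  have "l \<le> (1 + \<epsilon>) * l" using eps n by simp
  moreover have "2 + t + t' - m \<le> 2 - 2 * l" if "t \<le> 9 * u" "t' \<le> m / 10" "20 * u \<le> m - 1" "l \<le> u" for t t' m u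
    using that n(2) by linarith
  ultimately have "2 + 8 * p * real (Suc L) / D1 + 16 * (real M + 1)\<^sup>2 / D1 - (real M + 1) \<le> 2 - 2 * l"
    using 1 2 3 by simp
  then have "real n * exp (2 + 8 * p * real (Suc L) / D1 + 16 * (real M + 1)\<^sup>2 / D1 - (real M + 1)) \<le> real n * exp (2 - 2 * l)"
    by (intro mult_left_mono) auto
  also have "\<dots> = exp 2 / real n" by (simp add: n_exp exp_diff exp_minus field_simps flip: exp_add)
  also have "\<dots> \<le> 9 / real n" using exp_two_le by (intro divide_right_mono) auto
  finally show ?thesis .
qed

text \<open>This is where the walk must be longer than \<open>n ln n\<close>. Of the surplus
  \<open>\<epsilon> * l\<close> in the exponent, a quarter goes to the losses in \<open>a\<close>
  and an eighth to \<open>(s + 1) * 4 * \<kappa>\<close>; at least half survives the union over the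
  vertices.\<close>

lemma few_visits_small: "real n * exp ((s + 1) * real (4 * \<kappa>) - a * real L) \<le> 3 * exp (- (\<epsilon> / 2) * l)"
proof -
  have "(s + 1) * real (4 * \<kappa>) \<le> (s + 1) * (4 * (\<rho> * l))"
    using kappa_bounds s_ok by (intro mult_left_mono) auto
  also have "\<dots> = 4 * \<rho> * (s + 1) * l" by simp
  also have "\<dots> \<le> \<epsilon> / 8 * l" using rho n by (intro mult_right_mono) auto
  finally have 1: "(s + 1) * real (4 * \<kappa>) \<le> \<epsilon> / 8 * l" .
  have "(1 - 4 * \<delta>) / real n * ((1 + \<epsilon>) * real n * l - 1) \<le> a * real L"
  proof (intro mult_mono)
    have "1 * 1 * 1 \<le> (1 + \<epsilon>) * real n * l" using eps n n_pos by (intro mult_mono) auto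
    then show "0 \<le> (1 + \<epsilon>) * real n * l - 1" by simp
    have "0 \<le> (1 - 4 * \<delta>) / real n" using delta by auto
    then show "0 \<le> a" using a_ok by linarith
  qed (use a_ok L_bounds in auto)
  moreover have "(1 - 4 * \<delta>) / real n * ((1 + \<epsilon>) * real n * l - 1) = (1 - 4 * \<delta>) * ((1 + \<epsilon>) * l) - (1 - 4 * \<delta>) / real n"
    using n_pos by (simp add: field_simps)
  moreover have "(1 - 4 * \<delta>) / real n \<le> 1" using n_pos delta by simp
  moreover have "4 * (\<delta> * (1 + \<epsilon>)) * l \<le> 4 * (\<epsilon> / 16) * l" using delta n by (intro mult_right_mono) auto
  ultimately have 2: "(1 + \<epsilon>) * l - \<epsilon> / 4 * l - 1 \<le> a * real L" by (simp add: algebra_simps)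
  have "0 \<le> \<epsilon> / 8 * l" using eps n by auto
  then have "(s + 1) * real (4 * \<kappa>) - a * real L \<le> - (\<epsilon> / 2) * l - l + 1"
    using 1 2 by (simp add: algebra_simps)
  then have "real n * exp ((s + 1) * real (4 * \<kappa>) - a * real L) \<le> real n * exp (- (\<epsilon> / 2) * l - l + 1)"
    by (intro mult_left_mono) auto
  also have "\<dots> = exp 1 * exp (- (\<epsilon> / 2) * l)" by (simp add: n_exp flip: exp_add)
  also have "\<dots> \<le> 3 * exp (- (\<epsilon> / 2) * l)" using exp_le by (intro mult_right_mono) auto
  finally show ?thesis .
qed

text \<open>The base is at most \<open>exp (- (3 / \<rho>))\<close> by the last summand of
  \<open>C\<close>, and \<open>2 * \<kappa> \<ge> \<rho> * l\<close> turns this into a power of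
  \<open>n\<close>.\<close>

lemma few_distinct_small: "real n * (exp 1 * (2 * real \<kappa>) / D1) ^ (2 * \<kappa>) \<le> 1 / real n"
proof -
  have "exp 1 * (2 * real \<kappa>) / D1 \<le> 3 * (2 * l) / (15 / 16 * (7 * exp (3 / \<rho>) * l))"
    using kappa_bounds exp_le D1_ge x_ge(4) n by (intro frac_le mult_mono) auto
  also have "\<dots> = (96 / 105) * exp (- (3 / \<rho>))" using n by (simp add: exp_minus field_simps)
  also have "\<dots> \<le> 1 * exp (- (3 / \<rho>))" by (intro mult_right_mono) auto
  finally have "(exp 1 * (2 * real \<kappa>) / D1) ^ (2 * \<kappa>) \<le> exp (- (3 / \<rho>)) ^ (2 * \<kappa>)"
    using D1_ge by (intro power_mono) auto
  also have "\<dots> = exp (- (3 / \<rho>) * (2 * real \<kappa>))" by (simp add: mult.commute flip: exp_of_nat_mult)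
  also have "\<dots> \<le> exp (- (2 * l))"
  proof -
    have "3 / \<rho> * (\<rho> * l) \<le> 3 / \<rho> * (2 * real \<kappa>)" using kappa_bounds rho by (intro mult_left_mono) auto
    then have "3 * l \<le> 3 / \<rho> * (2 * real \<kappa>)" using rho by simp
    then show ?thesis using n by simp
  qed
  finally have "real n * (exp 1 * (2 * real \<kappa>) / D1) ^ (2 * \<kappa>) \<le> real n * exp (- (2 * l))"
    by (intro mult_left_mono) auto
  also have "\<dots> = 1 / real n" by (simp add: n_exp exp_minus field_simps flip: exp_add)
  finally show ?thesis .
qed

lemma beta_bounds: "0 < \<beta>" "2 * \<beta> \<le> \<rho> / 16" "2 * \<beta> \<le> 1"
proof -
  show "0 < \<beta>" by (simp add: beta)
  have "17 / \<rho> \<le> exp (17 / \<rho>)" using exp_ge_add_one_self[of "17 / \<rho>"] by linarith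
  then have "exp (- (17 / \<rho>)) * (17 / \<rho>) \<le> exp (- (17 / \<rho>)) * exp (17 / \<rho>)"
    by (intro mult_left_mono) auto
  then have "exp (- (17 / \<rho>)) * (17 / \<rho>) \<le> 1" by (simp flip: exp_add)
  then have "2 * \<beta> \<le> \<rho> / 17" using rho by (simp add: beta field_simps)
  then show "2 * \<beta> \<le> \<rho> / 16" "2 * \<beta> \<le> 1" using rho by linarith+
qed

lemma q_bounds:
  assumes "i \<in> {1..nat \<lfloor>real n / l\<rfloor>}"
  shows "real i + real i * (\<beta> * l) \<le> real (q i)" "q i \<le> n" "real (q i) \<le> 2 * \<beta> * real i * l" "real (q i) \<le> 2 * \<beta> * real n"
proof -
  have i: "1 \<le> real i" "real i * l \<le> real n"
  proof -
    show "1 \<le> real i" using assms by auto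
    have "real i \<le> real n / l" using assms n by (auto simp: le_nat_iff le_floor_iff)
    then show "real i * l \<le> real n" using n by (simp add: field_simps)
  qed
  have pos: "0 \<le> 2 * \<beta> * real i * l" using beta_bounds n by auto
  show q1: "real (q i) \<le> 2 * \<beta> * real i * l" unfolding q_def using pos by (intro of_nat_floor)
  have "2 * \<beta> * (real i * l) \<le> 2 * \<beta> * real n" using beta_bounds i by (intro mult_left_mono) auto
  then show q2: "real (q i) \<le> 2 * \<beta> * real n" using q1 by (simp add: mult.assoc)
  have "2 * \<beta> * real n \<le> 1 * real n" using beta_bounds by (intro mult_right_mono) auto
  then have "real (q i) \<le> real n" using q2 by linarith
  then show "q i \<le> n" by simp
  have "real i * 2 \<le> real i * (\<beta> * l)" using n by (intro mult_left_mono) auto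
  moreover have "2 * \<beta> * real i * l - 1 \<le> real (q i)" unfolding q_def using pos by linarith
  moreover have "2 * \<beta> * real i * l = 2 * (real i * (\<beta> * l))" by simp
  ultimately show "real i + real i * (\<beta> * l) \<le> real (q i)" using i by linarith
qed

text \<open>With \<open>y = ln (n / q)\<close>, choosing \<open>D\<close> costs
  \<open>q * (1 + y)\<close> with \<open>q\<close> at most \<open>\<rho> * i * l / 16\<close>, while
  the edges gain \<open>i * \<kappa> * (y - 4)\<close> with
  \<open>\<kappa> \<ge> \<rho> * l / 2\<close>. So large \<open>y\<close> wins, and
  \<open>\<beta>\<close> is chosen to force \<open>\<rho> * y \<ge> 17\<close>.\<close>

lemma dense_sets_term:
  assumes i: "i \<in> {1..nat \<lfloor>real n / l\<rfloor>}"
  shows "real n ^ i * (exp 1 * real n / real (q i)) ^ q i * (2 * exp 1 * real (q i) * real (4 * \<kappa>) * p / (real \<kappa> * D1)) ^ (i * \<kappa>)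
     \<le> exp (- (2 * l))"
proof -
  note q = q_bounds[OF i]
  have i1: "1 \<le> real i" using i by auto
  have "0 \<le> real i * (\<beta> * l)" using beta_bounds n by auto
  then have q0: "0 < real (q i)" using q(1) i1 by linarith
  define y where "y = ln (real n / real (q i))"
  have ny: "real n / real (q i) = exp y" using q0 n_pos by (simp add: y_def)
  have "exp (17 / \<rho>) \<le> exp y"
  proof -
    have "exp (17 / \<rho>) * real (q i) \<le> exp (17 / \<rho>) * (2 * \<beta> * real n)" using q(4) by (intro mult_left_mono) auto
    also have "\<dots> = real n" by (simp add: beta flip: exp_add)
    finally show ?thesis using q0 unfolding ny[symmetric] by (simp add: pos_le_divide_eq)
  qed
  then have y: "17 / \<rho> \<le> y" by simp
  have "17 \<le> 17 / \<rho>" using rho by (simp add: pos_le_divide_eq)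
  then have y4: "17 \<le> y" using y by linarith
  have yr: "17 \<le> \<rho> * y" using y rho by (simp add: field_simps)
  have A: "(exp 1 * real n / real (q i)) ^ q i = exp (real (q i) * (1 + y))"
  proof -
    have "exp 1 * real n / real (q i) = exp (1 + y)"
      by (simp only: times_divide_eq_right[symmetric] ny exp_add)
    then show ?thesis by (simp add: exp_of_nat_mult)
  qed
  have "2 * exp 1 * real (q i) * real (4 * \<kappa>) * p / (real \<kappa> * D1) = 8 * exp 1 * real (q i) * p / D1"
    using kappa_bounds(4) by (simp add: field_simps)
  also have "\<dots> \<le> 8 * 3 * real (q i) * p / (15 / 16 * x)"
    using exp_le D1_ge x_pos p_pos by (intro frac_le mult_mono) auto
  \<comment> \<open>\<open>384 / 15\<close> is \<open>8 * 3 * 16 / 15\<close>: the 8 is twice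
    \<open>k / \<kappa>\<close>, the 3 bounds \<open>e\<close>, and \<open>16 / 15\<close> comes
    from \<open>D1\<close>.\<close>
  also have "\<dots> = 384 / 15 * (real (q i) / real n)" using p_pos n_pos by (simp add: x field_simps)
  also have "real (q i) / real n = exp (- y)"
    using ny q0 n_pos by (simp add: exp_minus ny[symmetric])
  also have "384 / 15 * exp (- y) \<le> exp 4 * exp (- y)"
  proof (rule mult_right_mono)
    have "(5/2::real) \<le> exp 1" using exp_lower_Taylor_quadratic[of "1::real"] by simp
    then have "(5/2::real) ^ 4 \<le> exp 1 ^ 4" by (intro power_mono) auto
    also have "\<dots> = exp (4::real)" by (simp flip: exp_of_nat_mult)
    finally show "384 / 15 \<le> exp (4::real)" by (simp add: power_divide)
  qed simp
  also have "\<dots> = exp (4 - y)" by (simp flip: exp_add)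
  finally have "2 * exp 1 * real (q i) * real (4 * \<kappa>) * p / (real \<kappa> * D1) \<le> exp (4 - y)" .
  then have B: "(2 * exp 1 * real (q i) * real (4 * \<kappa>) * p / (real \<kappa> * D1)) ^ (i * \<kappa>) \<le> exp (4 - y) ^ (i * \<kappa>)"
    using p_pos D1_ge by (intro power_mono) auto
  have B': "exp (4 - y) ^ (i * \<kappa>) = exp (real i * real \<kappa> * (4 - y))" by (simp flip: exp_of_nat_mult)
  have Nn: "real n ^ i = exp (real i * l)" by (simp add: n_exp flip: exp_of_nat_mult)
  have "real (q i) * (1 + y) \<le> (\<rho> / 16 * (real i * l)) * (1 + y)"
  proof (rule mult_right_mono)
    have "2 * \<beta> * (real i * l) \<le> \<rho> / 16 * (real i * l)" using beta_bounds i1 n by (intro mult_right_mono) auto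
    then show "real (q i) \<le> \<rho> / 16 * (real i * l)" using q(3) by (simp add: mult.assoc)
  qed (use y4 in simp)
  moreover have "real i * real \<kappa> * (4 - y) \<le> real i * (\<rho> * l / 2) * (4 - y)"
    using kappa_bounds(1) y4 i1 by (intro mult_right_mono_neg mult_left_mono) auto
  \<comment> \<open>\<open>2 * \<rho>\<close> is the 4 in \<open>4 - y\<close> times
    \<open>\<rho> / 2\<close>, and \<open>7 / 16\<close> is \<open>1 / 2 - 1 / 16\<close>.\<close>
  ultimately have "real i * l + real (q i) * (1 + y) + real i * real \<kappa> * (4 - y)
     \<le> real i * l * (1 + \<rho> / 16 + 2 * \<rho> - 7 / 16 * (\<rho> * y))"
    by (simp add: algebra_simps)
  also have "\<dots> \<le> real i * l * (- 2)"
    using rho yr i1 n by (intro mult_left_mono) auto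
  also have "\<dots> \<le> 1 * l * (- 2)" using i1 n by simp
  finally have e: "real i * l + real (q i) * (1 + y) + real i * real \<kappa> * (4 - y) \<le> - (2 * l)" by simp
  have "real n ^ i * (exp 1 * real n / real (q i)) ^ q i * (2 * exp 1 * real (q i) * real (4 * \<kappa>) * p / (real \<kappa> * D1)) ^ (i * \<kappa>)
    \<le> real n ^ i * (exp 1 * real n / real (q i)) ^ q i * exp (4 - y) ^ (i * \<kappa>)"
    by (intro mult_left_mono B) auto
  also have "\<dots> = exp (real i * l + real (q i) * (1 + y) + real i * real \<kappa> * (4 - y))"
    unfolding A B' Nn by (simp flip: exp_add)
  also have "\<dots> \<le> exp (- (2 * l))" using e by simp
  finally show ?thesis .
qed

lemma dense_sets_small: "(\<Sum>i\<in>{1..nat \<lfloor>real n / l\<rfloor>}. real n ^ i * (exp 1 * real n / real (q i)) ^ q i *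
    (2 * exp 1 * real (q i) * real (4 * \<kappa>) * p / (real \<kappa> * D1)) ^ (i * \<kappa>)) \<le> 1 / real n" (is "?s \<le> _")
proof -
  have "?s \<le> (\<Sum>i\<in>{1..nat \<lfloor>real n / l\<rfloor>}. exp (- (2 * l)))" by (rule sum_mono[OF dense_sets_term])
  also have "\<dots> = real (nat \<lfloor>real n / l\<rfloor>) * exp (- (2 * l))" by simp
  also have "\<dots> \<le> real n * exp (- (2 * l))"
  proof (rule mult_right_mono)
    have "real (nat \<lfloor>real n / l\<rfloor>) \<le> real n / l" using n by (intro of_nat_floor) auto
    also have "\<dots> \<le> real n / 1" using n by (intro divide_left_mono) auto
    finally show "real (nat \<lfloor>real n / l\<rfloor>) \<le> real n" by simp
  qed simp
  also have "\<dots> = 1 / real n" by (simp add: n_exp exp_minus field_simps flip: exp_add)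
  finally show ?thesis .
qed

lemma s0_bounds: "real n * ln l powr 1.5 / l \<le> real s0" "real n / l \<le> real s0" "l \<le> real s0" "0 < s0"
proof -
  show 1: "real n * ln l powr 1.5 / l \<le> real s0" unfolding s0_def by (rule real_nat_ceiling_ge)
  have "1 \<le> ln l powr 1.5" using n by (intro ge_one_powr_ge_zero) auto
  then have "real n * 1 / l \<le> real n * ln l powr 1.5 / l" using n by (intro divide_right_mono mult_left_mono) auto
  then show 2: "real n / l \<le> real s0" using 1 by simp
  have "l \<le> real n / l" using n by (simp add: pos_le_divide_eq power2_eq_square)
  then show "l \<le> real s0" using 2 by linarith
  then show "0 < s0" using n by linarith
qed

text \<open>Per element of the sets the gain is at least \<open>\<rho> / 2 * ln l powr 1.5\<close>
  and the entropy at most \<open>2 + 2 * ln l\<close>. The power 1.5 lets the gain win however small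
  the constant \<open>\<rho>\<close> is; the remaining \<open>exp (- s0)\<close> suffices as
  \<open>s0 \<ge> l\<close>.\<close>

lemma no_edges_small: "(exp 1 * real n / real s0) ^ (2 * s0) * exp (- (real s0)\<^sup>2 * p * real (4 * \<kappa>) / (2 * D2)) \<le> 1 / real n"
proof -
  note s0 = s0_bounds
  have "real n / real s0 \<le> l" using s0(2,4) n by (simp add: field_simps)
  also have "l = exp (ln l)" using n by simp
  finally have "exp 1 * (real n / real s0) \<le> exp 1 * exp (ln l)" by (intro mult_left_mono) auto
  then have "exp 1 * real n / real s0 \<le> exp (1 + ln l)" by (simp only: exp_add times_divide_eq_right)
  then have "(exp 1 * real n / real s0) ^ (2 * s0) \<le> exp (1 + ln l) ^ (2 * s0)"
    by (intro power_mono) auto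
  also have "\<dots> = exp (real s0 * (2 + 2 * ln l))" by (simp add: algebra_simps flip: exp_of_nat_mult)
  finally have A: "(exp 1 * real n / real s0) ^ (2 * s0) \<le> exp (real s0 * (2 + 2 * ln l))" .
  have "real s0 * (\<rho> / 2 * ln l powr 1.5) \<le> (real s0)\<^sup>2 * (real \<kappa> / real n)"
  proof -
    have "\<rho> / 2 * ln l powr 1.5 = real n * ln l powr 1.5 / l * (\<rho> * l / 2 / real n)"
      using n n_pos by simp
    also have "\<dots> \<le> real s0 * (real \<kappa> / real n)"
      using s0(1) kappa_bounds(1) rho n by (intro mult_mono divide_right_mono) auto
    finally have "real s0 * (\<rho> / 2 * ln l powr 1.5) \<le> real s0 * (real s0 * (real \<kappa> / real n))"
      by (intro mult_left_mono) auto
    then show ?thesis by (simp add: power2_eq_square)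
  qed
  also have "\<dots> \<le> (real s0)\<^sup>2 * (p * real (4 * \<kappa>) / (2 * D2))"
  proof (rule mult_left_mono)
    have D2: "0 < D2" "D2 \<le> 2 * x" using delta x_pos by (auto simp: D2_def)
    have "real \<kappa> / real n = p * real (4 * \<kappa>) / (2 * (2 * x))" using p_pos n_pos by (simp add: x field_simps)
    also have "\<dots> \<le> p * real (4 * \<kappa>) / (2 * D2)" using D2 p_pos by (intro divide_left_mono) auto
    finally show "real \<kappa> / real n \<le> p * real (4 * \<kappa>) / (2 * D2)" .
  qed simp
  finally have "real s0 * (3 + 2 * ln l) \<le> (real s0)\<^sup>2 * (p * real (4 * \<kappa>) / (2 * D2))"
    using n(7) mult_left_mono[OF n(7), of "real s0"] by linarith
  then have e: "real s0 * (2 + 2 * ln l) - (real s0)\<^sup>2 * p * real (4 * \<kappa>) / (2 * D2) \<le> - real s0"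
    by (simp add: algebra_simps)
  have "(exp 1 * real n / real s0) ^ (2 * s0) * exp (- (real s0)\<^sup>2 * p * real (4 * \<kappa>) / (2 * D2))
    \<le> exp (real s0 * (2 + 2 * ln l)) * exp (- (real s0)\<^sup>2 * p * real (4 * \<kappa>) / (2 * D2))"
    by (intro mult_right_mono A) auto
  also have "\<dots> = exp (real s0 * (2 + 2 * ln l) - (real s0)\<^sup>2 * p * real (4 * \<kappa>) / (2 * D2))"
    by (simp flip: exp_add)
  also have "\<dots> \<le> exp (- l)" using e s0(3) by simp
  also have "\<dots> = 1 / real n" by (simp add: n_exp exp_minus field_simps)
  finally show ?thesis .
qed

text \<open>\<open>22 = 10 + 9 + 1 + 1 + 1\<close> collects all estimates but
  \<open>few_visits_small\<close>, which has its own rate.\<close>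

lemma failure_small:
  assumes v0: "v0 \<in> {1..n}"
  shows "subset_mean p (all_edges n) (\<lambda>G. measure_pmf.prob (srw G L v0) {ys. \<not> (E1 \<beta> n (walk_edges ys) \<and> E2 n (walk_edges ys))})
    \<le> 22 / real n + 3 * exp (- (\<epsilon> / 2) * l)"
proof -
  have D2: "0 < D2" "D1 \<le> D2" using delta x_pos by (auto simp: D1_def D2_def)
  have "400 * 20 * l \<le> 400 * K * l" using K_ge n by (intro mult_right_mono) auto
  then have k: "4 * real \<kappa> \<le> D1" using kappa_bounds(3) D1_ge x_ge(1) n by linarith
  have lf: "ln (real n) = l" by (simp add: l)
  have q: "real i + real i * (\<beta> * ln (real n)) \<le> real (q i) \<and> q i \<le> n" if "i \<in> {1..nat \<lfloor>real n / ln (real n)\<rfloor>}" for i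
    using q_bounds(1,2)[of i] that unfolding lf by blast
  have pos: "0 \<le> \<beta> * ln (real n)" "0 < nat \<lceil>real n * ln (ln (real n)) powr 1.5 / ln (real n)\<rceil>"
    using n(4) s0_bounds(4) unfolding lf s0_def by linarith+
  have \<kappa>: "2 * real \<kappa> \<le> D1" "4 * real \<kappa> \<le> D2" using k D2 by linarith+
  note fb = failure_bound[OF p_pos p v0 D1_ge(2) D2(1) r_ok np_ok s_ok(1) a_def a_ok(1) kappa_bounds(4) \<kappa> q pos,
      where L = L, unfolded lf]
  show ?thesis
    using fb irregular_small many_visits_small few_visits_small few_distinct_small dense_sets_small no_edges_small[unfolded s0_def] by linarith
qed

end

section \<open>From the averaged failure probability to the nested statement\<close>

text \<open>Markov's inequality with threshold \<open>sqrt (b n)\<close>: graphs whose failure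
  probability exceeds it have total probability at most \<open>b n / sqrt (b n)\<close>, which is
  \<open>sqrt (b n)\<close> again. One sequence thus serves as the error at both levels.\<close>

lemma whp_whp_of_expectation:
  fixes p :: "nat \<Rightarrow> real" and K :: "nat \<Rightarrow> nat set set \<Rightarrow> 'b pmf"
  assumes p: "\<And>n. 0 \<le> p n \<and> p n \<le> 1"
    and ev: "\<forall>\<^sub>F n in sequentially. subset_mean (p n) (all_edges n) (\<lambda>G. measure_pmf.prob (K n G) {y. \<not> P n y}) \<le> b n"
    and b: "b \<longlonglongrightarrow> 0" "\<And>n. 0 < b n"
  shows "whp_whp (\<lambda>n. gnp n (p n)) K P"
  unfolding whp_whp_def
proof (intro exI conjI)
  let ?\<delta> = "\<lambda>n. sqrt (b n)"
  let ?f = "\<lambda>n G. measure_pmf.prob (K n G) {y. \<not> P n y}"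
  have s0: "?\<delta> \<longlonglongrightarrow> 0" using tendsto_real_sqrt[OF b(1)] by simp
  then show "?\<delta> \<longlonglongrightarrow> 0" .
  have compl: "measure_pmf.prob (K n G) {y. P n y} = 1 - ?f n G" for n G
    using measure_pmf.prob_compl[of "{y. \<not> P n y}" "K n G"] by (simp add: Compl_eq_Diff_UNIV[symmetric] Collect_neg_eq)
  have lower: "1 - ?\<delta> n \<le> measure_pmf.prob (gnp n (p n)) {G. 1 - ?\<delta> n \<le> measure_pmf.prob (K n G) {y. P n y}}"
    if e: "subset_mean (p n) (all_edges n) (?f n) \<le> b n" for n
  proof -
    have pn: "0 \<le> p n" "p n \<le> 1" using p by auto
    have "subset_mean (p n) (all_edges n) (\<lambda>G. 1 - ?f n G / ?\<delta> n)
       \<le> subset_mean (p n) (all_edges n) (\<lambda>G. of_bool (1 - ?\<delta> n \<le> measure_pmf.prob (K n G) {y. P n y}))"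
    proof (rule subset_mean_mono[OF pn])
      fix G
      have "1 \<le> ?f n G / ?\<delta> n" if "\<not> 1 - ?\<delta> n \<le> measure_pmf.prob (K n G) {y. P n y}"
        using that b(2)[of n] unfolding compl by (simp add: pos_le_divide_eq)
      moreover have "0 \<le> ?f n G / ?\<delta> n" using b(2)[of n] by simp
      ultimately show "1 - ?f n G / ?\<delta> n \<le> of_bool (1 - ?\<delta> n \<le> measure_pmf.prob (K n G) {y. P n y})"
        by (cases "1 - ?\<delta> n \<le> measure_pmf.prob (K n G) {y. P n y}") auto
    qed
    also have "\<dots> = measure_pmf.prob (gnp n (p n)) {G. 1 - ?\<delta> n \<le> measure_pmf.prob (K n G) {y. P n y}}"
      by (rule prob_gnp[OF pn, symmetric])
    finally have 1: "1 - subset_mean (p n) (all_edges n) (?f n) / ?\<delta> n \<le> \<dots>"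
      using subset_mean_cmult[of "p n" "all_edges n" "1 / ?\<delta> n" "?f n"] by (simp add: subset_mean_diff subset_mean_const finite_all_edges)
    have "subset_mean (p n) (all_edges n) (?f n) / ?\<delta> n \<le> b n / ?\<delta> n"
      using e b(2)[of n] by (intro divide_right_mono) auto
    also have "\<dots> = ?\<delta> n" using b(2)[of n] by (simp add: real_div_sqrt)
    finally show ?thesis using 1 by linarith
  qed
  show "whp (\<lambda>n. gnp n (p n)) (\<lambda>n G. measure_pmf.prob (K n G) {y. P n y} \<ge> 1 - ?\<delta> n)"
    unfolding whp_def
  proof (rule tendsto_sandwich[where h = "\<lambda>_. 1"])
    show "\<forall>\<^sub>F n in sequentially. 1 - ?\<delta> n \<le> measure_pmf.prob (gnp n (p n)) {G. 1 - ?\<delta> n \<le> measure_pmf.prob (K n G) {y. P n y}}"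
      using ev by eventually_elim (rule lower)
    show "(\<lambda>n. 1 - ?\<delta> n) \<longlonglongrightarrow> 1" using tendsto_diff[OF tendsto_const s0, of 1] by simp
  qed (auto intro!: always_eventually)
qed

theorem theorem3p1:
  "\<forall>\<epsilon>::real. \<epsilon> > 0 \<longrightarrow>
     (\<exists>C>0. \<exists>\<beta>>0. \<forall>(p :: nat \<Rightarrow> real) (v0 :: nat \<Rightarrow> nat).
        (\<forall>n. 0 \<le> p n \<and> p n \<le> 1) \<and>
        (\<forall>\<^sub>F n in sequentially. p n \<ge> C * (ln (real n) / real n)) \<and>
        (\<forall>n\<ge>1. v0 n \<in> {1..n}) \<longrightarrow>
        whp_whp (\<lambda>n. gnp n (p n))
          (\<lambda>n G. walk_trace G (v0 n) ((1 + \<epsilon>) * real n * ln (real n)))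
          (\<lambda>n \<Gamma>. E1 \<beta> n \<Gamma> \<and> E2 n \<Gamma>))"
proof (intro allI impI)
  fix \<epsilon> :: real assume eps: "0 < \<epsilon>"
  \<comment> \<open>This and the later constants come from \<open>\<epsilon>\<close> alone. The
    minimum keeps the relative errors small in absolute terms and also a small fraction of the
    surplus \<open>\<epsilon>\<close>.\<close>
  define \<delta> where "\<delta> = min (1 / 16) (\<epsilon> / (16 * (1 + \<epsilon>)))"
  have delta: "0 < \<delta>" "\<delta> \<le> 1 / 16" "\<delta> * (1 + \<epsilon>) \<le> \<epsilon> / 16"
  proof -
    have "\<delta> * (1 + \<epsilon>) \<le> \<epsilon> / (16 * (1 + \<epsilon>)) * (1 + \<epsilon>)" using eps by (intro mult_right_mono) (auto simp: \<delta>_def)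
    also have "\<dots> = \<epsilon> / 16" using eps by (simp add: divide_simps)
    finally show "\<delta> * (1 + \<epsilon>) \<le> \<epsilon> / 16" .
  qed (use eps in \<open>auto simp: \<delta>_def\<close>)
  define K where "K = 20 * (1 + \<epsilon>)"
  define s where "s = - ln \<delta>"
  have s: "0 \<le> s" using delta by (simp add: s_def)
  define \<rho> where "\<rho> = min 1 (\<epsilon> / (32 * (s + 1)))"
  have rho: "0 < \<rho>" "\<rho> \<le> 1" "4 * \<rho> * (s + 1) \<le> \<epsilon> / 8"
  proof -
    have "4 * \<rho> * (s + 1) \<le> 4 * (\<epsilon> / (32 * (s + 1))) * (s + 1)" using s by (intro mult_right_mono) (auto simp: \<rho>_def)
    also have "\<dots> = \<epsilon> / 8" using s by (simp add: divide_simps)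
    finally show "4 * \<rho> * (s + 1) \<le> \<epsilon> / 8" .
  qed (use eps s in \<open>auto simp: \<rho>_def\<close>)
  define C where "C = 400 * K / \<delta> + 8 / \<delta>\<^sup>2 + 7 * exp (3 / \<rho>)"
  define \<beta> where "\<beta> = exp (- 17 / \<rho>) / 2"
  have "0 < C" using eps delta by (auto simp: C_def K_def intro!: add_pos_pos)
  have "0 < \<beta>" by (simp add: \<beta>_def)
  have main: "whp_whp (\<lambda>n. gnp n (p n)) (\<lambda>n G. walk_trace G (v0 n) ((1 + \<epsilon>) * real n * ln (real n)))
          (\<lambda>n \<Gamma>. E1 \<beta> n \<Gamma> \<and> E2 n \<Gamma>)"
    if asm: "(\<forall>n. 0 \<le> p n \<and> p n \<le> 1) \<and>
        (\<forall>\<^sub>F n in sequentially. p n \<ge> C * (ln (real n) / real n)) \<and> (\<forall>n\<ge>1. v0 n \<in> {1..n})"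
    for p :: "nat \<Rightarrow> real" and v0 :: "nat \<Rightarrow> nat"
  proof -
    \<comment> \<open>The last summand makes \<open>b n > 0\<close> evident for every
      \<open>n\<close>, as dividing by \<open>sqrt (b n)\<close> requires.\<close>
    define b where "b n = 22 / real n + 3 * exp (- (\<epsilon> / 2) * ln (real n)) + 1 / (real n + 1)" for n
    show "whp_whp (\<lambda>n. gnp n (p n)) (\<lambda>n G. walk_trace G (v0 n) ((1 + \<epsilon>) * real n * ln (real n)))
          (\<lambda>n \<Gamma>. E1 \<beta> n \<Gamma> \<and> E2 n \<Gamma>)"
    proof (rule whp_whp_of_expectation)
      show "0 \<le> p n \<and> p n \<le> 1" for n using asm by blast
      show "0 < b n" for n unfolding b_def by (intro add_nonneg_pos add_nonneg_nonneg) auto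
      have "(\<lambda>n. 3 * exp (- (c * ln (real n)))) \<longlonglongrightarrow> 0" if "0 < c" for c :: real
        using that by real_asymp
      from this[of "\<epsilon> / 2"] have "(\<lambda>n. 3 * exp (- (\<epsilon> / 2 * ln (real n)))) \<longlonglongrightarrow> 0" using eps by linarith
      moreover have "(\<lambda>n. 22 / real n) \<longlonglongrightarrow> 0" "(\<lambda>n. 1 / (real n + 1)) \<longlonglongrightarrow> 0" by real_asymp+
      ultimately have "(\<lambda>n. 22 / real n + 3 * exp (- (\<epsilon> / 2 * ln (real n))) + 1 / (real n + 1)) \<longlonglongrightarrow> 0 + 0 + 0"
        by (intro tendsto_add)
      then show "b \<longlonglongrightarrow> 0" unfolding b_def by simp
      have "\<forall>\<^sub>F n in sequentially. p n \<ge> C * (ln (real n) / real n)" using asm by blast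
      moreover have "\<forall>\<^sub>F n::nat in sequentially. 4 \<le> n" by (rule eventually_ge_at_top)
      moreover have "\<forall>\<^sub>F n::nat in sequentially. 20 \<le> ln (real n)" by real_asymp
      moreover have "\<forall>\<^sub>F n::nat in sequentially. 2 \<le> \<rho> * ln (real n)" using rho(1) by real_asymp
      moreover have "\<forall>\<^sub>F n::nat in sequentially. 2 \<le> \<beta> * ln (real n)" using \<open>0 < \<beta>\<close> by real_asymp
      moreover have "\<forall>\<^sub>F n::nat in sequentially. (ln (real n))\<^sup>2 \<le> real n" by real_asymp
      moreover have "\<forall>\<^sub>F n::nat in sequentially. 1 \<le> ln (ln (real n))" by real_asymp
      moreover have "\<forall>\<^sub>F n::nat in sequentially. 3 + 2 * ln (ln (real n)) \<le> \<rho> / 2 * ln (ln (real n)) powr 1.5"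
        using rho(1) by real_asymp
      ultimately show "\<forall>\<^sub>F n in sequentially. subset_mean (p n) (all_edges n) (\<lambda>G. measure_pmf.prob
          (walk_trace G (v0 n) ((1 + \<epsilon>) * real n * ln (real n))) {\<Gamma>. \<not> (E1 \<beta> n \<Gamma> \<and> E2 n \<Gamma>)}) \<le> b n"
      proof eventually_elim
        fix n :: nat
        assume pn: "C * (ln (real n) / real n) \<le> p n" and n: "4 \<le> n" "20 \<le> ln (real n)" "2 \<le> \<rho> * ln (real n)"
          "2 \<le> \<beta> * ln (real n)" "(ln (real n))\<^sup>2 \<le> real n" "1 \<le> ln (ln (real n))"
          "3 + 2 * ln (ln (real n)) \<le> \<rho> / 2 * ln (ln (real n)) powr 1.5"
        have v: "v0 n \<in> {1..n}" and p1: "p n \<le> 1" using asm n(1) by auto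
        have "C * ln (real n) \<le> real n * p n" using pn n(1) by (simp add: field_simps)
        then have large: "large_n n (p n) \<epsilon> \<delta> K s \<rho> C \<beta> (ln (real n)) (real n * p n)"
          by (intro large_n.intro eps delta rho K_def s_def C_def \<beta>_def refl p1 n)
        from large_n.failure_small[OF large v]
        show "subset_mean (p n) (all_edges n) (\<lambda>G. measure_pmf.prob
          (walk_trace G (v0 n) ((1 + \<epsilon>) * real n * ln (real n))) {\<Gamma>. \<not> (E1 \<beta> n \<Gamma> \<and> E2 n \<Gamma>)}) \<le> b n"
          unfolding walk_trace_def large_n.L_def[OF large] b_def by (simp add: vimage_def add_increasing2)
      qed
    qed
  qed
  show "\<exists>C>0. \<exists>\<beta>>0. \<forall>(p :: nat \<Rightarrow> real) (v0 :: nat \<Rightarrow> nat).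
        (\<forall>n. 0 \<le> p n \<and> p n \<le> 1) \<and>
        (\<forall>\<^sub>F n in sequentially. p n \<ge> C * (ln (real n) / real n)) \<and>
        (\<forall>n\<ge>1. v0 n \<in> {1..n}) \<longrightarrow>
        whp_whp (\<lambda>n. gnp n (p n))
          (\<lambda>n G. walk_trace G (v0 n) ((1 + \<epsilon>) * real n * ln (real n)))
          (\<lambda>n \<Gamma>. E1 \<beta> n \<Gamma> \<and> E2 n \<Gamma>)"
    by (rule exI[of _ C], rule conjI[OF \<open>0 < C\<close>], rule exI[of _ \<beta>], rule conjI[OF \<open>0 < \<beta>\<close>],
        intro allI impI, rule main)
qed

end
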